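(* Let $G=SL(n,\mathbb{R})$, $n\ge3$. For any $t\in\mathbb{R}$ and $\delta\in\{+,-\}$, consider the unitary representation $\mathrm{Ind}_P^G(\lambda_t^{\delta})$. For each $E_{k,\ell}$ and each $\mathfrak{u}_{i,j}\in E_{k,\ell}$ there exist smooth vectors $f,g$ of $\mathrm{Ind}_P^G(\lambda_t^{\delta})$ which satisfy the cocycle equation $\mathfrak{u}_{i,j}f=\mathfrak{u}_{k,\ell}g$, while neither the equation $\mathfrak{u}_{k,\ell}\omega=f$ nor the equation $\mathfrak{u}_{i,j}\omega=g$ has a solution $\omega$ in the Hilbert space of $\mathrm{Ind}_P^G(\lambda_t^{\delta})$.
   Context: For $i\neq j$, $\mathfrak{u}_{i,j}\in\mathfrak{sl}(n,\mathbb{R})$ is the elementary matrix whose only nonzero entry is a $1$ in row $i$, column $j$, and $E_{k,\ell}=\{\mathfrak{u}_{i,j}:\ \mathfrak{u}_{i,j}\neq\mathfrak{u}_{k,\ell},\ [\mathfrak{u}_{i,j},\mathfrak{u}_{k,\ell}]=0,\ [\mathfrak{u}_{i,j},\mathfrak{u}_{\ell,k}]\neq0\}$, for $1\le k\neq\ell\le n$. $P$ is the maximal parabolic subgroup of $G$ stabilizing the line $\{(x,0,\dots,0)^\tau:x\in\mathbb{R}\}\subset\mathbb{R}^n$ ($\tau$ = transpose); its elements have the form $\begin{pmatrix}a&v\\0&A\end{pmatrix}$ with $a\in\mathbb{R}\setminus\{0\}$, $v^\tau\in\mathbb{R}^{n-1}$, $A\in GL(n-1,\mathbb{R})$. For $t\in\mathbb{R}$,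 $\lambda_t^{\pm}$ is the unitary character of $P$ given by $\lambda_t^{\pm}\begin{pmatrix}a&v\\0&A\end{pmatrix}=\varepsilon^{\pm}(a)|a|^{t\sqrt{-1}}$, with $\varepsilon^+(a)=1$, $\varepsilon^-(a)=\mathrm{sgn}(a)$. $\mathrm{Ind}_P^G$ denotes (normalized) unitary induction. For $X$ in the Lie algebra and a unitary representation $\pi$, $Xv:=d\pi(X)v$, where $d\pi(X)$ is the skew-adjoint generator of $t\mapsto\pi(\exp tX)$; the equations are understood in the Hilbert space of the representation. A vector $v$ is smooth if $x\mapsto\pi(x)v$ is $C^\infty$. *)

theory Defs
  imports "HOL-Analysis.Analysis"
begin

text \<open>
  The dimension \<open>n\<close> is \<open>CARD('n)\<close>; the linear order on \<open>'n\<close> only serves to single out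
  the first coordinate. The entry of \<open>A\<close> in row \<open>i\<close>, column \<open>j\<close> is \<open>A $ i $ j\<close>.
\<close>

definition first :: "'n::{finite,linorder}" where
  "first = Min UNIV"

type_synonym 'n sqmat = "((real, 'n) vec, 'n) vec"

definition SL :: "'n::finite sqmat set" where
  "SL = {A. det A = 1}"

definition elem_mat :: "'n::finite \<Rightarrow> 'n \<Rightarrow> 'n sqmat" where
  "elem_mat i j = (\<chi> a b. if a = i \<and> b = j then 1 else 0)"

definition lie_bracket :: "'n::finite sqmat \<Rightarrow> 'n sqmat \<Rightarrow> 'n sqmat" where
  "lie_bracket X Y = X ** Y - Y ** X"

definition E_set :: "'n::finite \<Rightarrow> 'n \<Rightarrow> 'n sqmat set" where
  "E_set k l = {elem_mat i j | i j. i \<noteq> j \<and> elem_mat i j \<noteq> elem_mat k l \<and>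
     lie_bracket (elem_mat i j) (elem_mat k l) = 0 \<and>
     lie_bracket (elem_mat i j) (elem_mat l k) \<noteq> 0}"

text \<open>The multiplication \<open>*\<close> on \<open>real^'n^'n\<close> is componentwise, so the library's \<open>exp\<close> does not
  provide the matrix exponential.\<close>

definition mat_exp :: "'n::finite sqmat \<Rightarrow> 'n sqmat" where
  "mat_exp X = (\<Sum>m. (1 / fact m) *\<^sub>R ((\<lambda>Y. X ** Y) ^^ m) (mat 1))"

definition P_par :: "'n::{finite,linorder} sqmat set" where
  "P_par = {p \<in> SL. (\<lambda>v. p *v v) ` span {axis first 1} = span {axis first 1}}"

datatype pol = Pol_plus | Pol_minus

fun eps :: "pol \<Rightarrow> real \<Rightarrow> real" where
  "eps Pol_plus a = 1"
| "eps Pol_minus a = sgn a"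

definition lam :: "pol \<Rightarrow> real \<Rightarrow> 'n::{finite,linorder} sqmat \<Rightarrow> complex" where
  "lam \<delta> t p = of_real (eps \<delta> (p $ first $ first)) *
     (of_real \<bar>p $ first $ first\<bar>) powr (of_real t * \<i>)"

text \<open>The modular function \<open>p \<mapsto> \<bar>det (Ad p)\<bar>\<close>, with \<open>Ad p\<close> acting on the nilradical of
  the Lie algebra of \<open>P\<close>. If \<open>p\<close> has diagonal blocks \<open>a\<close> and \<open>A\<close>, then \<open>Ad p\<close> is the map
  \<open>v \<mapsto> a v A\<inverse>\<close> on row vectors of length \<open>n - 1\<close>, whose determinant is
  \<open>a^(n-1) / det A = a^n\<close> because \<open>a det A = 1\<close>.\<close>

definition modular_P :: "'n::{finite,linorder} sqmat \<Rightarrow> real" where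
  "modular_P p = \<bar>p $ first $ first\<bar> ^ CARD('n)"

text \<open>
  \<open>nbar x\<close> parametrises the unipotent radical of the opposite parabolic, which is
  \<open>\<real>^(n-1)\<close>: the first column below the diagonal is \<open>x\<close>. For \<open>F\<close> in the induced space
  (see below), the equivariance makes \<open>\<bar>F\<bar>\<^sup>2\<close> a density on \<open>G/P\<close>; as \<open>x \<mapsto> nbar x P\<close> is a
  chart of \<open>G/P\<close> with null complement, the integral of that density is the Lebesgue integral of
  \<open>\<bar>F (nbar x)\<bar>\<^sup>2\<close>. It is the squared Hilbert norm of the induced representation, and
  up to a constant it equals the integral of \<open>\<bar>F\<bar>\<^sup>2\<close> over \<open>SO(n)\<close>.
\<close>

definition nbar :: "('n \<Rightarrow> real) \<Rightarrow> 'n::{finite,linorder} sqmat" where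
  "nbar x = (\<chi> a b. if a = b then 1 else if b = first then x a else 0)"

definition nrm2 :: "('n::{finite,linorder} sqmat \<Rightarrow> complex) \<Rightarrow> ennreal" where
  "nrm2 F = (\<integral>\<^sup>+ x. ennreal ((cmod (F (nbar x)))\<^sup>2) \<partial>(\<Pi>\<^sub>M i\<in>{i. i \<noteq> first}. lborel))"

text \<open>
  Normalised unitary induction from \<open>P\<close> to \<open>G = SL(n, \<real>)\<close>. The Hilbert space consists of the
  classes of functions in \<open>Ind_space \<xi>\<close> modulo those of norm \<open>0\<close>; we work with
  representatives, so that equality of vectors \<open>F\<close> and \<open>F'\<close> means
  \<open>nrm2 (\<lambda>g. F g - F' g) = 0\<close>. Functions are defined on all matrices, but only their values on
  \<open>SL\<close> matter. The action is by left translation.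
\<close>

definition Ind_space ::
  "('n::{finite,linorder} sqmat \<Rightarrow> complex) \<Rightarrow> ('n sqmat \<Rightarrow> complex) set" where
  "Ind_space \<xi> = {F. F \<in> borel_measurable (restrict_space borel SL) \<and>
     (\<forall>g\<in>SL. \<forall>p\<in>P_par.
        F (g ** p) = of_real (modular_P p powr (- 1 / 2)) * inverse (\<xi> p) * F g) \<and>
     nrm2 F < \<infinity>}"

definition Ind_act ::
  "'n::{finite,linorder} sqmat \<Rightarrow> ('n sqmat \<Rightarrow> complex) \<Rightarrow> 'n sqmat \<Rightarrow> complex" where
  "Ind_act x F = (\<lambda>g. F (matrix_inv x ** g))"

text \<open>\<open>dInd \<xi> X F H\<close>: the vector \<open>F\<close> lies in the domain of the skew-adjoint generator
  \<open>d\<pi>(X)\<close> of \<open>s \<mapsto> \<pi>(exp (s X))\<close>, \<open>\<pi> = Ind \<xi>\<close>, and \<open>d\<pi>(X) F = H\<close>.\<close>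

definition dInd ::
  "('n::{finite,linorder} sqmat \<Rightarrow> complex) \<Rightarrow> 'n sqmat \<Rightarrow>
   ('n sqmat \<Rightarrow> complex) \<Rightarrow> ('n sqmat \<Rightarrow> complex) \<Rightarrow> bool" where
  "dInd \<xi> X F H \<longleftrightarrow> F \<in> Ind_space \<xi> \<and> H \<in> Ind_space \<xi> \<and>
     ((\<lambda>s. nrm2 (\<lambda>g. (Ind_act (mat_exp (s *\<^sub>R X)) F g - F g) / of_real s - H g)) \<longlongrightarrow> 0) (at (0::real))"

text \<open>\<open>C\<^sup>\<infinity>\<close> for maps from an open set \<open>U\<close> of a Euclidean space to the Hilbert space: all iterated
  partial derivatives exist and are continuous on \<open>U\<close>. \<open>D bs\<close> is the iterated partial
  derivative of \<open>\<Phi>\<close> along the list \<open>bs\<close> of basis vectors.\<close>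

definition Ind_smooth_on ::
  "('n::{finite,linorder} sqmat \<Rightarrow> complex) \<Rightarrow> 'e::euclidean_space set \<Rightarrow>
   ('e \<Rightarrow> 'n sqmat \<Rightarrow> complex) \<Rightarrow> bool" where
  "Ind_smooth_on \<xi> U \<Phi> \<longleftrightarrow> (\<exists>D. D [] = \<Phi> \<and>
     (\<forall>bs. set bs \<subseteq> Basis \<longrightarrow> (\<forall>y\<in>U.
        D bs y \<in> Ind_space \<xi> \<and>
        ((\<lambda>z. nrm2 (\<lambda>g. D bs z g - D bs y g)) \<longlongrightarrow> 0) (at y) \<and>
        (\<forall>b\<in>Basis.
          ((\<lambda>h. nrm2 (\<lambda>g. (D bs (y + h *\<^sub>R b) g - D bs y g) / of_real h - D (b # bs) y g))
             \<longlongrightarrow> 0) (at (0::real))))))"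

text \<open>A vector \<open>F\<close> is smooth if \<open>x \<mapsto> \<pi>(x) F\<close> is \<open>C\<^sup>\<infinity>\<close> on \<open>G\<close>. As \<open>G\<close> is an embedded
  submanifold of the space of matrices, this means that the map locally extends to a \<open>C\<^sup>\<infinity>\<close>
  map on an open set of matrices.\<close>

definition Ind_smooth_vector ::
  "('n::{finite,linorder} sqmat \<Rightarrow> complex) \<Rightarrow> ('n sqmat \<Rightarrow> complex) \<Rightarrow> bool" where
  "Ind_smooth_vector \<xi> F \<longleftrightarrow> F \<in> Ind_space \<xi> \<and>
     (\<forall>x\<in>SL. \<exists>U \<Phi>. open U \<and> x \<in> U \<and> Ind_smooth_on \<xi> U \<Phi> \<and>
        (\<forall>y\<in>U \<inter> SL. nrm2 (\<lambda>g. \<Phi> y g - Ind_act y F g) = 0))"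

end

theory Submission
  imports Defs
begin

text \<open>
  A vector of the induced representation is a function \<open>\<phi>\<close> on \<open>\<real>\<^sup>n - {0}\<close>, homogeneous of degree
  \<open>- n/2 - it\<close> and of parity \<open>\<delta>\<close>, and \<open>u\<^sub>i\<^sub>j\<close> acts by \<open>- v\<^sub>j \<partial>\<^sub>i\<close>. The members of \<open>E\<^sub>k\<^sub>l\<close> are
  the \<open>u\<^sub>k\<^sub>j\<close> with \<open>j \<noteq> l\<close> and the \<open>u\<^sub>i\<^sub>l\<close> with \<open>i \<noteq> k\<close>. For \<open>u\<^sub>k\<^sub>j\<close> take \<open>f = v\<^sub>l \<psi>\<close> and
  \<open>g = v\<^sub>j \<psi>\<close>: a solution of either equation satisfies \<open>\<partial>\<^sub>k \<omega> = - \<psi>\<close>, which is impossible in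
  \<open>L\<^sup>2\<close> if the integrals of \<open>\<psi>\<close> along the lines in direction \<open>e\<^sub>k\<close> do not vanish; for
  \<open>\<psi> = v\<^sub>l\<^sup>m \<bar>v\<bar>\<^bsup>-n/2-1-m-it\<^esup>\<close> a large \<open>m\<close> prevents cancellation. For \<open>u\<^sub>i\<^sub>l\<close> take
  \<open>f = \<partial>\<^sub>k \<psi>\<close> and \<open>g = \<partial>\<^sub>i \<psi>\<close>: formally \<open>\<omega> = - \<psi> / v\<^sub>l\<close>, which is not square integrable
  near \<open>v\<^sub>l = 0\<close>. Both obstructions are made rigorous by unitarity: if \<open>X \<omega> = f\<close>, the integrals of
  \<open>\<pi>(exp rX) f\<close> over \<open>r \<in> [0, T]\<close> have norm at most \<open>2 \<bar>\<omega>\<bar>\<close>, but for these \<open>f\<close> and \<open>g\<close> they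
  are unbounded.
\<close>

section \<open>Homogeneous densities\<close>

text \<open>A solution \<omega> is only a class in the Hilbert space, with no regularity, so it
  cannot be found or excluded by integrating the equation line by line. The bound on orbit integrals
  removes \<omega>: what remains is a statement about f, whose orbit integrals are again continuous
  and homogeneous and can be estimated on explicit boxes. Near v_l = 0 they have size T on a box of
  volume 1/T; along the lines in direction e_k they stay above a constant on a box of length T.
  Either way the squared norm grows like T. The norm is computed in the chart v_first = 1, while k,
  l, i, j lie anywhere with respect to \<open>first\<close>. Treating |F|^2 as a density of degree
  -n on R^n makes unitarity and the box estimates independent of the chart. A large m helps because
  it concentrates the profile (1 + \<sigma>^2)^(-L/2) where the phase (t/2) ln(1 + \<sigma>^2)
  coming from |v|^(-it) is still small. For u_il, the function \<psi> has degree 1 - n/2 - it; it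
  decays at infinity because n \<ge> 3.\<close>

abbreviation lebn :: "'n set \<Rightarrow> ('n \<Rightarrow> real) measure" where
  "lebn I \<equiv> \<Pi>\<^sub>M i\<in>I. lborel"

interpretation lborel_product: product_sigma_finite "\<lambda>_::'n. lborel :: real measure"
  by standard

lemma nn_integral_lebn_insert:
  assumes "finite I" "i \<notin> I" "f \<in> borel_measurable (lebn (insert i I))"
  shows "(\<integral>\<^sup>+x. f x \<partial>lebn (insert i I)) = (\<integral>\<^sup>+x. \<integral>\<^sup>+y. f (x(i := y)) \<partial>lborel \<partial>lebn I)"
    and "(\<integral>\<^sup>+x. f x \<partial>lebn (insert i I)) = (\<integral>\<^sup>+y. \<integral>\<^sup>+x. f (x(i := y)) \<partial>lebn I \<partial>lborel)"
  using lborel_product.product_nn_integral_insert[OF assms]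
    lborel_product.product_nn_integral_insert_rev[OF assms] by auto

lemma nn_integral_lebn_UNIV:
  fixes f :: "('n::finite \<Rightarrow> real) \<Rightarrow> ennreal"
  assumes "f \<in> borel_measurable (lebn UNIV)"
  shows "(\<integral>\<^sup>+x. f x \<partial>lebn UNIV) = (\<integral>\<^sup>+x. \<integral>\<^sup>+y. f (x(i := y)) \<partial>lborel \<partial>lebn (- {i}))"
    and "(\<integral>\<^sup>+x. f x \<partial>lebn UNIV) = (\<integral>\<^sup>+y. \<integral>\<^sup>+x. f (x(i := y)) \<partial>lebn (- {i}) \<partial>lborel)"
proof -
  have *: "insert i (- {i}) = (UNIV :: 'n set)" by auto
  show "(\<integral>\<^sup>+x. f x \<partial>lebn UNIV) = (\<integral>\<^sup>+x. \<integral>\<^sup>+y. f (x(i := y)) \<partial>lborel \<partial>lebn (- {i}))"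
    "(\<integral>\<^sup>+x. f x \<partial>lebn UNIV) = (\<integral>\<^sup>+y. \<integral>\<^sup>+x. f (x(i := y)) \<partial>lebn (- {i}) \<partial>lborel)"
    using nn_integral_lebn_insert[of "- {i}" i f] assms unfolding * by auto
qed

lemma nn_integral_lebn_scale:
  assumes "finite I" "c \<noteq> 0" "f \<in> borel_measurable (lebn I)"
  shows "(\<integral>\<^sup>+x. f x \<partial>lebn I) =
    ennreal (\<bar>c\<bar> ^ card I) * (\<integral>\<^sup>+x. f (\<lambda>i\<in>I. c * x i) \<partial>lebn I)"
  using assms
proof (induction I arbitrary: f rule: finite_induct)
  case empty
  then show ?case by (simp add: PiM_empty restrict_def nn_integral_count_space_finite)
next
  case (insert i I)
  note [measurable] = insert.prems(2)
  have upd: "(\<lambda>(x, y). f (x(i := y))) \<in> borel_measurable (lebn I \<Otimes>\<^sub>M lborel)"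
    by measurable
  have *: "(\<lambda>j\<in>insert i I. c * (x(i := y)) j) = (\<lambda>j\<in>I. c * x j)(i := c * y)" for x y
    using insert.hyps by (auto simp: restrict_def fun_eq_iff)
  have m: "(\<lambda>x. f (\<lambda>j\<in>insert i I. c * x j)) \<in> borel_measurable (lebn (insert i I))"
    by measurable
  have "(\<integral>\<^sup>+x. f x \<partial>lebn (insert i I)) = (\<integral>\<^sup>+x. \<integral>\<^sup>+y. f (x(i := y)) \<partial>lborel \<partial>lebn I)"
    using insert by (intro nn_integral_lebn_insert) auto
  also have "\<dots> = (\<integral>\<^sup>+x. ennreal \<bar>c\<bar> * (\<integral>\<^sup>+y. f (x(i := c * y)) \<partial>lborel) \<partial>lebn I)"
  proof (rule nn_integral_cong)
    fix x assume "x \<in> space (lebn I)"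
    then have "(\<lambda>y. f (x(i := y))) \<in> borel_measurable lborel"
      using measurable_Pair2[OF upd] by simp
    then show "(\<integral>\<^sup>+y. f (x(i := y)) \<partial>lborel) = ennreal \<bar>c\<bar> * (\<integral>\<^sup>+y. f (x(i := c * y)) \<partial>lborel)"
      using insert.prems by (subst nn_integral_real_affine[where t = 0 and c = c]) auto
  qed
  also have "\<dots> = ennreal (\<bar>c\<bar> ^ card I) * (\<integral>\<^sup>+x. ennreal \<bar>c\<bar> *
      (\<integral>\<^sup>+y. f ((\<lambda>j\<in>I. c * x j)(i := c * y)) \<partial>lborel) \<partial>lebn I)"
    using insert.prems by (subst insert.IH) auto
  also have "\<dots> = ennreal (\<bar>c\<bar> ^ card I) * ennreal \<bar>c\<bar> * (\<integral>\<^sup>+x.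
      (\<integral>\<^sup>+y. f ((\<lambda>j\<in>I. c * x j)(i := c * y)) \<partial>lborel) \<partial>lebn I)"
    by (subst nn_integral_cmult) (auto simp: mult_ac)
  also have "\<dots> = ennreal (\<bar>c\<bar> ^ card (insert i I)) *
      (\<integral>\<^sup>+x. f (\<lambda>j\<in>insert i I. c * x j) \<partial>lebn (insert i I))"
    unfolding nn_integral_lebn_insert(1)[OF insert.hyps m] *
    using insert.hyps by (simp add: ennreal_mult'' mult.commute)
  finally show ?case .
qed

lemma nn_integral_lebn_shear:
  fixes f :: "('n::finite \<Rightarrow> real) \<Rightarrow> ennreal"
  assumes [measurable]: "f \<in> borel_measurable (lebn UNIV)" and "i \<noteq> j"
  shows "(\<integral>\<^sup>+v. f (v(i := v i - s * v j)) \<partial>lebn UNIV) = (\<integral>\<^sup>+v. f v \<partial>lebn UNIV)"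
proof -
  have upd: "(\<lambda>(x, y). f (x(i := y))) \<in> borel_measurable (lebn (- {i}) \<Otimes>\<^sub>M lborel)"
  proof -
    have "(\<lambda>(x, y). x(i := y)) \<in> lebn (- {i}) \<Otimes>\<^sub>M lborel \<rightarrow>\<^sub>M lebn (insert i (- {i}))"
      by measurable
    also have "insert i (- {i}) = UNIV" by auto
    finally show ?thesis using assms(1) by measurable
  qed
  have m: "(\<lambda>v. f (v(i := v i - s * v j))) \<in> borel_measurable (lebn UNIV)"
  proof -
    have "(\<lambda>v. v(i := v i - s * v j)) \<in> lebn UNIV \<rightarrow>\<^sub>M lebn UNIV"
      by (rule measurable_PiM_single') (auto simp: space_PiM)
    then show ?thesis by measurable
  qed
  have "(\<integral>\<^sup>+y. f (x(i := y)) \<partial>lborel) = (\<integral>\<^sup>+y. f (x(i := y - s * x j)) \<partial>lborel)"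
    if "x \<in> space (lebn (- {i}))" for x
  proof -
    have "(\<lambda>y. f (x(i := y))) \<in> borel_measurable lborel"
      using measurable_Pair2[OF upd that] by simp
    then show ?thesis
      by (subst nn_integral_real_affine[where t = "- s * x j" and c = 1]) auto
  qed
  then show ?thesis
    using nn_integral_lebn_UNIV(1)[OF m, of i] nn_integral_lebn_UNIV(1)[OF assms(1), of i] \<open>i \<noteq> j\<close>
    by (simp cong: nn_integral_cong_simp)
qed

text \<open>Degree -n makes q(v) dv invariant under dilations, so q is a density on projective
  space; its integral over the affine chart v_m = 1 is the total mass.\<close>

definition hom_density :: "(('n::finite \<Rightarrow> real) \<Rightarrow> ennreal) \<Rightarrow> bool" where
  "hom_density q \<longleftrightarrow> q \<in> borel_measurable (lebn UNIV) \<and>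
     (\<forall>r v. r \<noteq> 0 \<longrightarrow> ennreal (\<bar>r\<bar> ^ CARD('n)) * q (\<lambda>i. r * v i) = q v)"

lemma measurable_upd_UNIV [measurable]:
  "(\<lambda>(x, y). x(i := y)) \<in> lebn (- {i}) \<Otimes>\<^sub>M lborel \<rightarrow>\<^sub>M lebn (UNIV :: 'n::finite set)"
proof -
  have "(\<lambda>(x, y). x(i := y)) \<in> lebn (- {i}) \<Otimes>\<^sub>M lborel \<rightarrow>\<^sub>M lebn (insert i (- {i}))"
    by measurable
  also have "insert i (- {i}) = UNIV" by auto
  finally show ?thesis .
qed

lemma measurable_upd_const [measurable]:
  "(\<lambda>x. x(i := c)) \<in> lebn (- {i}) \<rightarrow>\<^sub>M lebn (UNIV :: 'n::finite set)"
  using measurable_compose[OF measurable_Pair[OF measurable_ident_sets[OF refl] measurable_const[of c]] measurable_upd_UNIV[of i]]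
  by simp

lemma measurable_scale_UNIV [measurable]:
  "(\<lambda>(r, v). (\<lambda>i. r * v i)) \<in> borel \<Otimes>\<^sub>M lebn UNIV \<rightarrow>\<^sub>M lebn (UNIV :: 'n::finite set)"
  by (rule measurable_PiM_single') (auto simp: space_PiM case_prod_beta')

text \<open>In the coordinates v = r w with w_m = 1, dv is |r|^(n-1) dr dw and q(v) = |r|^(-n) q(w).
  The two powers leave dr/|r|, so a weight \<eta> is seen from the chart only through its
  logarithmic integral along each line through the origin.\<close>

lemma nn_integral_lebn_rays:
  fixes q \<eta> :: "('n::finite \<Rightarrow> real) \<Rightarrow> ennreal"
  assumes q: "hom_density q" and \<eta>[measurable]: "\<eta> \<in> borel_measurable (lebn UNIV)"
  shows "(\<integral>\<^sup>+v. q v * \<eta> v \<partial>lebn UNIV) =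
    (\<integral>\<^sup>+x. q (x(m := 1)) * (\<integral>\<^sup>+r. \<eta> (\<lambda>i. r * (x(m := 1)) i) * ennreal (1 / \<bar>r\<bar>) \<partial>lborel) \<partial>lebn (- {m}))"
proof -
  have [measurable]: "q \<in> borel_measurable (lebn UNIV)"
    using q by (simp add: hom_density_def)
  let ?I = "- {m}"
  have card: "CARD('n) = Suc (card ?I)"
    by (metis Compl_eq_Diff_UNIV UNIV_I card_Suc_Diff1 finite)
  interpret pair_sigma_finite "lebn ?I" "lborel :: real measure"
    by (simp add: lborel_product.sigma_finite pair_sigma_finite.intro sigma_finite_lborel)
  have [measurable]: "(\<lambda>(x, r). \<eta> (\<lambda>i. r * (x(m := 1)) i)) \<in> borel_measurable (lebn ?I \<Otimes>\<^sub>M lborel)"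
  proof -
    have "(\<lambda>z. (snd z, (fst z)(m := 1))) \<in> lebn ?I \<Otimes>\<^sub>M lborel \<rightarrow>\<^sub>M borel \<Otimes>\<^sub>M lebn UNIV"
      by measurable
    from measurable_compose[OF measurable_compose[OF this measurable_scale_UNIV] \<eta>]
    show ?thesis by (simp add: case_prod_beta')
  qed
  have "(\<integral>\<^sup>+v. q v * \<eta> v \<partial>lebn UNIV) =
    (\<integral>\<^sup>+r. \<integral>\<^sup>+x. q (x(m := r)) * \<eta> (x(m := r)) \<partial>lebn ?I \<partial>lborel)"
    by (subst nn_integral_lebn_UNIV(2)[of _ m]) auto
  also have "\<dots> = (\<integral>\<^sup>+r. \<integral>\<^sup>+x. q (x(m := 1)) * (\<eta> (\<lambda>i. r * (x(m := 1)) i) * ennreal (1 / \<bar>r\<bar>)) \<partial>lebn ?I \<partial>lborel)"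
  proof (rule nn_integral_cong_AE)
    have "AE r in lborel. r \<noteq> (0::real)"
      by (rule AE_lborel_singleton)
    then show "AE r in lborel. (\<integral>\<^sup>+x. q (x(m := r)) * \<eta> (x(m := r)) \<partial>lebn ?I) =
      (\<integral>\<^sup>+x. q (x(m := 1)) * (\<eta> (\<lambda>i. r * (x(m := 1)) i) * ennreal (1 / \<bar>r\<bar>)) \<partial>lebn ?I)"
    proof eventually_elim
      case (elim r)
      let ?h = "\<lambda>x. q (x(m := r)) * \<eta> (x(m := r))"
      have [measurable]: "?h \<in> borel_measurable (lebn ?I)" by measurable
      have eq: "(\<lambda>i\<in>?I. r * x i)(m := r) = (\<lambda>i. r * (x(m := 1)) i)" for x
        by auto
      have [measurable]: "(\<lambda>x. (\<lambda>i\<in>?I. r * x i)) \<in> lebn ?I \<rightarrow>\<^sub>M lebn ?I"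
        by (rule measurable_restrict) simp
      have "(\<integral>\<^sup>+x. ?h x \<partial>lebn ?I) = ennreal (\<bar>r\<bar> ^ card ?I) * (\<integral>\<^sup>+x. ?h (\<lambda>i\<in>?I. r * x i) \<partial>lebn ?I)"
        using elim by (intro nn_integral_lebn_scale) auto
      also have "\<dots> = (\<integral>\<^sup>+x. ennreal (\<bar>r\<bar> ^ card ?I) * ?h (\<lambda>i\<in>?I. r * x i) \<partial>lebn ?I)"
        by (rule nn_integral_cmult[symmetric]) measurable
      also have "\<dots> = (\<integral>\<^sup>+x. q (x(m := 1)) * (\<eta> (\<lambda>i. r * (x(m := 1)) i) * ennreal (1 / \<bar>r\<bar>)) \<partial>lebn ?I)"
      proof (rule nn_integral_cong)
        fix x
        have 1: "ennreal (\<bar>r\<bar> ^ card ?I) = ennreal (1 / \<bar>r\<bar>) * ennreal (\<bar>r\<bar> ^ CARD('n))"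
          using elim by (subst ennreal_mult'[symmetric]) (auto simp: card)
        have "q (x(m := 1)) = ennreal (\<bar>r\<bar> ^ CARD('n)) * q (\<lambda>i. r * (x(m := 1)) i)"
          using q elim unfolding hom_density_def by metis
        then show "ennreal (\<bar>r\<bar> ^ card ?I) * ?h (\<lambda>i\<in>?I. r * x i) =
          q (x(m := 1)) * (\<eta> (\<lambda>i. r * (x(m := 1)) i) * ennreal (1 / \<bar>r\<bar>))"
          unfolding eq 1 by (simp add: mult_ac)
      qed
      finally show ?case .
    qed
  qed
  also have "\<dots> = (\<integral>\<^sup>+x. \<integral>\<^sup>+r. q (x(m := 1)) * (\<eta> (\<lambda>i. r * (x(m := 1)) i) * ennreal (1 / \<bar>r\<bar>)) \<partial>lborel \<partial>lebn ?I)"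
    by (rule Fubini') measurable
  also have "\<dots> = (\<integral>\<^sup>+x. q (x(m := 1)) * (\<integral>\<^sup>+r. \<eta> (\<lambda>i. r * (x(m := 1)) i) * ennreal (1 / \<bar>r\<bar>) \<partial>lborel) \<partial>lebn ?I)"
    by (intro nn_integral_cong nn_integral_cmult) measurable
  finally show ?thesis .
qed

text \<open>Its value is 2 ln 2, the logarithmic length of the shell on a line through the origin.
  Being positive and finite, it can be cancelled.\<close>

definition ray_const :: ennreal where
  "ray_const = (\<integral>\<^sup>+r. indicator {1..2} \<bar>r\<bar> * ennreal (1 / \<bar>r\<bar>) \<partial>lborel)"

lemma ray_const_finite: "ray_const < \<infinity>"
proof -
  have "ray_const \<le> (\<integral>\<^sup>+r. indicator {-2..2::real} r \<partial>lborel)"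
    unfolding ray_const_def
    by (intro nn_integral_mono) (auto simp: indicator_def intro!: ennreal_leI)
  also have "\<dots> < \<infinity>" by simp
  finally show ?thesis .
qed

lemma ray_const_pos: "ray_const > 0"
proof -
  have "0 < ennreal (1/2) * (\<integral>\<^sup>+r. indicator {1..2::real} r \<partial>lborel)"
    unfolding ennreal_zero_less_mult_iff ennreal_less_zero_iff by simp
  also have "\<dots> = (\<integral>\<^sup>+r. ennreal (1/2) * indicator {1..2::real} r \<partial>lborel)"
    by (rule nn_integral_cmult[symmetric]) simp
  also have "\<dots> \<le> ray_const"
    unfolding ray_const_def
  proof (rule nn_integral_mono)
    fix r :: real
    have "ennreal (1/2) \<le> ennreal (1 / \<bar>r\<bar>)" if "r \<in> {1..2}"
      using that by (intro ennreal_leI) (auto simp: field_simps)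
    then show "ennreal (1/2) * indicator {1..2::real} r \<le> indicator {1..2} \<bar>r\<bar> * ennreal (1 / \<bar>r\<bar>)"
      by (cases "r \<in> {1..2}") auto
  qed
  finally show ?thesis .
qed

text \<open>dr/|r| is the Haar measure of the multiplicative group. Hence the shell weight of a line
  does not depend on the vector chosen to span it.\<close>

lemma nn_integral_ray:
  fixes c :: real and h :: "real \<Rightarrow> ennreal"
  assumes "c \<noteq> 0" "h \<in> borel_measurable borel"
  shows "(\<integral>\<^sup>+r. h (c * r) * ennreal (1 / \<bar>r\<bar>) \<partial>lborel) = (\<integral>\<^sup>+r. h r * ennreal (1 / \<bar>r\<bar>) \<partial>lborel)"
proof -
  note [measurable] = assms(2)
  have "(\<integral>\<^sup>+r. h r * ennreal (1 / \<bar>r\<bar>) \<partial>lborel) =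
    ennreal \<bar>c\<bar> * (\<integral>\<^sup>+r. h (c * r) * ennreal (1 / \<bar>c * r\<bar>) \<partial>lborel)"
    using assms(1) by (subst nn_integral_real_affine[where c = c and t = 0]) auto
  also have "\<dots> = (\<integral>\<^sup>+r. ennreal \<bar>c\<bar> * (h (c * r) * ennreal (1 / \<bar>c * r\<bar>)) \<partial>lborel)"
    by (rule nn_integral_cmult[symmetric]) measurable
  also have "\<dots> = (\<integral>\<^sup>+r. h (c * r) * ennreal (1 / \<bar>r\<bar>) \<partial>lborel)"
  proof (rule nn_integral_cong)
    fix r
    have "ennreal \<bar>c\<bar> * ennreal (1 / \<bar>c * r\<bar>) = ennreal (1 / \<bar>r\<bar>)"
      using assms(1) by (subst ennreal_mult'[symmetric]) (auto simp: abs_mult)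
    then show "ennreal \<bar>c\<bar> * (h (c * r) * ennreal (1 / \<bar>c * r\<bar>)) = h (c * r) * ennreal (1 / \<bar>r\<bar>)"
      by (metis mult.left_commute)
  qed
  finally show ?thesis ..
qed

lemma nn_integral_shell_ray:
  fixes w :: "'n::finite \<Rightarrow> real"
  assumes "w \<noteq> (\<lambda>_. 0)"
  shows "(\<integral>\<^sup>+r. indicator {1..2} (\<Sum>i\<in>UNIV. \<bar>r * w i\<bar>) * ennreal (1 / \<bar>r\<bar>) \<partial>lborel) = ray_const"
proof -
  let ?N = "\<Sum>i\<in>UNIV. \<bar>w i\<bar>"
  have "?N \<noteq> 0" using assms by (subst sum_nonneg_eq_0_iff) auto
  moreover have "(\<Sum>i\<in>UNIV. \<bar>r * w i\<bar>) = \<bar>?N * r\<bar>" for r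
    by (simp add: abs_mult sum_nonneg mult.commute flip: sum_distrib_left)
  ultimately show ?thesis
    using nn_integral_ray[of ?N "\<lambda>r. indicator {1..2} \<bar>r\<bar>"] by (simp add: ray_const_def)
qed

text \<open>Integrating a homogeneous density over the shell \<open>1 \<le> \<bar>v\<bar> \<le> 2\<close> instead of over
  an affine chart makes the invariance under \<open>SL\<close> visible: the weight of every ray is the same
  constant for the shell and for its images under linear maps.\<close>

lemma nn_integral_hom_density_shear:
  fixes q :: "('n::finite \<Rightarrow> real) \<Rightarrow> ennreal"
  assumes q: "hom_density q" and "i \<noteq> j"
  shows "(\<integral>\<^sup>+x. q ((x(m := 1))(i := (x(m := 1)) i - s * (x(m := 1)) j)) \<partial>lebn (- {m})) =
    (\<integral>\<^sup>+x. q (x(m := 1)) \<partial>lebn (- {m}))"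
proof -
  have [measurable]: "q \<in> borel_measurable (lebn UNIV)"
    using q by (simp add: hom_density_def)
  let ?S = "\<lambda>s v. v(i := v i - s * v j)"
  have S[measurable]: "?S s \<in> lebn UNIV \<rightarrow>\<^sub>M lebn UNIV" for s :: real
    by (rule measurable_PiM_single') (auto simp: space_PiM)
  have hS: "?S s (\<lambda>i. r * v i) = (\<lambda>i. r * ?S s v i)" for s r and v :: "'n \<Rightarrow> real"
    by (auto simp: fun_eq_iff algebra_simps)
  have qS: "hom_density (\<lambda>v. q (?S s v))"
  proof -
    have "(\<lambda>v. q (?S s v)) \<in> borel_measurable (lebn UNIV)" by measurable
    then show ?thesis using q unfolding hom_density_def hS by blast
  qed
  define \<eta> :: "('n \<Rightarrow> real) \<Rightarrow> ennreal" where "\<eta> v = indicator {1..2} (\<Sum>i\<in>UNIV. \<bar>v i\<bar>)" for v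
  have [measurable]: "\<eta> \<in> borel_measurable (lebn UNIV)" unfolding \<eta>_def by measurable
  have ray: "(\<integral>\<^sup>+r. \<eta> (\<lambda>i. r * w i) * ennreal (1 / \<bar>r\<bar>) \<partial>lborel) = ray_const"
    if "w \<noteq> (\<lambda>_. 0)" for w
    using nn_integral_shell_ray[OF that] unfolding \<eta>_def by simp
  have nz: "x(m := 1) \<noteq> (\<lambda>_. 0)" for x :: "'n \<Rightarrow> real"
    by (metis fun_upd_same zero_neq_one)
  have Sinv: "?S (-s) (?S s v) = v" for s and v :: "'n \<Rightarrow> real" using \<open>i \<noteq> j\<close> by auto
  have nzS: "?S (-s) (x(m := 1)) \<noteq> (\<lambda>_. 0)" for x :: "'n \<Rightarrow> real"
  proof
    assume "?S (-s) (x(m := 1)) = (\<lambda>_. 0)"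
    then have "?S s (?S (-s) (x(m := 1))) = ?S s (\<lambda>_. 0)" by simp
    then have "x(m := 1) = (\<lambda>_. 0)" using Sinv[of "x(m := 1)" "-s"] by (auto simp: fun_eq_iff)
    then show False using nz by blast
  qed
  have "ray_const * (\<integral>\<^sup>+x. q (?S s (x(m := 1))) \<partial>lebn (- {m})) =
      (\<integral>\<^sup>+x. q (?S s (x(m := 1))) * ray_const \<partial>lebn (- {m}))"
  proof -
    have "(\<lambda>x. q (?S s (x(m := 1)))) \<in> borel_measurable (lebn (- {m}))"
      by (rule measurable_compose[OF measurable_upd_const]) measurable
    from nn_integral_multc[OF this, of ray_const] show ?thesis by (simp only: mult.commute)
  qed
  also have "\<dots> = (\<integral>\<^sup>+v. q (?S s v) * \<eta> v \<partial>lebn UNIV)"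
    using ray[OF nz] by (subst nn_integral_lebn_rays[OF qS, of _ m]) simp_all
  \<comment> \<open>The weight is written in terms of the sheared vector, so that invariance of dv
    under the shear moves the shear from q to \<eta>.\<close>
  also have "\<dots> = (\<integral>\<^sup>+v. q (?S s v) * \<eta> (?S (-s) (?S s v)) \<partial>lebn UNIV)"
    unfolding Sinv ..
  also have "\<dots> = (\<integral>\<^sup>+v. q v * \<eta> (?S (-s) v) \<partial>lebn UNIV)"
    by (rule nn_integral_lebn_shear[OF _ \<open>i \<noteq> j\<close>, of "\<lambda>v. q v * \<eta> (?S (-s) v)"]) measurable
  also have "\<dots> = (\<integral>\<^sup>+x. q (x(m := 1)) * ray_const \<partial>lebn (- {m}))"
  proof -
    have "(\<lambda>v. \<eta> (?S (-s) v)) \<in> borel_measurable (lebn UNIV)" by measurable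
    from nn_integral_lebn_rays[OF q this, of m] show ?thesis by (simp only: hS ray[OF nzS])
  qed
  also have "\<dots> = ray_const * (\<integral>\<^sup>+x. q (x(m := 1)) \<partial>lebn (- {m}))"
    by (subst nn_integral_multc) (auto simp: mult.commute)
  finally show ?thesis
    unfolding ennreal_mult_cancel_left using ray_const_pos ray_const_finite by fastforce
qed

text \<open>Up to \<open>ray_const\<close> the total mass is the mass of the shell, which lies in
  the cube [-2, 2]^n and in the region where q is bounded.\<close>

lemma nn_integral_hom_density_finite:
  fixes q :: "('n::finite \<Rightarrow> real) \<Rightarrow> ennreal"
  assumes q: "hom_density q" and bdd: "\<And>v. 1 \<le> (\<Sum>i\<in>UNIV. \<bar>v i\<bar>) \<Longrightarrow> q v \<le> ennreal B"
  shows "(\<integral>\<^sup>+x. q (x(m := 1)) \<partial>lebn (- {m})) < \<infinity>"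
proof -
  have [measurable]: "q \<in> borel_measurable (lebn UNIV)"
    using q by (simp add: hom_density_def)
  define \<eta> :: "('n \<Rightarrow> real) \<Rightarrow> ennreal" where "\<eta> v = indicator {1..2} (\<Sum>i\<in>UNIV. \<bar>v i\<bar>)" for v
  have [measurable]: "\<eta> \<in> borel_measurable (lebn UNIV)" unfolding \<eta>_def by measurable
  have nz: "x(m := 1) \<noteq> (\<lambda>_. 0)" for x :: "'n \<Rightarrow> real"
    by (metis fun_upd_same zero_neq_one)
  have "ray_const * (\<integral>\<^sup>+x. q (x(m := 1)) \<partial>lebn (- {m})) = (\<integral>\<^sup>+x. q (x(m := 1)) * ray_const \<partial>lebn (- {m}))"
    by (subst nn_integral_multc) (auto simp: mult.commute)
  also have "\<dots> = (\<integral>\<^sup>+v. q v * \<eta> v \<partial>lebn UNIV)"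
    using nn_integral_shell_ray[OF nz]
    by (subst nn_integral_lebn_rays[OF q, of _ m]) (simp_all add: \<eta>_def)
  also have "\<dots> \<le> (\<integral>\<^sup>+v. ennreal B * indicator (Pi\<^sub>E (UNIV :: 'n set) (\<lambda>_. {-2..2})) v \<partial>lebn UNIV)"
  proof (rule nn_integral_mono)
    fix v :: "'n \<Rightarrow> real"
    show "q v * \<eta> v \<le> ennreal B * indicator (Pi\<^sub>E UNIV (\<lambda>_. {-2..2})) v"
    proof (cases "(\<Sum>i\<in>UNIV. \<bar>v i\<bar>) \<in> {1..2}")
      case True
      have "\<bar>v i\<bar> \<le> 2" for i
        using member_le_sum[of i UNIV "\<lambda>i. \<bar>v i\<bar>"] True by auto
      then have "v \<in> Pi\<^sub>E UNIV (\<lambda>_. {-2..2})" by (auto simp: abs_le_iff minus_le_iff)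
      then show ?thesis using True bdd[of v] by (simp add: \<eta>_def)
    qed (simp add: \<eta>_def)
  qed
  also have "\<dots> = ennreal B * emeasure (lebn UNIV) (Pi\<^sub>E UNIV (\<lambda>_::'n. {-2..2}))"
    by (subst nn_integral_cmult_indicator) auto
  also have "\<dots> = ennreal B * (\<Prod>_\<in>(UNIV::'n set). ennreal 4)"
    by (subst lborel_product.emeasure_PiM) auto
  also have "\<dots> < \<infinity>"
    by (simp add: ennreal_mult_less_top ennreal_power flip: ennreal_numeral)
  finally show ?thesis using ray_const_pos by (auto simp: ennreal_mult_less_top)
qed

text \<open>A set of rays meeting the slab \<open>1 \<le> v\<^sub>a \<le> 2\<close> has logarithmic length at most
  \<open>ln 2 \<le> 1\<close> there, so \<open>v\<^sub>a = 1\<close> can replace the chart \<open>v\<^sub>m = 1\<close> in lower bounds.\<close>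

lemma nn_integral_hom_density_slab:
  fixes q :: "('n::finite \<Rightarrow> real) \<Rightarrow> ennreal"
  assumes q: "hom_density q" and Q: "Q \<in> sets (lebn UNIV)"
    and slab: "\<And>v. v \<in> Q \<Longrightarrow> v a \<in> {1..2}"
  shows "(\<integral>\<^sup>+v. q v * indicator Q v \<partial>lebn UNIV) \<le> (\<integral>\<^sup>+x. q (x(m := 1)) \<partial>lebn (- {m}))"
proof -
  have [measurable]: "q \<in> borel_measurable (lebn UNIV)"
    using q by (simp add: hom_density_def)
  define h :: "real \<Rightarrow> ennreal" where "h = indicator {1..2}"
  have [measurable]: "h \<in> borel_measurable borel" unfolding h_def by measurable
  have h1: "(\<integral>\<^sup>+r. h r * ennreal (1 / \<bar>r\<bar>) \<partial>lborel) \<le> 1"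
  proof -
    have "(\<integral>\<^sup>+r. h r * ennreal (1 / \<bar>r\<bar>) \<partial>lborel) \<le> (\<integral>\<^sup>+r. h r \<partial>lborel)"
      by (intro nn_integral_mono) (auto simp: indicator_def h_def)
    also have "\<dots> = 1" by (simp add: h_def)
    finally show ?thesis .
  qed
  have hc: "(\<integral>\<^sup>+r. h (r * c) * ennreal (1 / \<bar>r\<bar>) \<partial>lborel) \<le> 1" for c
  proof (cases "c = 0")
    case False
    then show ?thesis using nn_integral_ray[of c h] h1 by (simp add: mult.commute)
  qed (simp add: h_def)
  have "(\<integral>\<^sup>+v. q v * indicator Q v \<partial>lebn UNIV) \<le> (\<integral>\<^sup>+v. q v * h (v a) \<partial>lebn UNIV)"
    using slab by (intro nn_integral_mono mult_left_mono) (auto simp: indicator_def h_def)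
  also have "\<dots> = (\<integral>\<^sup>+x. q (x(m := 1)) * (\<integral>\<^sup>+r. h (r * (x(m := 1)) a) * ennreal (1 / \<bar>r\<bar>) \<partial>lborel) \<partial>lebn (- {m}))"
    by (rule nn_integral_lebn_rays[OF q]) measurable
  also have "\<dots> \<le> (\<integral>\<^sup>+x. q (x(m := 1)) * 1 \<partial>lebn (- {m}))"
    by (intro nn_integral_mono mult_left_mono hc) auto
  finally show ?thesis by simp
qed

section \<open>Equivariant functions and unitarity\<close>

text \<open>The factor by which right translation by p acts: the modular function to the power -1/2
  times the inverse character. It depends on p only through the corner entry a and has degree -N/2 -
  it in |a|.\<close>

definition hfac :: "nat \<Rightarrow> pol \<Rightarrow> real \<Rightarrow> real \<Rightarrow> complex" where
  "hfac N \<delta> t a = of_real ((\<bar>a\<bar> ^ N) powr (- 1 / 2)) *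
     inverse (of_real (eps \<delta> a) * (of_real \<bar>a\<bar>) powr (of_real t * \<i>))"

definition equivar :: "pol \<Rightarrow> real \<Rightarrow> ('n::{finite,linorder} sqmat \<Rightarrow> complex) set" where
  "equivar \<delta> t = {F. F \<in> borel_measurable (restrict_space borel SL) \<and>
     (\<forall>g\<in>SL. \<forall>p\<in>P_par. F (g ** p) = hfac CARD('n) \<delta> t (p $ first $ first) * F g)}"

lemma Ind_space_iff: "F \<in> Ind_space (lam \<delta> t) \<longleftrightarrow> F \<in> equivar \<delta> t \<and> nrm2 F < \<infinity>"
  unfolding Ind_space_def equivar_def hfac_def lam_def modular_P_def by auto

text \<open>The character is unitary, so only the modular factor contributes to the modulus; its
  square has exactly the degree -N of a density.\<close>

lemma cmod_hfac:
  assumes "a \<noteq> 0"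
  shows "(cmod (hfac N \<delta> t a))\<^sup>2 * \<bar>a\<bar> ^ N = 1"
proof -
  have e: "\<bar>eps \<delta> a\<bar> = 1" using assms by (cases \<delta>) (auto simp: sgn_if)
  have p: "\<bar>a\<bar> ^ N > 0" using assms by simp
  have "cmod (hfac N \<delta> t a) = (\<bar>a\<bar> ^ N) powr (- 1 / 2)"
    using assms e by (simp add: hfac_def norm_mult norm_inverse norm_powr_real_powr)
  then have "(cmod (hfac N \<delta> t a))\<^sup>2 = (\<bar>a\<bar> ^ N) powr (-1)"
    using p by (simp add: power2_eq_square flip: powr_add)
  also have "\<dots> = inverse (\<bar>a\<bar> ^ N)" using p by (simp add: powr_minus)
  finally show ?thesis using p by simp
qed

text \<open>A permutation with nonzero product sends each index to itself or to
  \<open>first\<close>; injectivity leaves only the identity.\<close>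

lemma det_nbar: "det (nbar x :: 'n::{finite,linorder} sqmat) = 1"
proof -
  let ?A = "nbar x :: 'n sqmat"
  have z: "(\<Prod>i\<in>UNIV. ?A $ i $ p i) = 0" if "p permutes UNIV" "p \<noteq> id" for p :: "'n \<Rightarrow> 'n"
  proof (rule ccontr)
    assume "(\<Prod>i\<in>UNIV. ?A $ i $ p i) \<noteq> 0"
    then have nz: "?A $ i $ p i \<noteq> 0" for i by simp
    then have 1: "p i = i \<or> p i = first" for i
      using nz[of i] unfolding nbar_def vec_lambda_beta by metis
    have "p i = i" for i
      using 1[of i] 1[of first] permutes_inj[OF that(1)] by (metis injD)
    then show False using that(2) by auto
  qed
  have "det ?A = (\<Sum>p\<in>{id}. of_int (sign p) * (\<Prod>i\<in>UNIV. ?A $ i $ p i))"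
    unfolding det_def
  proof (rule sum.mono_neutral_right)
    show "\<forall>p\<in>{p. p permutes UNIV} - {id}. of_int (sign p) * (\<Prod>i\<in>UNIV. ?A $ i $ p i) = 0"
      using z by (metis (no_types, lifting) Diff_iff mem_Collect_eq mult_zero_right singletonI)
  qed (simp_all add: permutes_id finite_permutations)
  then show ?thesis by (simp add: nbar_def)
qed

lemma nbar_in_SL [simp]: "nbar x \<in> SL" by (simp add: SL_def det_nbar)

lemma SL_mult: "A \<in> SL \<Longrightarrow> B \<in> SL \<Longrightarrow> A ** B \<in> SL" by (simp add: SL_def det_mul)

lemma column_matrix_mult: "column i (A ** B) = A *v column i B"
  by (simp add: column_def matrix_matrix_mult_def matrix_vector_mult_def vec_eq_iff)

lemma column_nbar: "column first (nbar x) = (\<chi> i. (x(first := 1)) i)"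
  by (simp add: column_def nbar_def vec_eq_iff)

lemma matrix_vector_axis: "A *v axis i 1 = column i A" for A :: "real^'n^'m"
  by (simp add: matrix_vector_mult_basis)

lemma nbar_mult_vec:
  "nbar x *v u = (\<chi> i. if i = first then u $ i else u $ i + x i * u $ first)"
proof -
  have "(nbar x *v u) $ i = (if i = first then u $ i else u $ i + x i * u $ first)" for i
  proof -
    have "(nbar x *v u) $ i = (\<Sum>j\<in>UNIV. (if i = j then 1 else if j = first then x i else 0) * u $ j)"
      by (simp add: matrix_vector_mult_def nbar_def)
    also have "\<dots> = (\<Sum>j\<in>UNIV. (if j = i then u $ j else 0) +
        (if j = first then (if i = first then 0 else x i * u $ j) else 0))"
      by (intro sum.cong) auto
    also have "\<dots> = (if i = first then u $ i else u $ i + x i * u $ first)"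
      by (simp add: sum.distrib)
    finally show ?thesis .
  qed
  then show ?thesis by (simp add: vec_eq_iff)
qed

lemma P_parI:
  assumes "p \<in> SL" "p *v axis first 1 = a *\<^sub>R axis first 1" "a \<noteq> 0"
  shows "p \<in> P_par"
proof -
  have "(\<lambda>v. p *v v) ` span {axis first 1} = span ((\<lambda>v. p *v v) ` {axis first 1})"
    by (rule linear_span_image[symmetric]) simp
  also have "\<dots> = span {axis first 1}"
    using assms span_image_scale[of "{axis first 1}" "\<lambda>_. a"] by simp
  finally show ?thesis using assms by (simp add: P_par_def)
qed

lemma P_parD:
  assumes "p \<in> P_par"
  shows "p \<in> SL" "column first p = (p $ first $ first) *\<^sub>R axis first 1" "p $ first $ first \<noteq> 0"
proof -
  show S: "p \<in> SL" using assms by (simp add: P_par_def)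
  have "p *v axis first 1 \<in> span {axis first 1}"
    using assms span_base[of "axis first 1" "{axis first 1}"] unfolding P_par_def by blast
  then obtain c where c: "column first p = c *\<^sub>R axis first 1"
    unfolding matrix_vector_axis span_singleton by auto
  then have "p $ first $ first = c" by (simp add: column_def vec_eq_iff axis_def)
  then show *: "column first p = (p $ first $ first) *\<^sub>R axis first 1" using c by simp
  show "p $ first $ first \<noteq> 0"
  proof
    assume "p $ first $ first = 0"
    then have "column first p = 0" using * by simp
    then have "det p = 0" by (rule det_zero_column)
    then show False using S by (simp add: SL_def)
  qed
qed

lemma column_nonzero: "g \<in> SL \<Longrightarrow> column i g \<noteq> 0"
  using det_zero_column[of i g] by (auto simp: SL_def)

text \<open>Big-cell decomposition: g = \<open>nbar x ** p\<close> with x = u / u_first for the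
  first column u of g, and p in P with corner entry u_first.\<close>

lemma equivar_chart:
  fixes g :: "'n::{finite,linorder} sqmat"
  assumes F: "F \<in> equivar \<delta> t" and g: "g \<in> SL" and u: "column first g $ first \<noteq> 0"
  shows "F g = hfac CARD('n) \<delta> t (column first g $ first) *
    F (nbar (\<lambda>i. column first g $ i / column first g $ first))"
proof -
  let ?u = "column first g"
  let ?x = "\<lambda>i. ?u $ i / ?u $ first"
  let ?p = "nbar (\<lambda>i. - ?x i) ** g"
  have S: "?p \<in> SL" using g by (simp add: SL_mult)
  have c: "column first ?p = (?u $ first) *\<^sub>R axis first 1"
    using u unfolding column_matrix_mult nbar_mult_vec by (simp add: vec_eq_iff axis_def)
  then have P: "?p \<in> P_par" using P_parI[OF S _ u] by (simp add: matrix_vector_axis)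
  have pff: "?p $ first $ first = ?u $ first"
    using c by (simp add: column_def vec_eq_iff axis_def)
  have "nbar ?x ** nbar (\<lambda>i. - ?x i) = mat 1"
  proof -
    have "(nbar ?x ** nbar (\<lambda>i. - ?x i)) *v v = v" for v
      unfolding matrix_vector_mul_assoc[symmetric] nbar_mult_vec by (simp add: vec_eq_iff)
    then show ?thesis by (simp add: matrix_eq)
  qed
  then have "nbar ?x ** ?p = g" by (simp add: matrix_mul_assoc)
  then show ?thesis using F P unfolding equivar_def
    by (metis (mono_tags, lifting) mem_Collect_eq nbar_in_SL pff)
qed

lemma borel_measurable_vec_lambda [measurable]:
  fixes f :: "'n::finite \<Rightarrow> 'a \<Rightarrow> 'b::euclidean_space"
  assumes "\<And>i. f i \<in> borel_measurable M"
  shows "(\<lambda>x. \<chi> i. f i x) \<in> borel_measurable M"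
proof (subst borel_measurable_euclidean_space, intro ballI)
  fix b :: "('b, 'n) vec" assume "b \<in> Basis"
  then obtain i c where b: "b = axis i c" unfolding Basis_vec_def by auto
  show "(\<lambda>x. (\<chi> i. f i x) \<bullet> b) \<in> borel_measurable M"
    unfolding b inner_axis using assms[measurable] by simp
qed

lemma measurable_nbar:
  "nbar \<in> lebn (- {first}) \<rightarrow>\<^sub>M restrict_space borel (SL :: 'n::{finite,linorder} sqmat set)"
proof (rule measurable_restrict_space2)
  show "nbar \<in> borel_measurable (lebn (- {first :: 'n}))"
    unfolding nbar_def
  proof (intro borel_measurable_vec_lambda)
    fix a b :: 'n
    show "(\<lambda>x. if a = b then 1 else if b = first then x a else 0) \<in> borel_measurable (lebn (- {first}))"
      by (cases "a = b"; cases "b = first") auto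
  qed
qed auto

lemma equivar_measurable [measurable]:
  "F \<in> equivar \<delta> t \<Longrightarrow> (\<lambda>x. F (nbar x)) \<in> borel_measurable (\<Pi>\<^sub>M i\<in>- {first}. lborel)"
  using measurable_compose[OF measurable_nbar] by (auto simp: equivar_def)

lemma not_first_eq: "{i. i \<noteq> a} = - {a}" by auto

text \<open>Division by zero makes the density vanish where \<open>v\<close> is outside the chart.\<close>

definition dens :: "('n::{finite,linorder} sqmat \<Rightarrow> complex) \<Rightarrow> ('n \<Rightarrow> real) \<Rightarrow> ennreal" where
  "dens F v = ennreal ((cmod (F (nbar (\<lambda>i\<in>- {first}. v i / v first))))\<^sup>2 / \<bar>v first\<bar> ^ CARD('n))"

lemma nbar_restrict: "nbar (\<lambda>i\<in>- {first}. x i) = nbar x"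
  by (auto simp: nbar_def vec_eq_iff)

lemma hom_density_dens:
  fixes F :: "'n::{finite,linorder} sqmat \<Rightarrow> complex"
  assumes F: "F \<in> equivar \<delta> t"
  shows "hom_density (dens F)"
  unfolding hom_density_def
proof (intro conjI allI impI)
  have [measurable]: "(\<lambda>v. (\<lambda>i\<in>- {first}. v i / v first)) \<in> lebn UNIV \<rightarrow>\<^sub>M lebn (- {first :: 'n})"
    by (rule measurable_restrict) simp
  have [measurable]: "(\<lambda>v. F (nbar (\<lambda>i\<in>- {first}. v i / v first))) \<in> borel_measurable (lebn UNIV)"
    using equivar_measurable[OF F] by (rule measurable_compose[rotated]) measurable
  show "dens F \<in> borel_measurable (lebn UNIV)"
    unfolding dens_def by measurable
next
  fix r :: real and v :: "'n \<Rightarrow> real" assume "r \<noteq> 0"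
  then show "ennreal (\<bar>r\<bar> ^ CARD('n)) * dens F (\<lambda>i. r * v i) = dens F v"
    unfolding dens_def nbar_restrict
    by (simp add: ennreal_mult'[symmetric] abs_mult power_mult_distrib)
qed

text \<open>This makes |F|^2 a function of the first column alone, so that left translation of F
  becomes a linear substitution in \<open>dens\<close>.\<close>

lemma dens_column:
  assumes "F \<in> equivar \<delta> t" "g \<in> SL" "column first g $ first \<noteq> 0"
  shows "ennreal ((cmod (F g))\<^sup>2) = dens F (\<lambda>i. column first g $ i)"
proof -
  let ?a = "column first g $ first"
  have "(cmod (hfac CARD('a) \<delta> t ?a))\<^sup>2 = 1 / \<bar>?a\<bar> ^ CARD('a)"
    using cmod_hfac[OF assms(3), of "CARD('a)" \<delta> t] assms(3) by (simp add: field_simps)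
  then show ?thesis
    unfolding equivar_chart[OF assms] dens_def nbar_restrict by (simp add: norm_mult power_mult_distrib)
qed

lemma nrm2_dens:
  assumes "F \<in> equivar \<delta> t"
  shows "nrm2 F = (\<integral>\<^sup>+x. dens F (x(first := 1)) \<partial>lebn (- {first}))"
  unfolding nrm2_def not_first_eq
proof (rule nn_integral_cong)
  fix x :: "'a \<Rightarrow> real"
  have "(\<lambda>i\<in>- {first}. (x(first := 1)) i / (x(first := 1)) first) = (\<lambda>i\<in>- {first}. x i)" by auto
  then show "ennreal ((cmod (F (nbar x)))\<^sup>2) = dens F (x(first := 1))"
    unfolding dens_def by (simp add: nbar_restrict)
qed

lemma AE_lebn_component_neq:
  fixes I :: "'n set"
  assumes "finite I" "i \<in> I"
  shows "AE x in lebn I. x i \<noteq> c"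
proof (rule AE_I)
  let ?A = "\<lambda>j. if j = i then {c} else UNIV :: real set"
  show "{x \<in> space (lebn I). \<not> x i \<noteq> c} \<subseteq> Pi\<^sub>E I ?A"
    using assms by (auto simp: space_PiM PiE_iff extensional_def)
  show "Pi\<^sub>E I ?A \<in> sets (lebn I)"
    using assms by (intro sets_PiM_I_finite) auto
  have "emeasure (lebn I) (Pi\<^sub>E I ?A) = (\<Prod>j\<in>I. emeasure lborel (?A j))"
    using assms by (intro lborel_product.emeasure_PiM) auto
  also have "\<dots> = 0" using assms by (auto intro!: prod_zero bexI[of _ i])
  finally show "emeasure (lebn I) (Pi\<^sub>E I ?A) = 0" .
qed

section \<open>Shears: the one-parameter groups generated by elementary matrices\<close>

definition shear :: "'n::finite \<Rightarrow> 'n \<Rightarrow> real \<Rightarrow> 'n sqmat" where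
  "shear i j s = mat 1 + s *\<^sub>R elem_mat i j"

lemma shear_mult_vec: "shear i j s *v v = v + (s * v $ j) *\<^sub>R axis i 1"
proof -
  have "(elem_mat i j *v v) = v $ j *\<^sub>R axis i 1"
  proof -
    have "(elem_mat i j *v v) $ k = (v $ j *\<^sub>R axis i 1) $ k" for k
    proof -
      have "(elem_mat i j *v v) $ k = (\<Sum>b\<in>UNIV. if b = j then (if k = i then v $ b else 0) else 0)"
        unfolding matrix_vector_mult_def elem_mat_def vec_lambda_beta by (rule sum.cong) auto
      then show ?thesis by (simp add: axis_def)
    qed
    then show ?thesis by (simp add: vec_eq_iff)
  qed
  then show ?thesis
    by (simp add: shear_def matrix_vector_mult_add_rdistrib scaleR_matrix_vector_assoc[symmetric])
qed

lemma shear_add: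
  assumes "i \<noteq> j" shows "shear i j s ** shear i j r = shear i j (s + r)"
proof -
  have "(shear i j s ** shear i j r) *v v = shear i j (s + r) *v v" for v
    unfolding matrix_vector_mul_assoc[symmetric] shear_mult_vec
    using assms by (simp add: axis_def vec_eq_iff algebra_simps)
  then show ?thesis by (simp add: matrix_eq)
qed

lemma shear_0: "shear i j 0 = mat 1" by (simp add: shear_def)

lemma shear_in_SL:
  assumes "i \<noteq> j" shows "shear i j s \<in> SL"
proof -
  have "shear i j s = (\<chi> k. if k = i then row i (mat 1) + s *s row j (mat 1) else row k (mat 1))"
    by (auto simp: shear_def elem_mat_def vec_eq_iff row_def mat_def)
  then have "det (shear i j s) = det (mat 1 :: 'a sqmat)"
    using det_row_operation[OF assms, of "mat 1" s] by (metis)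
  then show ?thesis by (simp add: SL_def)
qed

lemma matrix_inv_eqI:
  fixes A B :: "real^'n^'n"
  assumes "A ** B = mat 1" shows "matrix_inv A = B"
proof -
  have BA: "B ** A = mat 1" using assms matrix_left_right_inverse by blast
  have "A ** matrix_inv A = mat 1 \<and> matrix_inv A ** A = mat 1"
    unfolding matrix_inv_def by (rule someI[of _ B]) (use assms BA in auto)
  then have "B ** (A ** matrix_inv A) = B" by simp
  then show ?thesis by (simp add: matrix_mul_assoc BA)
qed

lemma matrix_inv_shear: "i \<noteq> j \<Longrightarrow> matrix_inv (shear i j s) = shear i j (- s)"
  by (rule matrix_inv_eqI) (simp add: shear_add shear_0)

lemma elem_mat_square: "i \<noteq> j \<Longrightarrow> elem_mat i j ** elem_mat i j = 0"
  unfolding elem_mat_def matrix_matrix_mult_def vec_eq_iff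
  by (auto intro!: sum.neutral)

text \<open>X^2 = 0, so the exponential series stops after the linear term.\<close>

lemma mat_exp_elem:
  assumes "i \<noteq> j" shows "mat_exp (s *\<^sub>R elem_mat i j) = shear i j s"
proof -
  let ?X = "s *\<^sub>R elem_mat i j"
  have sq: "?X ** ?X = 0"
    using elem_mat_square[OF assms]
    by (simp add: matrix_scalar_ac scalar_matrix_assoc[symmetric] flip: scalar_matrix_assoc)
  have z: "((\<lambda>Y. ?X ** Y) ^^ m) (mat 1) = 0" if "m \<ge> 2" for m
  proof -
    from le_Suc_ex[OF that] obtain d where m: "m = Suc (Suc d)" by auto
    show ?thesis
      unfolding m by (induction d) (simp_all add: sq matrix_mul_assoc)
  qed
  have "(\<Sum>m. (1 / fact m) *\<^sub>R ((\<lambda>Y. ?X ** Y) ^^ m) (mat 1)) =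
    (\<Sum>m\<in>{..<2}. (1 / fact m) *\<^sub>R ((\<lambda>Y. ?X ** Y) ^^ m) (mat 1))"
    by (rule suminf_finite) (auto simp: z)
  then show ?thesis by (simp add: mat_exp_def shear_def numeral_2_eq_2)
qed

lemma Ind_act_exp:
  "i \<noteq> j \<Longrightarrow> Ind_act (mat_exp (s *\<^sub>R elem_mat i j)) F = (\<lambda>g. F (shear i j (- s) ** g))"
  by (simp add: Ind_act_def mat_exp_elem matrix_inv_shear)

lemma equivar_translate:
  fixes F :: "'n::{finite,linorder} sqmat \<Rightarrow> complex"
  assumes F: "F \<in> equivar \<delta> t" and A: "A \<in> SL"
  shows "(\<lambda>g. F (A ** g)) \<in> equivar \<delta> t"
proof -
  have "continuous_on SL (\<lambda>g. A ** g)"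
    unfolding matrix_matrix_mult_def by (intro continuous_intros)
  then have "(\<lambda>g. A ** g) \<in> borel_measurable (restrict_space borel SL)"
    by (rule borel_measurable_continuous_on_restrict)
  then have "(\<lambda>g. A ** g) \<in> restrict_space borel SL \<rightarrow>\<^sub>M restrict_space borel SL"
    by (rule measurable_restrict_space2[rotated]) (auto simp: space_restrict_space SL_mult A)
  then have "(\<lambda>g. F (A ** g)) \<in> borel_measurable (restrict_space borel SL)"
    using F by (intro measurable_compose[of "\<lambda>g. A ** g" _ _ F]) (auto simp: equivar_def)
  moreover have "F (A ** (g ** p)) = hfac CARD('n) \<delta> t (p $ first $ first) * F (A ** g)"
    if "g \<in> SL" "p \<in> P_par" for g p
    using F that SL_mult[OF A that(1)] unfolding matrix_mul_assoc equivar_def by blast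
  ultimately show ?thesis by (simp add: equivar_def)
qed

text \<open>Unitarity of the one-parameter groups. The first column of
  \<open>shear i j s ** nbar x\<close> is the sheared chart point, which leaves the chart only on a
  null set; off that set the density can be used, and its total mass is invariant under
  shears.\<close>

theorem nrm2_shear:
  fixes F :: "'n::{finite,linorder} sqmat \<Rightarrow> complex"
  assumes F: "F \<in> equivar \<delta> t" and "i \<noteq> j"
  shows "nrm2 (\<lambda>g. F (shear i j s ** g)) = nrm2 F"
proof -
  let ?w = "\<lambda>x. x(first := 1 :: real)"
  let ?S = "\<lambda>v. v(i := v i - (- s) * v j)"
  have col: "(\<lambda>k. column first (shear i j s ** nbar x) $ k) = ?S (?w x)" for x
    unfolding column_matrix_mult column_nbar shear_mult_vec
    by (auto simp: axis_def fun_eq_iff)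
  \<comment> \<open>Only i = \<open>first\<close> moves the top entry: it becomes 1 + s x_j, which
    vanishes on a hyperplane.\<close>
  have ae: "AE x in lebn (- {first}). ?S (?w x) first \<noteq> 0"
  proof (cases "i = first \<and> s \<noteq> 0")
    case True
    then have "j \<in> - {first}" using \<open>i \<noteq> j\<close> by auto
    then have "AE x in lebn (- {first}). x j \<noteq> - 1 / s"
      by (intro AE_lebn_component_neq) auto
    then show ?thesis
    proof eventually_elim
      case (elim x)
      have "1 + s * x j \<noteq> 0"
      proof
        assume "1 + s * x j = 0"
        then have "s * x j = -1" by simp
        then have "x j = - 1 / s" using True by (metis nonzero_mult_div_cancel_left)
        then show False using elim by simp
      qed
      then show ?case using True \<open>i \<noteq> j\<close> by auto
    qed
  qed auto
  have "nrm2 (\<lambda>g. F (shear i j s ** g)) =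
    (\<integral>\<^sup>+x. dens F (?S (?w x)) \<partial>lebn (- {first}))"
    unfolding nrm2_def not_first_eq
  proof (rule nn_integral_cong_AE)
    show "AE x in lebn (- {first}). ennreal ((cmod (F (shear i j s ** nbar x)))\<^sup>2) = dens F (?S (?w x))"
      using ae
    proof eventually_elim
      case (elim x)
      have "shear i j s ** nbar x \<in> SL" using \<open>i \<noteq> j\<close> by (intro SL_mult shear_in_SL) auto
      moreover have "column first (shear i j s ** nbar x) $ first \<noteq> 0"
        using elim fun_cong[OF col[of x], of first] by simp
      ultimately have "ennreal ((cmod (F (shear i j s ** nbar x)))\<^sup>2) =
        dens F (\<lambda>k. column first (shear i j s ** nbar x) $ k)"
        by (rule dens_column[OF F])
      then show ?case unfolding col .
    qed
  qed
  also have "\<dots> = nrm2 F"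
    unfolding nrm2_dens[OF F]
    by (rule nn_integral_hom_density_shear[OF hom_density_dens[OF F] \<open>i \<noteq> j\<close>])
  finally show ?thesis .
qed

section \<open>The Hilbert seminorm on representatives\<close>

lemma L2_triangle:
  fixes f g :: "'a \<Rightarrow> complex"
  assumes [measurable]: "f \<in> borel_measurable M" "g \<in> borel_measurable M"
    and fin: "(\<integral>\<^sup>+x. ennreal ((cmod (f x))\<^sup>2) \<partial>M) < \<infinity>" "(\<integral>\<^sup>+x. ennreal ((cmod (g x))\<^sup>2) \<partial>M) < \<infinity>"
  shows "(\<integral>\<^sup>+x. ennreal ((cmod (f x + g x))\<^sup>2) \<partial>M) \<le>
    ennreal ((sqrt (enn2real (\<integral>\<^sup>+x. ennreal ((cmod (f x))\<^sup>2) \<partial>M)) +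
      sqrt (enn2real (\<integral>\<^sup>+x. ennreal ((cmod (g x))\<^sup>2) \<partial>M)))\<^sup>2)"
proof -
  define A where "A = (\<integral>\<^sup>+x. ennreal ((cmod (f x))\<^sup>2) \<partial>M)"
  define B where "B = (\<integral>\<^sup>+x. ennreal ((cmod (g x))\<^sup>2) \<partial>M)"
  define C where "C = (\<integral>\<^sup>+x. ennreal (cmod (f x)) * ennreal (cmod (g x)) \<partial>M)"
  obtain a where a: "A = ennreal a" "a \<ge> 0"
    using fin(1) unfolding A_def by (metis ennreal_cases infinity_ennreal_def less_irrefl)
  obtain b where b: "B = ennreal b" "b \<ge> 0"
    using fin(2) unfolding B_def by (metis ennreal_cases infinity_ennreal_def less_irrefl)
  have "C\<^sup>2 \<le> A * B"
    using Cauchy_Schwarz_nn_integral[of "\<lambda>x. ennreal (cmod (f x))" M "\<lambda>x. ennreal (cmod (g x))"]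
    unfolding A_def B_def C_def by (simp add: ennreal_power)
  then have C2: "C\<^sup>2 \<le> ennreal (a * b)" using a b by (simp add: ennreal_mult)
  then have "C \<noteq> \<infinity>" by (auto simp: power2_eq_square top_unique)
  then obtain c where c: "C = ennreal c" "c \<ge> 0" by (cases C) auto
  have "c\<^sup>2 \<le> a * b" using C2 a b c by (simp add: ennreal_power ennreal_le_iff)
  then have "c \<le> sqrt (a * b)" by (rule real_le_rsqrt)
  then have cab: "a + 2 * c + b \<le> (sqrt a + sqrt b)\<^sup>2"
    using a b by (simp add: power2_sum real_sqrt_mult)
  have "(\<integral>\<^sup>+x. ennreal ((cmod (f x + g x))\<^sup>2) \<partial>M) \<le>
    (\<integral>\<^sup>+x. ennreal ((cmod (f x))\<^sup>2) + 2 * (ennreal (cmod (f x)) * ennreal (cmod (g x))) + ennreal ((cmod (g x))\<^sup>2) \<partial>M)"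
  proof (rule nn_integral_mono)
    fix x
    have "(cmod (f x + g x))\<^sup>2 \<le> (cmod (f x) + cmod (g x))\<^sup>2"
      by (intro power_mono norm_triangle_ineq) auto
    also have "\<dots> = (cmod (f x))\<^sup>2 + 2 * (cmod (f x) * cmod (g x)) + (cmod (g x))\<^sup>2"
      by (simp add: power2_sum)
    finally have "ennreal ((cmod (f x + g x))\<^sup>2) \<le>
      ennreal ((cmod (f x))\<^sup>2 + 2 * (cmod (f x) * cmod (g x)) + (cmod (g x))\<^sup>2)"
      by (rule ennreal_leI)
    then show "ennreal ((cmod (f x + g x))\<^sup>2) \<le> ennreal ((cmod (f x))\<^sup>2) +
      2 * (ennreal (cmod (f x)) * ennreal (cmod (g x))) + ennreal ((cmod (g x))\<^sup>2)"
      by (simp add: ennreal_plus ennreal_mult)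
  qed
  also have "\<dots> = A + 2 * C + B"
    unfolding A_def B_def C_def by (simp add: nn_integral_add nn_integral_cmult)
  also have "\<dots> = ennreal (a + 2 * c + b)"
    using a b c by (simp add: ennreal_plus ennreal_mult)
  also have "\<dots> \<le> ennreal ((sqrt a + sqrt b)\<^sup>2)" using cab by (rule ennreal_leI)
  finally show ?thesis using a b by (simp add: A_def[symmetric] B_def[symmetric])
qed

text \<open>A seminorm on \<open>Ind_space\<close> only, because \<open>enn2real\<close> sends an
  infinite norm to 0. It lets all estimates be made on functions instead of classes.\<close>

definition L2n :: "('n::{finite,linorder} sqmat \<Rightarrow> complex) \<Rightarrow> real" where
  "L2n F = sqrt (enn2real (nrm2 F))"

lemma L2n_nonneg [simp]: "L2n F \<ge> 0" by (simp add: L2n_def)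

lemma nrm2_L2n: "nrm2 F < \<infinity> \<Longrightarrow> nrm2 F = ennreal ((L2n F)\<^sup>2)"
  by (simp add: L2n_def)

lemma nrm2_scale:
  assumes "F \<in> equivar \<delta> t"
  shows "nrm2 (\<lambda>g. c * F g) = ennreal ((cmod c)\<^sup>2) * nrm2 F"
  unfolding nrm2_def not_first_eq norm_mult power_mult_distrib
  using equivar_measurable[OF assms] by (simp add: ennreal_mult nn_integral_cmult)

lemma equivar_add:
  "F \<in> equivar \<delta> t \<Longrightarrow> G \<in> equivar \<delta> t \<Longrightarrow> (\<lambda>g. F g + G g) \<in> equivar \<delta> t"
  unfolding equivar_def by (auto simp: algebra_simps)

lemma equivar_scale: "F \<in> equivar \<delta> t \<Longrightarrow> (\<lambda>g. c * F g) \<in> equivar \<delta> t"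
  unfolding equivar_def by (auto simp: algebra_simps)

lemma Ind_space_add:
  assumes "F \<in> Ind_space (lam \<delta> t)" "G \<in> Ind_space (lam \<delta> t)"
  shows "(\<lambda>g. F g + G g) \<in> Ind_space (lam \<delta> t)" and "L2n (\<lambda>g. F g + G g) \<le> L2n F + L2n G"
proof -
  have F: "F \<in> equivar \<delta> t" "nrm2 F < \<infinity>" and G: "G \<in> equivar \<delta> t" "nrm2 G < \<infinity>"
    using assms by (auto simp: Ind_space_iff)
  have *: "nrm2 (\<lambda>g. F g + G g) \<le> ennreal ((L2n F + L2n G)\<^sup>2)"
    using L2_triangle[OF equivar_measurable[OF F(1)] equivar_measurable[OF G(1)]] F(2) G(2)
    unfolding nrm2_def not_first_eq L2n_def by blast
  then show "(\<lambda>g. F g + G g) \<in> Ind_space (lam \<delta> t)"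
    using equivar_add[OF F(1) G(1)] by (simp add: Ind_space_iff le_less_trans)
  have "enn2real (nrm2 (\<lambda>g. F g + G g)) \<le> (L2n F + L2n G)\<^sup>2"
    using * by (metis enn2real_ennreal enn2real_mono ennreal_less_top zero_le_power2)
  then show "L2n (\<lambda>g. F g + G g) \<le> L2n F + L2n G"
    unfolding L2n_def[of "\<lambda>g. F g + G g"] by (intro real_le_lsqrt) auto
qed

lemma Ind_space_scale:
  assumes "F \<in> Ind_space (lam \<delta> t)"
  shows "(\<lambda>g. c * F g) \<in> Ind_space (lam \<delta> t)" and "L2n (\<lambda>g. c * F g) = cmod c * L2n F"
proof -
  have F: "F \<in> equivar \<delta> t" "nrm2 F < \<infinity>"
    using assms by (auto simp: Ind_space_iff)
  show "(\<lambda>g. c * F g) \<in> Ind_space (lam \<delta> t)"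
    using F equivar_scale[OF F(1)] nrm2_scale[OF F(1), of c]
    by (simp add: Ind_space_iff ennreal_mult_less_top)
  show "L2n (\<lambda>g. c * F g) = cmod c * L2n F"
    unfolding L2n_def nrm2_scale[OF F(1)] by (simp add: enn2real_mult real_sqrt_mult)
qed

lemma Ind_space_diff:
  assumes "F \<in> Ind_space (lam \<delta> t)" "G \<in> Ind_space (lam \<delta> t)"
  shows "(\<lambda>g. F g - G g) \<in> Ind_space (lam \<delta> t)" and "L2n (\<lambda>g. F g - G g) \<le> L2n F + L2n G"
  using Ind_space_add[OF assms(1) Ind_space_scale(1)[OF assms(2), of "-1"]]
    Ind_space_scale(2)[OF assms(2), of "-1"] by auto

lemma Ind_space_shear:
  assumes "F \<in> Ind_space (lam \<delta> t)" "i \<noteq> j"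
  shows "(\<lambda>g. F (shear i j s ** g)) \<in> Ind_space (lam \<delta> t)"
    and "L2n (\<lambda>g. F (shear i j s ** g)) = L2n F"
  using assms equivar_translate[OF _ shear_in_SL[OF assms(2)]]
  by (auto simp: Ind_space_iff L2n_def nrm2_shear)

section \<open>Vectors given by homogeneous functions\<close>

text \<open>The value at 0 is left free: a column of an element of SL is never 0.\<close>

definition Hom :: "pol \<Rightarrow> real \<Rightarrow> (real^'n::finite \<Rightarrow> complex) \<Rightarrow> bool" where
  "Hom \<delta> t \<phi> \<longleftrightarrow> (\<forall>a v. a \<noteq> 0 \<longrightarrow> v \<noteq> 0 \<longrightarrow> \<phi> (a *\<^sub>R v) = hfac CARD('n) \<delta> t a * \<phi> v)"

text \<open>Right multiplication by p in P multiplies the first column by the corner entry of p, so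
  \<open>Hom\<close> becomes the equivariance condition, and left translation by A becomes the
  substitution of A v for v.\<close>

definition lift :: "(real^'n::{finite,linorder} \<Rightarrow> complex) \<Rightarrow> 'n sqmat \<Rightarrow> complex" where
  "lift \<phi> g = \<phi> (column first g)"

lemma lift_mult: "lift \<phi> (A ** g) = lift (\<lambda>v. \<phi> (A *v v)) g"
  by (simp add: lift_def column_matrix_mult)

lemma lift_equivar:
  fixes \<phi> :: "real^'n::{finite,linorder} \<Rightarrow> complex"
  assumes "Hom \<delta> t \<phi>" "continuous_on (- {0}) \<phi>"
  shows "lift \<phi> \<in> equivar \<delta> t"
proof -
  have "continuous_on SL (\<lambda>g :: 'n sqmat. column first g)"
    unfolding column_def by (intro continuous_intros)
  then have "continuous_on SL (lift \<phi>)"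
    unfolding lift_def
    by (rule continuous_on_compose2[OF assms(2)]) (auto simp: column_nonzero)
  then have "lift \<phi> \<in> borel_measurable (restrict_space borel SL)"
    by (rule borel_measurable_continuous_on_restrict)
  moreover have "lift \<phi> (g ** p) = hfac CARD('n) \<delta> t (p $ first $ first) * lift \<phi> g"
    if "g \<in> SL" "p \<in> P_par" for g p
  proof -
    have "column first (g ** p) = (p $ first $ first) *\<^sub>R column first g"
      unfolding column_matrix_mult P_parD(2)[OF that(2)]
      by (simp add: matrix_vector_mult_scaleR matrix_vector_axis)
    then show ?thesis
      using assms(1) P_parD(3)[OF that(2)] column_nonzero[OF that(1), of first]
      by (simp add: Hom_def lift_def)
  qed
  ultimately show ?thesis by (simp add: equivar_def)
qed

lemma cmod_Hom:
  fixes \<phi> :: "real^'n::finite \<Rightarrow> complex"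
  assumes "Hom \<delta> t \<phi>" "a \<noteq> 0" "v \<noteq> 0"
  shows "(cmod (\<phi> (a *\<^sub>R v)))\<^sup>2 = (cmod (\<phi> v))\<^sup>2 / \<bar>a\<bar> ^ CARD('n)"
proof -
  have "(cmod (hfac CARD('n) \<delta> t a))\<^sup>2 = 1 / \<bar>a\<bar> ^ CARD('n)"
    using cmod_hfac[OF assms(2), of "CARD('n)" \<delta> t] assms(2) by (simp add: field_simps)
  then show ?thesis
    using assms by (simp add: Hom_def norm_mult power_mult_distrib)
qed

lemma dens_lift:
  fixes \<phi> :: "real^'n::{finite,linorder} \<Rightarrow> complex"
  assumes "Hom \<delta> t \<phi>" "v first \<noteq> 0"
  shows "dens (lift \<phi>) v = ennreal ((cmod (\<phi> (\<chi> i. v i)))\<^sup>2)"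
proof -
  let ?w = "(\<chi> i. ((\<lambda>i. v i / v first)(first := 1)) i) :: (real, 'n) vec"
  have w: "(\<chi> i. v i) = v first *\<^sub>R ?w" using assms(2) by (simp add: vec_eq_iff)
  have "?w $ first \<noteq> 0" by simp
  then have "?w \<noteq> 0" by (metis zero_index)
  show ?thesis
    unfolding dens_def nbar_restrict lift_def column_nbar w
    using cmod_Hom[OF assms(1,2) \<open>?w \<noteq> 0\<close>] by (simp only:)
qed

text \<open>The coordinate a is free, so lower bounds can use a box placed where \<phi> is large,
  whatever its position relative to the chart v_first = 1.\<close>

lemma nrm2_lift_slab:
  fixes \<phi> :: "real^'n::{finite,linorder} \<Rightarrow> complex"
  assumes \<phi>: "Hom \<delta> t \<phi>" "continuous_on (- {0}) \<phi>"
    and Q: "Q \<in> sets (lebn UNIV)" "\<And>v. v \<in> Q \<Longrightarrow> v a \<in> {1..2}"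
  shows "(\<integral>\<^sup>+v. ennreal ((cmod (\<phi> (\<chi> i. v i)))\<^sup>2) * indicator Q v \<partial>lebn UNIV) \<le> nrm2 (lift \<phi>)"
proof -
  have "AE v in lebn UNIV. v (first :: 'n) \<noteq> 0" by (rule AE_lebn_component_neq) auto
  then have "(\<integral>\<^sup>+v. ennreal ((cmod (\<phi> (\<chi> i. v i)))\<^sup>2) * indicator Q v \<partial>lebn UNIV) =
      (\<integral>\<^sup>+v. dens (lift \<phi>) v * indicator Q v \<partial>lebn UNIV)"
    by (intro nn_integral_cong_AE) (auto elim!: eventually_mono simp: dens_lift[OF \<phi>(1)])
  also have "\<dots> \<le> nrm2 (lift \<phi>)"
    unfolding nrm2_dens[OF lift_equivar[OF \<phi>]]
    by (rule nn_integral_hom_density_slab[OF hom_density_dens[OF lift_equivar[OF \<phi>]] Q])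
  finally show ?thesis .
qed

text \<open>Comparison with the density |v|^(-n), whose total mass is K. As K is obtained before
  \<phi>, the supremum over the unit sphere controls the norm uniformly, and limits in the Hilbert
  space reduce to uniform limits on a compact set.\<close>

lemma nrm2_lift_le:
  obtains K where "K < \<infinity>"
    "\<And>\<delta> t (\<phi> :: real^'n::{finite,linorder} \<Rightarrow> complex) M. Hom \<delta> t \<phi> \<Longrightarrow>
       (\<And>v. norm v = 1 \<Longrightarrow> cmod (\<phi> v) \<le> M) \<Longrightarrow> nrm2 (lift \<phi>) \<le> ennreal (M\<^sup>2) * K"
proof -
  define q :: "('n \<Rightarrow> real) \<Rightarrow> ennreal" where
    "q v = ennreal (1 / norm ((\<chi> i. v i) :: (real, 'n) vec) ^ CARD('n))" for v
  define K where "K = (\<integral>\<^sup>+x. q (x(first := 1)) \<partial>lebn (- {first}))"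
  have qm: "q \<in> borel_measurable (lebn UNIV)"
    unfolding q_def by measurable
  have sc: "(\<chi> i. r * v i) = r *\<^sub>R ((\<chi> i. v i) :: (real, 'n) vec)" for r v by (simp add: vec_eq_iff)
  have hq: "hom_density q"
    unfolding hom_density_def
  proof (intro conjI allI impI qm)
    fix r :: real and v :: "'n \<Rightarrow> real" assume "r \<noteq> 0"
    then show "ennreal (\<bar>r\<bar> ^ CARD('n)) * q (\<lambda>i. r * v i) = q v"
      unfolding q_def sc by (subst ennreal_mult[symmetric]) (auto simp: power_mult_distrib)
  qed
  have fin: "K < \<infinity>"
    unfolding K_def
  proof (rule nn_integral_hom_density_finite[OF hq])
    fix v :: "'n \<Rightarrow> real" assume 1: "1 \<le> (\<Sum>i\<in>UNIV. \<bar>v i\<bar>)"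
    let ?v = "(\<chi> i. v i) :: (real, 'n) vec"
    let ?N = "real CARD('n)"
    \<comment> \<open>Each |v_i| is at most |v|, so |v| \<ge> 1/n where the l1 norm is at least 1;
      this bounds |v|^(-n) by n^n.\<close>
    have "(\<Sum>i\<in>UNIV. \<bar>v i\<bar>) \<le> (\<Sum>i\<in>(UNIV::'n set). norm ?v)"
      using component_le_norm_cart[of ?v] by (intro sum_mono) auto
    then have n: "1 \<le> ?N * norm ?v" using 1 by simp
    then have "norm ?v > 0" by (metis less_eq_real_def mult_zero_right norm_ge_zero not_one_le_zero)
    then have "1 / norm ?v \<le> ?N" using n by (simp add: field_simps)
    then have "(1 / norm ?v) ^ CARD('n) \<le> ?N ^ CARD('n)" by (intro power_mono) auto
    then show "q v \<le> ennreal (?N ^ CARD('n))"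
      unfolding q_def by (intro ennreal_leI) (simp add: power_divide)
  qed
  moreover have "nrm2 (lift \<phi>) \<le> ennreal (M\<^sup>2) * K"
    if \<phi>: "Hom \<delta> t \<phi>" and M: "\<And>v. norm v = 1 \<Longrightarrow> cmod (\<phi> v) \<le> M"
    for \<delta> t and \<phi> :: "(real, 'n) vec \<Rightarrow> complex" and M
  proof -
    have "nrm2 (lift \<phi>) \<le> (\<integral>\<^sup>+x. ennreal (M\<^sup>2) * q (x(first := 1)) \<partial>lebn (- {first}))"
      unfolding nrm2_def not_first_eq
    proof (rule nn_integral_mono)
      fix x :: "'n \<Rightarrow> real"
      let ?w = "(\<chi> i. (x(first := 1)) i) :: (real, 'n) vec"
      have "?w $ first \<noteq> 0" by simp
      then have w0: "?w \<noteq> 0" by (metis zero_index)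
      define u where "u = (1 / norm ?w) *\<^sub>R ?w"
      have u: "norm u = 1" "u \<noteq> 0" and wu: "?w = norm ?w *\<^sub>R u" using w0 by (auto simp: u_def)
      have "(cmod (\<phi> ?w))\<^sup>2 = (cmod (\<phi> u))\<^sup>2 / norm ?w ^ CARD('n)"
        using cmod_Hom[OF \<phi> _ u(2), of "norm ?w"] w0 wu by simp
      also have "\<dots> \<le> M\<^sup>2 / norm ?w ^ CARD('n)"
        by (intro divide_right_mono power_mono M u) auto
      finally have "ennreal ((cmod (\<phi> ?w))\<^sup>2) \<le> ennreal (M\<^sup>2 * (1 / norm ?w ^ CARD('n)))"
        by (intro ennreal_leI) simp
      then show "ennreal ((cmod (lift \<phi> (nbar x)))\<^sup>2) \<le> ennreal (M\<^sup>2) * q (x(first := 1))"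
        unfolding lift_def column_nbar q_def by (subst (asm) ennreal_mult) auto
    qed
    also have "\<dots> = ennreal (M\<^sup>2) * K"
      unfolding K_def by (rule nn_integral_cmult) (rule measurable_compose[OF measurable_upd_const qm])
    finally show ?thesis .
  qed
  ultimately show ?thesis using that by blast
qed

lemma lift_Ind_space:
  fixes \<phi> :: "real^'n::{finite,linorder} \<Rightarrow> complex"
  assumes "Hom \<delta> t \<phi>" "continuous_on (- {0}) \<phi>"
  shows "lift \<phi> \<in> Ind_space (lam \<delta> t)"
proof -
  have "continuous_on (sphere 0 1) \<phi>"
    by (rule continuous_on_subset[OF assms(2)]) auto
  then have "compact (\<phi> ` sphere 0 1)" by (rule compact_continuous_image) simp
  then obtain M where M: "\<And>v. norm v = 1 \<Longrightarrow> cmod (\<phi> v) \<le> M"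
    by (metis bounded_iff compact_imp_bounded imageI mem_sphere_0)
  from nrm2_lift_le obtain K where "K < \<infinity>" "nrm2 (lift \<phi>) \<le> ennreal (M\<^sup>2) * K"
    using assms(1) M by metis
  then have "nrm2 (lift \<phi>) < \<infinity>"
    by (metis ennreal_less_top ennreal_mult_less_top infinity_ennreal_def le_less_trans)
  then show ?thesis using lift_equivar[OF assms] by (simp add: Ind_space_iff)
qed

lemma nrm2_lift_tendsto_0:
  fixes G :: "'a \<Rightarrow> real^'n::{finite,linorder} \<Rightarrow> complex"
  assumes hom: "eventually (\<lambda>z. Hom \<delta> t (G z)) F"
    and small: "\<And>e. e > 0 \<Longrightarrow> eventually (\<lambda>z. \<forall>v. norm v = 1 \<longrightarrow> cmod (G z v) \<le> e) F"
  shows "((\<lambda>z. nrm2 (lift (G z))) \<longlongrightarrow> 0) F"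
proof -
  from nrm2_lift_le obtain K where K: "K < \<infinity>"
    "\<And>\<delta> t (\<phi> :: (real, 'n) vec \<Rightarrow> complex) M. Hom \<delta> t \<phi> \<Longrightarrow>
       (\<And>v. norm v = 1 \<Longrightarrow> cmod (\<phi> v) \<le> M) \<Longrightarrow> nrm2 (lift \<phi>) \<le> ennreal (M\<^sup>2) * K" by blast
  obtain k where k: "K = ennreal k" "k \<ge> 0" using K(1) by (cases K) auto
  show ?thesis
  proof (rule order_tendstoI)
    fix a :: ennreal assume "0 < a"
    then obtain r where r: "0 < r" "ennreal r < a"
      by (metis dense ennreal_cases ennreal_less_zero_iff not_less_iff_gr_or_eq top.not_eq_extremum top_greatest le_less_trans ennreal_less_top)
    define e where "e = sqrt (r / (k + 1))"
    have e: "e > 0" using r k by (simp add: e_def)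
    have "e\<^sup>2 * k = r * (k / (k + 1))" using r k by (simp add: e_def)
    also have "\<dots> \<le> r * 1" using r k by (intro mult_left_mono) auto
    finally have "ennreal (e\<^sup>2) * K \<le> ennreal r"
      using k by (simp add: ennreal_mult[symmetric] ennreal_leI)
    then have *: "ennreal (e\<^sup>2) * K < a" using r(2) by (rule le_less_trans)
    show "eventually (\<lambda>z. nrm2 (lift (G z)) < a) F"
      using hom small[OF e] by eventually_elim (rule le_less_trans[OF K(2) *], auto)
  qed auto
qed

lemma Hom_lincomb:
  "Hom \<delta> t \<phi> \<Longrightarrow> Hom \<delta> t \<psi> \<Longrightarrow> Hom \<delta> t (\<lambda>v. c * \<phi> v + d * \<psi> v)"
  unfolding Hom_def by (simp add: algebra_simps)

lemma Hom_diff: "Hom \<delta> t \<phi> \<Longrightarrow> Hom \<delta> t \<psi> \<Longrightarrow> Hom \<delta> t (\<lambda>v. \<phi> v - \<psi> v)"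
  using Hom_lincomb[of \<delta> t \<phi> \<psi> 1 "-1"] by simp

lemma Hom_cmult: "Hom \<delta> t \<phi> \<Longrightarrow> Hom \<delta> t (\<lambda>v. c * \<phi> v)"
  using Hom_lincomb[of \<delta> t \<phi> \<phi> c 0] by simp

section \<open>Continuity and differentiability of families of homogeneous functions\<close>

lemma nrm2_lift_continuous:
  fixes \<Psi> :: "'e::topological_space \<Rightarrow> real^'n::{finite,linorder} \<Rightarrow> complex"
  assumes U: "open U" "y \<in> U"
    and cont: "continuous_on (U \<times> (- {0})) (\<lambda>(y, v). \<Psi> y v)"
    and hom: "\<And>y. y \<in> U \<Longrightarrow> Hom \<delta> t (\<Psi> y)"
  shows "((\<lambda>z. nrm2 (\<lambda>g. lift (\<Psi> z) g - lift (\<Psi> y) g)) \<longlongrightarrow> 0) (at y)"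
proof -
  have evU: "eventually (\<lambda>z. z \<in> U) (at y)" using U by (rule eventually_at_in_open')
  have "((\<lambda>z. nrm2 (lift (\<lambda>v. \<Psi> z v - \<Psi> y v))) \<longlongrightarrow> 0) (at y)"
  proof (rule nrm2_lift_tendsto_0)
    show "eventually (\<lambda>z. Hom \<delta> t (\<lambda>v. \<Psi> z v - \<Psi> y v)) (at y)"
      using evU by eventually_elim (intro Hom_diff hom U)
  next
    fix e :: real assume "e > 0"
    have "continuous_on (U \<times> sphere 0 1) (\<lambda>(y, v). \<Psi> y v)"
      by (rule continuous_on_subset[OF cont]) auto
    from continuous_on_prod_compactE[OF this compact_sphere U(2) \<open>e > 0\<close>]
    obtain X where X: "y \<in> X" "open X"
      "\<forall>x\<in>X \<inter> U. \<forall>v\<in>sphere 0 1. dist (\<Psi> x v) (\<Psi> y v) \<le> e" unfolding prod.case by metis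
    have "eventually (\<lambda>z. z \<in> X) (at y)" using X by (intro eventually_at_in_open')
    then show "eventually (\<lambda>z. \<forall>v. norm v = 1 \<longrightarrow> cmod (\<Psi> z v - \<Psi> y v) \<le> e) (at y)"
      using evU
    proof eventually_elim
      case (elim z)
      then show ?case using X(3) unfolding dist_norm by (metis IntI mem_sphere_0)
    qed
  qed
  then show ?thesis by (simp add: lift_def[abs_def])
qed

lemma has_vector_derivative_unshift:
  assumes "((\<lambda>h. f (y + h)) has_vector_derivative f') (at (0::real))"
  shows "(f has_vector_derivative f') (at y)"
proof -
  have "((\<lambda>x. x - y) has_vector_derivative 1) (at y)"
    by (auto intro!: derivative_eq_intros)
  from vector_diff_chain_at[OF this, of "\<lambda>h. f (y + h)" f'] assms show ?thesis
    by (simp add: o_def)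
qed

text \<open>A jointly continuous pointwise derivative is a derivative in norm: compactness of the
  sphere makes the continuity uniform in v, and the mean value inequality passes it on to the
  difference quotients.\<close>

lemma nrm2_lift_differentiable:
  fixes \<Psi> \<Psi>' :: "'e::real_normed_vector \<Rightarrow> real^'n::{finite,linorder} \<Rightarrow> complex"
  assumes U: "open U" "y \<in> U"
    and cont: "continuous_on (U \<times> (- {0})) (\<lambda>(y, v). \<Psi>' y v)"
    and hom: "\<And>y. y \<in> U \<Longrightarrow> Hom \<delta> t (\<Psi> y)" "\<And>y. y \<in> U \<Longrightarrow> Hom \<delta> t (\<Psi>' y)"
    and deriv: "\<And>y v. y \<in> U \<Longrightarrow> v \<noteq> 0 \<Longrightarrow>
      ((\<lambda>h. \<Psi> (y + h *\<^sub>R b) v) has_vector_derivative \<Psi>' y v) (at 0)"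
  shows "((\<lambda>h. nrm2 (\<lambda>g. (lift (\<Psi> (y + h *\<^sub>R b)) g - lift (\<Psi> y) g) / of_real h - lift (\<Psi>' y) g)) \<longlongrightarrow> 0) (at (0::real))"
proof -
  have line: "eventually (\<lambda>h. y + h *\<^sub>R b \<in> X) (nhds (0::real))" if "open X" "y \<in> X" for X
  proof -
    have "((\<lambda>h. y + h *\<^sub>R b) \<longlongrightarrow> y + 0 *\<^sub>R b) (nhds (0::real))" by (intro tendsto_intros filterlim_ident)
    then show ?thesis using that by (simp add: topological_tendstoD)
  qed
  have evU: "eventually (\<lambda>h. y + h *\<^sub>R b \<in> U) (at (0::real))"
    using line[OF U] by (simp add: eventually_nhds_conv_at)
  let ?G = "\<lambda>h v. (\<Psi> (y + h *\<^sub>R b) v - \<Psi> y v) / of_real h - \<Psi>' y v"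
  have "((\<lambda>h. nrm2 (lift (?G h))) \<longlongrightarrow> 0) (at 0)"
  proof (rule nrm2_lift_tendsto_0)
    show "eventually (\<lambda>h. Hom \<delta> t (?G h)) (at 0)"
      using evU
    proof eventually_elim
      case (elim h)
      have "Hom \<delta> t (\<lambda>v. inverse (of_real h) * (\<Psi> (y + h *\<^sub>R b) v - \<Psi> y v) - \<Psi>' y v)"
        using elim U by (intro Hom_diff Hom_cmult hom)
      then show ?case by (simp add: field_simps)
    qed
  next
    fix e :: real assume "e > 0"
    have "continuous_on (U \<times> sphere 0 1) (\<lambda>(y, v). \<Psi>' y v)"
      by (rule continuous_on_subset[OF cont]) auto
    from continuous_on_prod_compactE[OF this compact_sphere U(2) \<open>e > 0\<close>]
    obtain X where X: "y \<in> X" "open X"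
      "\<forall>x\<in>X \<inter> U. \<forall>v\<in>sphere 0 1. dist (\<Psi>' x v) (\<Psi>' y v) \<le> e" unfolding prod.case by metis
    have "eventually (\<lambda>h. y + h *\<^sub>R b \<in> X \<inter> U) (nhds (0::real))"
      using line[of "X \<inter> U"] X U by auto
    then obtain d where d: "d > 0" "\<And>h. \<bar>h\<bar> < d \<Longrightarrow> y + h *\<^sub>R b \<in> X \<inter> U"
      unfolding eventually_nhds_metric by (auto simp: dist_real_def)
    have main: "cmod (?G h v) \<le> e" if h: "h \<noteq> 0" "\<bar>h\<bar> < d" and v: "norm v = 1" for h v
    proof -
      \<comment> \<open>With the linear part subtracted, the mean value inequality bounds the error
        of the difference quotient rather than the quotient.\<close>
      let ?k = "\<lambda>s. \<Psi> (y + s *\<^sub>R b) v - s *\<^sub>R \<Psi>' y v"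
      have v0: "v \<noteq> 0" using v by auto
      have k': "(?k has_vector_derivative (\<Psi>' (y + s *\<^sub>R b) v - \<Psi>' y v)) (at s within {-\<bar>h\<bar>..\<bar>h\<bar>})"
        if s: "s \<in> {-\<bar>h\<bar>..\<bar>h\<bar>}" for s
      proof -
        have "\<bar>s\<bar> < d" using s h by auto
        then have yU: "y + s *\<^sub>R b \<in> U" using d by auto
        have "((\<lambda>h. \<Psi> (y + (s + h) *\<^sub>R b) v) has_vector_derivative \<Psi>' (y + s *\<^sub>R b) v) (at 0)"
          using deriv[OF yU v0] by (simp add: algebra_simps)
        then have "((\<lambda>r. \<Psi> (y + r *\<^sub>R b) v) has_vector_derivative \<Psi>' (y + s *\<^sub>R b) v) (at s)"
          by (rule has_vector_derivative_unshift)
        then have "(?k has_vector_derivative (\<Psi>' (y + s *\<^sub>R b) v - \<Psi>' y v)) (at s)"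
          by (auto intro!: derivative_eq_intros)
        then show ?thesis by (rule has_vector_derivative_at_within)
      qed
      have "norm (?k h - ?k 0) \<le> e * norm (h - 0)"
      proof (rule differentiable_bound[OF _ k'[unfolded has_vector_derivative_def]])
        fix s assume s: "s \<in> {-\<bar>h\<bar>..\<bar>h\<bar>}"
        then have "\<bar>s\<bar> < d" using h by auto
        then have "y + s *\<^sub>R b \<in> X \<inter> U" by (rule d)
        then have "norm (\<Psi>' (y + s *\<^sub>R b) v - \<Psi>' y v) \<le> e"
          using X(3) v by (metis dist_norm mem_sphere_0)
        then show "onorm (\<lambda>x. x *\<^sub>R (\<Psi>' (y + s *\<^sub>R b) v - \<Psi>' y v)) \<le> e"
          using \<open>e > 0\<close> by (intro onorm_bound) (auto simp: mult.commute[of e] intro!: mult_left_mono)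
      qed auto
      then have "cmod (?k h - ?k 0) / \<bar>h\<bar> \<le> e" using h by (simp add: field_simps)
      moreover have "?G h v = (?k h - ?k 0) / of_real h"
        using h by (simp add: field_simps scaleR_conv_of_real)
      ultimately show ?thesis by (simp add: norm_divide)
    qed
    have "eventually (\<lambda>h. h \<noteq> 0 \<and> \<bar>h\<bar> < d) (at (0::real))"
      using d(1) by (auto simp: eventually_at dist_real_def intro!: exI[of _ d])
    then show "eventually (\<lambda>h. \<forall>v. norm v = 1 \<longrightarrow> cmod (?G h v) \<le> e) (at 0)"
      by eventually_elim (use main in blast)
  qed
  then show ?thesis by (simp add: lift_def[abs_def])
qed

section \<open>Coboundaries\<close>

lemma shear_vec_cancel: "i \<noteq> j \<Longrightarrow> shear i j s *v (shear i j r *v v) = shear i j (s + r) *v v"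
  by (simp add: matrix_vector_mul_assoc shear_add)

lemma shear_vec_nonzero:
  assumes "i \<noteq> j" "v \<noteq> 0" shows "shear i j s *v v \<noteq> 0"
proof
  assume "shear i j s *v v = 0"
  then have "shear i j (- s) *v (shear i j s *v v) = 0" by simp
  then show False using assms by (simp add: shear_vec_cancel shear_0)
qed

lemma shear_vec_eq_0_iff: "i \<noteq> j \<Longrightarrow> shear i j s *v v = 0 \<longleftrightarrow> v = 0"
  using shear_vec_nonzero by (metis matrix_vector_mult_0_right)

lemma Hom_compose:
  fixes A :: "real^'n^'n"
  assumes "Hom \<delta> t \<phi>" "\<And>v. v \<noteq> 0 \<Longrightarrow> A *v v \<noteq> 0"
  shows "Hom \<delta> t (\<lambda>v. \<phi> (A *v v))"
  using assms unfolding Hom_def by (simp add: matrix_vector_mult_scaleR)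

lemma Hom_shear: "i \<noteq> j \<Longrightarrow> Hom \<delta> t \<phi> \<Longrightarrow> Hom \<delta> t (\<lambda>v. \<phi> (shear i j s *v v))"
  by (rule Hom_compose) (auto simp: shear_vec_nonzero)

lemma continuous_on_shear:
  fixes \<phi> :: "real^'n::finite \<Rightarrow> complex"
  assumes "i \<noteq> j" "continuous_on (- {0}) \<phi>"
  shows "continuous_on (UNIV \<times> (- {0})) (\<lambda>(s, v). \<phi> (shear i j (- s) *v v))"
  unfolding case_prod_beta'
proof (rule continuous_on_compose2[OF assms(2)])
  show "continuous_on (UNIV \<times> (- {0})) (\<lambda>x. shear i j (- fst x) *v snd x)"
    unfolding shear_mult_vec by (intro continuous_intros)
qed (auto simp: shear_vec_eq_0_iff[OF assms(1)])

lemma has_vector_derivative_shift: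
  assumes "(f has_vector_derivative f') (at y)"
  shows "((\<lambda>h. f (y + h)) has_vector_derivative f') (at (0::real))"
proof -
  have "((\<lambda>x. y + x) has_vector_derivative 1) (at 0)"
    by (auto intro!: derivative_eq_intros)
  from vector_diff_chain_at[OF this, of f f'] assms show ?thesis
    by (simp add: o_def)
qed

text \<open>A derivative at s = 0 suffices: by the group law the derivative at s is h at the moved
  point, which is jointly continuous in s and v.\<close>

lemma dInd_lift:
  fixes f h :: "real^'n::{finite,linorder} \<Rightarrow> complex"
  assumes ij: "i \<noteq> j" and f: "Hom \<delta> t f" "continuous_on (- {0}) f"
    and h: "Hom \<delta> t h" "continuous_on (- {0}) h"
    and deriv: "\<And>v. v \<noteq> 0 \<Longrightarrow> ((\<lambda>s. f (shear i j (- s) *v v)) has_vector_derivative h v) (at 0)"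
  shows "dInd (lam \<delta> t) (elem_mat i j) (lift f) (lift h)"
  unfolding dInd_def
proof (intro conjI lift_Ind_space f h)
  let ?\<Psi> = "\<lambda>s v. f (shear i j (- s) *v v)" and ?\<Psi>' = "\<lambda>s v. h (shear i j (- s) *v v)"
  have "((\<lambda>s. nrm2 (\<lambda>g. (lift (?\<Psi> (0 + s *\<^sub>R 1)) g - lift (?\<Psi> 0) g) / of_real s - lift (?\<Psi>' 0) g)) \<longlongrightarrow> 0) (at (0::real))"
  proof (rule nrm2_lift_differentiable[where U = UNIV and \<delta> = \<delta> and t = t])
    show "continuous_on (UNIV \<times> (- {0})) (\<lambda>(y, v). ?\<Psi>' y v)"
      by (rule continuous_on_shear[OF ij h(2)])
    fix y :: real and v :: "(real, 'n) vec" assume "v \<noteq> 0"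
    then show "((\<lambda>s. ?\<Psi> (y + s *\<^sub>R 1) v) has_vector_derivative ?\<Psi>' y v) (at 0)"
      using deriv[OF shear_vec_nonzero[OF ij, of v "-y"]] by (simp add: shear_vec_cancel[OF ij] algebra_simps)
  qed (use Hom_shear[OF ij] f h in auto)
  then show "((\<lambda>s. nrm2 (\<lambda>g. (Ind_act (mat_exp (s *\<^sub>R elem_mat i j)) (lift f) g - lift f g) / of_real s - lift h g)) \<longlongrightarrow> 0) (at (0::real))"
    by (simp add: Ind_act_exp[OF ij] lift_mult shear_0)
qed

lemma L2n_tendsto_0: "((\<lambda>h. nrm2 (F h)) \<longlongrightarrow> 0) A \<Longrightarrow> ((\<lambda>h. L2n (F h)) \<longlongrightarrow> 0) A"
  unfolding L2n_def using tendsto_real_sqrt[OF tendsto_enn2real[of "\<lambda>h. nrm2 (F h)" 0 A]] by simp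

lemma Hom_integral_shear:
  assumes "i \<noteq> j" "Hom \<delta> t f"
  shows "Hom \<delta> t (\<lambda>v. integral A (\<lambda>r. f (shear i j (- r) *v v)))"
  using Hom_shear[OF assms] unfolding Hom_def by simp

lemma continuous_on_integral_shear:
  fixes f :: "real^'n::finite \<Rightarrow> complex"
  assumes "i \<noteq> j" "continuous_on (- {0}) f"
  shows "continuous_on (- {0}) (\<lambda>v. integral {a..b::real} (\<lambda>r. f (shear i j (- r) *v v)))"
proof -
  have "continuous_on ((- {0}) \<times> cbox a b) (\<lambda>(v, r). f (shear i j (- r) *v v))"
    unfolding case_prod_beta'
    by (rule continuous_on_compose2[OF continuous_on_shear[OF assms], where f = "\<lambda>z. (snd z, fst z)", simplified])
      (auto intro!: continuous_intros)
  from integral_continuous_on_param[OF this] show ?thesis by simp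
qed

lemma continuous_on_orbit:
  fixes f :: "real^'n::finite \<Rightarrow> complex"
  assumes "i \<noteq> j" "continuous_on (- {0}) f" "v \<noteq> 0"
  shows "continuous_on A (\<lambda>r. f (shear i j (- r) *v v))"
proof -
  have "continuous_on UNIV (\<lambda>r. case (r, v) of (r, v) \<Rightarrow> f (shear i j (- r) *v v))"
    by (rule continuous_on_compose2[OF continuous_on_shear[OF assms(1,2)]])
      (use assms(3) in \<open>auto intro!: continuous_intros\<close>)
  then have "continuous_on UNIV (\<lambda>r. f (shear i j (- r) *v v))" by simp
  then show ?thesis by (rule continuous_on_subset) simp
qed

text \<open>If \<open>X \<omega> = f\<close>, then \<open>\<pi>(exp TX) \<omega> - \<omega>\<close> is the integral of \<open>\<pi>(exp rX) f\<close> over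
  \<open>[0, T]\<close>, because their difference \<open>c\<close> has derivative \<open>0\<close>. By unitarity these integrals stay
  bounded.\<close>

lemma coboundary_integral_bounded:
  fixes f :: "real^'n::{finite,linorder} \<Rightarrow> complex"
  assumes ij: "i \<noteq> j" and f: "Hom \<delta> t f" "continuous_on (- {0}) f"
    and \<omega>: "dInd (lam \<delta> t) (elem_mat i j) \<omega> (lift f)"
  shows "\<exists>C. \<forall>T\<ge>0. nrm2 (lift (\<lambda>v. integral {0..T} (\<lambda>r. f (shear i j (- r) *v v)))) \<le> ennreal C"
proof -
  let ?k = "\<lambda>v r. f (shear i j (- r) *v v)"
  let ?S = "\<lambda>s F g. F (shear i j (- s) ** g) :: complex"
  \<comment> \<open>This is the integral from 0 to T, based at -1 so that T = 0 is an interior point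
    with two-sided derivatives.\<close>
  define P where "P T v = integral {-1..T} (?k v) - integral {-1..0} (?k v)" for T v
  note kc = continuous_on_orbit[OF ij f(2)]
  have Pd: "((\<lambda>T. P T v) has_vector_derivative ?k v T) (at T)" if "v \<noteq> 0" "T > -1" for v T
  proof -
    have "((\<lambda>u. integral {-1..u} (?k v)) has_vector_derivative ?k v T) (at T within {-1..T+1})"
      by (rule integral_has_vector_derivative) (use that kc in auto)
    moreover have "at T within {-1..T+1} = at T" using that by (intro at_within_Icc_at) auto
    ultimately show ?thesis unfolding P_def by (auto intro!: derivative_eq_intros)
  qed
  have PH: "Hom \<delta> t (P T)" for T
    unfolding P_def by (intro Hom_diff Hom_integral_shear ij f)
  have Pc: "continuous_on (- {0}) (P T)" for T
    unfolding P_def by (intro continuous_intros continuous_on_integral_shear ij f)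
  have PI: "lift (P T) \<in> Ind_space (lam \<delta> t)" for T by (intro lift_Ind_space PH Pc)
  have \<omega>I: "\<omega> \<in> Ind_space (lam \<delta> t)" and fI: "lift f \<in> Ind_space (lam \<delta> t)"
    using \<omega> by (auto simp: dInd_def)
  define c where "c T g = ?S T \<omega> g - \<omega> g - lift (P T) g" for T g
  have cI: "c T \<in> Ind_space (lam \<delta> t)" for T
    unfolding c_def by (intro Ind_space_diff Ind_space_shear ij \<omega>I PI)
  define N where "N T = L2n (c T)" for T
  have R0: "((\<lambda>h. L2n (\<lambda>g. (?S h \<omega> g - \<omega> g) / of_real h - lift f g)) \<longlongrightarrow> 0) (at 0)"
    by (rule L2n_tendsto_0) (use \<omega> in \<open>simp add: dInd_def Ind_act_exp[OF ij]\<close>)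
  have Q0: "((\<lambda>h. L2n (\<lambda>g. (lift (P (T + h)) g - lift (P T) g) / of_real h - lift (\<lambda>v. ?k v T) g)) \<longlongrightarrow> 0) (at 0)"
    if "T > -1" for T
  proof (rule L2n_tendsto_0)
    have "((\<lambda>h. nrm2 (\<lambda>g. (lift (P (T + h *\<^sub>R 1)) g - lift (P T) g) / of_real h - lift ((\<lambda>T v. ?k v T) T) g)) \<longlongrightarrow> 0) (at 0)"
    proof (rule nrm2_lift_differentiable[where U = "{-1<..}" and \<delta> = \<delta> and t = t])
      show "continuous_on ({-1<..} \<times> (- {0})) (\<lambda>(y, v). ?k v y)"
        by (rule continuous_on_subset[OF continuous_on_shear[OF ij f(2)]]) auto
      fix y :: real and v :: "(real, 'n) vec" assume "y \<in> {-1<..}" "v \<noteq> 0"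
      then have "((\<lambda>T. P T v) has_vector_derivative ?k v y) (at y)" by (intro Pd) auto
      then show "((\<lambda>h. P (y + h *\<^sub>R 1) v) has_vector_derivative ?k v y) (at 0)"
        using has_vector_derivative_shift[of "\<lambda>T. P T v" _ y] by simp
    qed (use that PH Hom_shear[OF ij f(1)] in auto)
    then show "((\<lambda>h. nrm2 (\<lambda>g. (lift (P (T + h)) g - lift (P T) g) / of_real h - lift (\<lambda>v. ?k v T) g)) \<longlongrightarrow> 0) (at 0)"
      by simp
  qed
  have N': "(N has_field_derivative 0) (at T)" if "T > -1" for T
  proof -
    let ?r = "\<lambda>h. L2n (\<lambda>g. (?S h \<omega> g - \<omega> g) / of_real h - lift f g) +
       L2n (\<lambda>g. (lift (P (T + h)) g - lift (P T) g) / of_real h - lift (\<lambda>v. ?k v T) g)"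
    have le: "\<bar>(N (T + h) - N T) / h\<bar> \<le> ?r h" if h: "h \<noteq> 0" for h
    proof -
      define R where "R g = (?S h \<omega> g - \<omega> g) / of_real h - lift f g" for g
      define Q where "Q g = (lift (P (T + h)) g - lift (P T) g) / of_real h - lift (\<lambda>v. ?k v T) g" for g
      have kI: "lift (\<lambda>v. ?k v T) \<in> Ind_space (lam \<delta> t)"
        using Ind_space_shear(1)[OF fI ij, of "-T"] by (simp add: lift_mult[abs_def])
      have RI: "R \<in> Ind_space (lam \<delta> t)"
        unfolding R_def divide_inverse mult.commute[of _ "inverse _"]
        by (intro Ind_space_diff Ind_space_shear Ind_space_scale ij \<omega>I fI)
      have QI: "Q \<in> Ind_space (lam \<delta> t)"
        unfolding Q_def divide_inverse mult.commute[of _ "inverse _"]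
        by (intro Ind_space_diff Ind_space_scale kI PI)
      \<comment> \<open>D collects the errors of both difference quotients, so that c(T + h) - c(T)
        = h D. By unitarity the shear by T does not change the norm of R.\<close>
      define D where "D g = ?S T R g - Q g" for g
      have DI: "D \<in> Ind_space (lam \<delta> t)"
        unfolding D_def by (intro Ind_space_diff Ind_space_shear ij RI QI)
      have D: "L2n D \<le> L2n R + L2n Q"
        unfolding D_def using Ind_space_diff(2)[OF Ind_space_shear(1)[OF RI ij] QI] Ind_space_shear(2)[OF RI ij]
        by metis
      have step: "c (T + h) g - c T g = of_real h * D g" for g
      proof -
        have "shear i j (- h) ** (shear i j (- T) ** g) = shear i j (- (T + h)) ** g"
        proof -
          have "- h + - T = - (T + h)" by simp
          then show ?thesis by (simp only: matrix_mul_assoc shear_add[OF ij])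
        qed
        then show ?thesis
          using h unfolding c_def D_def R_def Q_def lift_mult by (simp add: field_simps)
      qed
      have "N (T + h) \<le> N T + \<bar>h\<bar> * L2n D"
      proof -
        have "c (T + h) = (\<lambda>g. c T g + of_real h * D g)"
          using step by (auto simp: fun_eq_iff algebra_simps)
        then show ?thesis unfolding N_def
          using Ind_space_add(2)[OF cI[of T] Ind_space_scale(1)[OF DI, of "of_real h"]]
            Ind_space_scale(2)[OF DI, of "of_real h"] by simp
      qed
      moreover have "N T \<le> N (T + h) + \<bar>h\<bar> * L2n D"
      proof -
        have "c T = (\<lambda>g. c (T + h) g - of_real h * D g)"
          using step by (auto simp: fun_eq_iff algebra_simps)
        then show ?thesis unfolding N_def
          using Ind_space_diff(2)[OF cI[of "T + h"] Ind_space_scale(1)[OF DI, of "of_real h"]]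
            Ind_space_scale(2)[OF DI, of "of_real h"] by simp
      qed
      ultimately have "\<bar>N (T + h) - N T\<bar> \<le> \<bar>h\<bar> * L2n D" by linarith
      then have "\<bar>(N (T + h) - N T) / h\<bar> \<le> L2n D"
        using h by (simp add: abs_divide field_simps)
      then show ?thesis using D unfolding R_def Q_def by linarith
    qed
    have "(?r \<longlongrightarrow> 0 + 0) (at 0)" by (intro tendsto_add R0 Q0 that)
    then have r0: "(?r \<longlongrightarrow> 0) (at 0)" by simp
    have "((\<lambda>h. (N (T + h) - N T) / h) \<longlongrightarrow> 0) (at 0)"
      by (rule Lim_null_comparison[OF _ r0]) (use le in \<open>auto simp: eventually_at_filter\<close>)
    then show ?thesis by (simp add: DERIV_def)
  qed
  have P0: "P 0 v = 0" for v by (simp add: P_def)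
  have N0: "N 0 = 0"
  proof -
    have "c 0 = (\<lambda>g. 0)" by (auto simp: c_def shear_0 lift_def P0)
    then show ?thesis by (simp add: N_def L2n_def nrm2_def)
  qed
  have "\<exists>a. \<forall>T\<in>{-1<..}. N T = a"
    by (rule has_field_derivative_zero_constant) (auto intro!: has_field_derivative_at_within N')
  then have NT: "N T = 0" if "T \<ge> 0" for T
    using N0 that by (metis greaterThan_iff less_le_trans neg_less_0_iff_less zero_less_one)
  have "nrm2 (lift (\<lambda>v. integral {0..T} (?k v))) \<le> ennreal ((2 * L2n \<omega>)\<^sup>2)" if T: "T \<ge> 0" for T
  proof -
    have PT: "P T v = integral {0..T} (?k v)" if "v \<noteq> 0" for v
    proof -
      have "integral {-1..0} (?k v) + integral {0..T} (?k v) = integral {-1..T} (?k v)"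
        by (rule Henstock_Kurzweil_Integration.integral_combine) (use T kc[OF that] in \<open>auto intro!: integrable_continuous_real\<close>)
      then show ?thesis by (simp add: P_def algebra_simps)
    qed
    have nz: "column first (nbar x :: 'n sqmat) \<noteq> 0" for x by (simp add: column_nonzero)
    have "nrm2 (lift (\<lambda>v. integral {0..T} (?k v))) = nrm2 (lift (P T))"
      unfolding nrm2_def lift_def PT[OF nz] ..
    also have "\<dots> = ennreal ((L2n (lift (P T)))\<^sup>2)"
      using PI[of T] by (intro nrm2_L2n) (simp add: Ind_space_iff)
    also have "\<dots> \<le> ennreal ((2 * L2n \<omega>)\<^sup>2)"
    proof (intro ennreal_leI power_mono)
      have eq: "lift (P T) = (\<lambda>g. (?S T \<omega> g - \<omega> g) - c T g)" by (simp add: c_def)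
      have 1: "(\<lambda>g. ?S T \<omega> g - \<omega> g) \<in> Ind_space (lam \<delta> t)"
        by (intro Ind_space_diff Ind_space_shear ij \<omega>I)
      have "L2n (lift (P T)) \<le> L2n (\<lambda>g. ?S T \<omega> g - \<omega> g) + N T"
        unfolding eq N_def by (rule Ind_space_diff(2)[OF 1 cI])
      also have "\<dots> \<le> L2n (?S T \<omega>) + L2n \<omega>"
        using Ind_space_diff(2)[OF Ind_space_shear(1)[OF \<omega>I ij] \<omega>I, of "-T"] NT[OF T] by simp
      also have "\<dots> = 2 * L2n \<omega>" using Ind_space_shear(2)[OF \<omega>I ij, of "-T"] by simp
      finally show "L2n (lift (P T)) \<le> 2 * L2n \<omega>" .
    qed simp
    finally show ?thesis .
  qed
  then show ?thesis by blast
qed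

text \<open>If the orbit integral is at least b in modulus on a box, its squared norm is at least
  b^2 times the volume; unbounded values contradict the estimate for coboundaries. One edge lies in
  [1, 2] to place the box in a slab, while the others may be long or thin.\<close>

lemma not_coboundaryI:
  fixes f :: "real^'n::{finite,linorder} \<Rightarrow> complex"
  assumes ij: "i \<noteq> j" and f: "Hom \<delta> t f" "continuous_on (- {0}) f"
    and large: "\<And>C. \<exists>T\<ge>0. \<exists>lo hi b. (\<forall>m. lo m \<le> hi m) \<and> {lo a..hi a} \<subseteq> {1..2} \<and>
      (\<forall>v. (\<forall>m. v $ m \<in> {lo m..hi m}) \<longrightarrow>
        b \<le> cmod (integral {0..T} (\<lambda>r. f (shear i j (- r) *v v)))) \<and>
      b \<ge> 0 \<and> b\<^sup>2 * (\<Prod>m\<in>UNIV. hi m - lo m) > C"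
  shows "\<nexists>\<omega>. dInd (lam \<delta> t) (elem_mat i j) \<omega> (lift f)"
proof
  assume "\<exists>\<omega>. dInd (lam \<delta> t) (elem_mat i j) \<omega> (lift f)"
  then obtain C where C: "\<And>T. T \<ge> 0 \<Longrightarrow>
      nrm2 (lift (\<lambda>v. integral {0..T} (\<lambda>r. f (shear i j (- r) *v v)))) \<le> ennreal C"
    using coboundary_integral_bounded[OF ij f] by blast
  from large[of "max C 0"] obtain T lo hi b
    where T: "T \<ge> 0" and lh: "\<forall>m. lo m \<le> hi m" "{lo a..hi a} \<subseteq> {1..2}"
      and low: "\<forall>v. (\<forall>m. v $ m \<in> {lo m..hi m}) \<longrightarrow>
        b \<le> cmod (integral {0..T} (\<lambda>r. f (shear i j (- r) *v v)))"
      and b: "b \<ge> 0" "b\<^sup>2 * (\<Prod>m\<in>UNIV. hi m - lo m) > max C 0"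
    by (elim exE conjE) (rule that, assumption+)
  define Q where "Q = Pi\<^sub>E UNIV (\<lambda>m. {lo m..hi m})"
  let ?\<phi> = "\<lambda>v. integral {0..T} (\<lambda>r. f (shear i j (- r) *v v))"
  have Qs: "Q \<in> sets (lebn UNIV)" unfolding Q_def by (intro sets_PiM_I_finite) auto
  have "ennreal (b\<^sup>2 * (\<Prod>m\<in>UNIV. hi m - lo m)) = ennreal (b\<^sup>2) * emeasure (lebn UNIV) Q"
    using lh(1) unfolding Q_def
    by (subst lborel_product.emeasure_PiM) (auto simp: ennreal_mult prod_nonneg prod_ennreal)
  also have "\<dots> = (\<integral>\<^sup>+v. ennreal (b\<^sup>2) * indicator Q v \<partial>lebn UNIV)"
    using Qs by (rule nn_integral_cmult_indicator[symmetric])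
  also have "\<dots> \<le> (\<integral>\<^sup>+v. ennreal ((cmod (?\<phi> (\<chi> m. v m)))\<^sup>2) * indicator Q v \<partial>lebn UNIV)"
  proof (rule nn_integral_mono)
    fix v :: "'n \<Rightarrow> real"
    have "b\<^sup>2 \<le> (cmod (?\<phi> (\<chi> m. v m)))\<^sup>2" if "v \<in> Q"
      using that b(1) by (intro power_mono low[rule_format]) (auto simp: Q_def PiE_iff)
    then show "ennreal (b\<^sup>2) * indicator Q v \<le> ennreal ((cmod (?\<phi> (\<chi> m. v m)))\<^sup>2) * indicator Q v"
      by (cases "v \<in> Q") (auto intro: ennreal_leI)
  qed
  also have "\<dots> \<le> nrm2 (lift ?\<phi>)"
  proof (rule nrm2_lift_slab[OF Hom_integral_shear[OF ij f(1)] continuous_on_integral_shear[OF ij f(2)] Qs])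
    fix v assume "v \<in> Q"
    then have "v a \<in> {lo a..hi a}" by (auto simp: Q_def PiE_iff)
    then show "v a \<in> {1..2}" using lh(2) by (rule subsetD[rotated])
  qed
  also have "\<dots> \<le> ennreal C" by (rule C[OF T])
  also have "\<dots> \<le> ennreal (max C 0)" by (intro ennreal_leI) simp
  finally show False using b(2) by (simp add: ennreal_le_iff)
qed

section \<open>Smooth vectors\<close>

text \<open>The polynomial map \<open>(y, v) \<mapsto> adj(y) v\<close> extends \<open>(y, v) \<mapsto> y\<inverse> v\<close> from \<open>SL\<close> to all matrices.\<close>

definition adjv :: "'n::finite sqmat \<Rightarrow> (real, 'n) vec \<Rightarrow> (real, 'n) vec" where
  "adjv y v = (\<chi> k. det (\<chi> a b. if b = k then v $ a else y $ a $ b))"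

text \<open>Cramer's rule: the determinants defining \<open>adjv\<close> are those with one column
  replaced by v.\<close>

lemma adjv_eq:
  assumes "det y \<noteq> 0" shows "adjv y v = det y *\<^sub>R (matrix_inv y *v v)"
proof -
  obtain B where B: "y ** B = mat 1" using assms by (auto simp: invertible_det_nz[symmetric] invertible_def)
  then have "matrix_inv y = B" by (rule matrix_inv_eqI)
  then have "y *v (matrix_inv y *v v) = v" using B by (simp add: matrix_vector_mul_assoc)
  then have "matrix_inv y *v v = (\<chi> k. det (\<chi> a b. if b = k then v $ a else y $ a $ b) / det y)"
    using cramer[OF assms] by blast
  then show ?thesis using assms by (simp add: adjv_def vec_eq_iff)
qed

lemma adjv_nonzero:
  assumes "det y \<noteq> 0" "v \<noteq> 0" shows "adjv y v \<noteq> 0"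
proof
  assume "adjv y v = 0"
  then have "matrix_inv y *v v = 0" using assms by (simp add: adjv_eq)
  moreover obtain B where B: "y ** B = mat 1" using assms by (auto simp: invertible_det_nz[symmetric] invertible_def)
  ultimately have "y *v (B *v v) = 0" by (simp add: matrix_inv_eqI)
  then show False using B assms by (simp add: matrix_vector_mul_assoc)
qed

lemma adjv_eq_0_iff: "det y \<noteq> 0 \<Longrightarrow> adjv y v = 0 \<longleftrightarrow> v = 0"
  using adjv_nonzero[of y v] by (auto simp: adjv_eq)

lemma adjv_scale: "det y \<noteq> 0 \<Longrightarrow> adjv y (a *\<^sub>R v) = a *\<^sub>R adjv y v"
  by (simp add: adjv_eq matrix_vector_mult_scaleR)

lemma adjv_id: "adjv (mat 1) v = v"
  using matrix_inv_eqI[of "mat 1 :: real^'a^'a" "mat 1"] by (simp add: adjv_eq)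

text \<open>A class of functions of (y, v) closed under directional derivatives in y:
  differentiating a power only shifts its exponent to z - 1. Membership thus provides all iterated
  derivatives together with their joint continuity. The base of a power is positive so that it
  avoids the branch cut.\<close>

inductive smooth_fn :: "('n::finite sqmat \<Rightarrow> (real, 'n) vec \<Rightarrow> complex) \<Rightarrow> bool" where
  const: "smooth_fn (\<lambda>_ _. c)"
| ent: "smooth_fn (\<lambda>y _. of_real (y $ a $ b))"
| vec: "smooth_fn (\<lambda>_ v. of_real (v $ a))"
| add: "smooth_fn H \<Longrightarrow> smooth_fn K \<Longrightarrow> smooth_fn (\<lambda>y v. H y v + K y v)"
| mult: "smooth_fn H \<Longrightarrow> smooth_fn K \<Longrightarrow> smooth_fn (\<lambda>y v. H y v * K y v)"
| powr: "smooth_fn (\<lambda>y v. of_real (R y v)) \<Longrightarrow> (\<And>y v. det y \<noteq> 0 \<Longrightarrow> v \<noteq> 0 \<Longrightarrow> R y v > 0) \<Longrightarrow>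
    smooth_fn (\<lambda>y v. of_real (R y v) powr z)"

abbreviation GLmat :: "'n::finite sqmat set" where "GLmat \<equiv> {y. det y \<noteq> 0}"

lemma smooth_fn_continuous:
  "smooth_fn H \<Longrightarrow> continuous_on (GLmat \<times> (- {0})) (\<lambda>(y, v). H y v)"
  unfolding case_prod_beta'
proof (induction rule: smooth_fn.induct)
  case (powr R z)
  show ?case
  proof (rule continuous_on_powr_complex)
    show "GLmat \<times> (- {0}) \<subseteq> {x. 0 \<le> Re (of_real (R (fst x) (snd x))) \<or> Im (of_real (R (fst x) (snd x))) \<noteq> 0}"
      using powr.hyps(2) by (force simp: less_imp_le)
  next
    fix x :: "'a sqmat \<times> (real, 'a) vec"
    assume "x \<in> GLmat \<times> (- {0})" "complex_of_real (R (fst x) (snd x)) = 0"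
    moreover from this have "R (fst x) (snd x) > 0" by (intro powr.hyps(2)) auto
    ultimately show "Re z > 0" by simp
  qed (use powr.IH in auto)
qed (auto intro!: continuous_intros)

lemma smooth_fn_deriv:
  "smooth_fn H \<Longrightarrow> \<exists>H'. smooth_fn H' \<and> (\<forall>y v. det y \<noteq> 0 \<longrightarrow> v \<noteq> 0 \<longrightarrow>
    ((\<lambda>h. H (y + h *\<^sub>R b) v) has_vector_derivative H' y v) (at 0))"
proof (induction rule: smooth_fn.induct)
  case (const c)
  show ?case by (rule exI[of _ "\<lambda>_ _. 0"]) (auto intro: smooth_fn.const)
next
  case (ent a c)
  show ?case
    by (rule exI[of _ "\<lambda>_ _. of_real (b $ a $ c)"])
      (auto intro!: smooth_fn.const derivative_eq_intros)
next
  case (vec a)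
  show ?case by (rule exI[of _ "\<lambda>_ _. 0"]) (auto intro: smooth_fn.const)
next
  case (add H K)
  then obtain H' K' where *: "smooth_fn H'" "smooth_fn K'"
    "\<forall>y v. det y \<noteq> 0 \<longrightarrow> v \<noteq> 0 \<longrightarrow> ((\<lambda>h. H (y + h *\<^sub>R b) v) has_vector_derivative H' y v) (at 0)"
    "\<forall>y v. det y \<noteq> 0 \<longrightarrow> v \<noteq> 0 \<longrightarrow> ((\<lambda>h. K (y + h *\<^sub>R b) v) has_vector_derivative K' y v) (at 0)"
    by blast
  show ?case
    by (rule exI[of _ "\<lambda>y v. H' y v + K' y v"])
      (use * in \<open>auto intro!: smooth_fn.add has_vector_derivative_add\<close>)
next
  case (mult H K)
  then obtain H' K' where *: "smooth_fn H'" "smooth_fn K'"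
    "\<forall>y v. det y \<noteq> 0 \<longrightarrow> v \<noteq> 0 \<longrightarrow> ((\<lambda>h. H (y + h *\<^sub>R b) v) has_vector_derivative H' y v) (at 0)"
    "\<forall>y v. det y \<noteq> 0 \<longrightarrow> v \<noteq> 0 \<longrightarrow> ((\<lambda>h. K (y + h *\<^sub>R b) v) has_vector_derivative K' y v) (at 0)"
    by blast
  have "((\<lambda>h. H (y + h *\<^sub>R b) v * K (y + h *\<^sub>R b) v) has_vector_derivative H y v * K' y v + H' y v * K y v) (at 0)"
    if "det y \<noteq> 0" "v \<noteq> 0" for y v
    using has_vector_derivative_mult[OF *(3)[rule_format, OF that] *(4)[rule_format, OF that]] by simp
  then show ?case
    by (intro exI[of _ "\<lambda>y v. H y v * K' y v + H' y v * K y v"])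
      (use * mult.hyps in \<open>auto intro!: smooth_fn.add smooth_fn.mult\<close>)
next
  case (powr R z)
  then obtain R' where R': "smooth_fn R'"
    "\<forall>y v. det y \<noteq> 0 \<longrightarrow> v \<noteq> 0 \<longrightarrow> ((\<lambda>h. of_real (R (y + h *\<^sub>R b) v)) has_vector_derivative R' y v) (at 0)"
    by blast
  have "((\<lambda>h. of_real (R (y + h *\<^sub>R b) v) powr z) has_vector_derivative R' y v * (z * of_real (R y v) powr (z - 1))) (at 0)"
    if "det y \<noteq> 0" "v \<noteq> 0" for y v
  proof -
    have "complex_of_real (R (y + 0 *\<^sub>R b) v) \<notin> \<real>\<^sub>\<le>\<^sub>0" using powr.hyps(2)[OF that] by simp
    from field_vector_diff_chain_at[OF R'(2)[rule_format, OF that] has_field_derivative_powr[OF this]]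
    show ?thesis by (simp add: o_def)
  qed
  moreover have "smooth_fn (\<lambda>y v. R' y v * (z * of_real (R y v) powr (z - 1)))"
    using R'(1) powr.hyps by (intro smooth_fn.mult smooth_fn.const smooth_fn.powr)
  ultimately show ?case by blast
qed

lemma smooth_fn_sum: "finite A \<Longrightarrow> (\<And>i. i \<in> A \<Longrightarrow> smooth_fn (f i)) \<Longrightarrow> smooth_fn (\<lambda>y v. \<Sum>i\<in>A. f i y v)"
  by (induction A rule: finite_induct) (auto intro: smooth_fn.const smooth_fn.add)

lemma smooth_fn_prod: "finite A \<Longrightarrow> (\<And>i. i \<in> A \<Longrightarrow> smooth_fn (f i)) \<Longrightarrow> smooth_fn (\<lambda>y v. \<Prod>i\<in>A. f i y v)"
  by (induction A rule: finite_induct) (auto intro: smooth_fn.const smooth_fn.mult)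

lemma smooth_fn_power: "smooth_fn f \<Longrightarrow> smooth_fn (\<lambda>y v. f y v ^ m)"
  by (induction m) (auto intro: smooth_fn.const smooth_fn.mult)

lemma smooth_fn_adjv: "smooth_fn (\<lambda>y v. of_real (adjv y v $ k))"
proof -
  have e: "smooth_fn (\<lambda>y v. of_real (if p i = k then v $ i else y $ i $ p i))" for i and p :: "'a \<Rightarrow> 'a"
    by (cases "p i = k") (auto intro: smooth_fn.vec smooth_fn.ent)
  show ?thesis
    unfolding adjv_def det_def vec_lambda_beta of_real_sum of_real_prod of_real_mult of_real_of_int_eq
    by (intro smooth_fn_sum smooth_fn.mult smooth_fn.const smooth_fn_prod e) (auto simp: finite_permutations)
qed

lemma open_GLmat: "open (GLmat :: 'n::finite sqmat set)"
proof -
  have "continuous_on UNIV (\<lambda>y :: 'n sqmat. det y)"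
    unfolding det_def by (intro continuous_intros)
  then show ?thesis by (intro open_Collect_neq continuous_on_const)
qed

text \<open>Differentiation concerns y and scaling concerns v, so they commute. Openness of GL makes
  homogeneity available at y + h b for all small h.\<close>

lemma Hom_derivative:
  fixes H :: "'n::finite sqmat \<Rightarrow> (real, 'n) vec \<Rightarrow> complex"
  assumes hom: "\<And>y. det y \<noteq> 0 \<Longrightarrow> Hom \<delta> t (H y)"
    and d: "\<And>v. v \<noteq> 0 \<Longrightarrow> ((\<lambda>h. H (y + h *\<^sub>R b) v) has_vector_derivative H' v) (at 0)"
    and y: "det y \<noteq> 0"
  shows "Hom \<delta> t H'"
  unfolding Hom_def
proof (intro allI impI)
  fix a :: real and v :: "(real, 'n) vec" assume av: "a \<noteq> 0" "v \<noteq> 0"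
  let ?c = "hfac CARD('n) \<delta> t a"
  let ?S = "(\<lambda>h. y + h *\<^sub>R b) -` GLmat"
  have S: "open ?S" by (intro open_vimage open_GLmat continuous_intros)
  have "((\<lambda>h. ?c * H (y + h *\<^sub>R b) v) has_vector_derivative ?c * H' v) (at 0)"
    using d[OF av(2)] by (rule has_vector_derivative_mult_right)
  then have "((\<lambda>h. H (y + h *\<^sub>R b) (a *\<^sub>R v)) has_vector_derivative ?c * H' v) (at 0)"
    by (rule has_vector_derivative_transform_within_open[OF _ S])
      (use y av hom in \<open>auto simp: Hom_def\<close>)
  then show "H' (a *\<^sub>R v) = ?c * H' v"
    using d[of "a *\<^sub>R v"] av vector_derivative_unique_at by auto
qed

text \<open>The choice turns an existence statement into an operator that can be iterated along a
  list of directions. For H in \<open>smooth_fn\<close> its values are determined where det y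
  \<noteq> 0 and v \<noteq> 0.\<close>

definition dir_deriv :: "'n::finite sqmat \<Rightarrow> ('n sqmat \<Rightarrow> (real, 'n) vec \<Rightarrow> complex) \<Rightarrow> 'n sqmat \<Rightarrow> (real, 'n) vec \<Rightarrow> complex" where
  "dir_deriv b H = (SOME H'. smooth_fn H' \<and> (\<forall>y v. det y \<noteq> 0 \<longrightarrow> v \<noteq> 0 \<longrightarrow>
    ((\<lambda>h. H (y + h *\<^sub>R b) v) has_vector_derivative H' y v) (at 0)))"

lemma dir_deriv:
  assumes "smooth_fn H"
  shows "smooth_fn (dir_deriv b H)"
    and "det y \<noteq> 0 \<Longrightarrow> v \<noteq> 0 \<Longrightarrow> ((\<lambda>h. H (y + h *\<^sub>R b) v) has_vector_derivative dir_deriv b H y v) (at 0)"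
  using someI_ex[OF smooth_fn_deriv[OF assms, of b]] unfolding dir_deriv_def by blast+

text \<open>On SL the vector \<pi>(y) \<open>lift \<phi>\<close> comes from v \<mapsto>
  \<phi>(adj(y) v), which makes sense on all invertible matrices; this one extension serves at every
  point of SL. Its iterated derivatives are homogeneous of the same type, hence again vectors of the
  representation.\<close>

theorem smooth_lift:
  fixes \<phi> :: "(real, 'n::{finite,linorder}) vec \<Rightarrow> complex"
  assumes hom: "Hom \<delta> t \<phi>" and sm: "smooth_fn (\<lambda>y v. \<phi> (adjv y v))"
  shows "continuous_on (- {0}) \<phi>" and "Ind_smooth_vector (lam \<delta> t) (lift \<phi>)"
proof -
  define \<Psi> where "\<Psi> bs = foldr dir_deriv bs (\<lambda>y v. \<phi> (adjv y v))" for bs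
  have \<Psi>_smooth: "smooth_fn (\<Psi> bs)" for bs
    by (induction bs) (auto simp: \<Psi>_def sm dir_deriv(1))
  have \<Psi>_deriv: "((\<lambda>h. \<Psi> bs (y + h *\<^sub>R b) v) has_vector_derivative \<Psi> (b # bs) y v) (at 0)"
    if "det y \<noteq> 0" "v \<noteq> 0" for bs b y v
    using dir_deriv(2)[OF \<Psi>_smooth that] by (simp add: \<Psi>_def)
  have \<Psi>_hom: "Hom \<delta> t (\<Psi> bs y)" if "det y \<noteq> 0" for bs y
    using that
  proof (induction bs arbitrary: y)
    case Nil
    then show ?case using hom unfolding Hom_def by (simp add: \<Psi>_def adjv_scale adjv_eq_0_iff)
  next
    case (Cons b bs)
    show ?case by (rule Hom_derivative[OF Cons.IH \<Psi>_deriv]) (use Cons.prems in auto)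
  qed
  have \<Psi>_cont: "continuous_on (GLmat \<times> (- {0})) (\<lambda>(y, v). \<Psi> bs y v)" for bs
    by (rule smooth_fn_continuous[OF \<Psi>_smooth])
  have \<Psi>_cont1: "continuous_on (- {0}) (\<Psi> bs y)" if "det y \<noteq> 0" for bs y
  proof -
    have "continuous_on (- {0}) (\<lambda>v. case (y, v) of (y, v) \<Rightarrow> \<Psi> bs y v)"
      by (rule continuous_on_compose2[OF \<Psi>_cont]) (use that in \<open>auto intro!: continuous_intros\<close>)
    then show ?thesis by simp
  qed
  have "continuous_on (- {0}) (\<Psi> [] (mat 1))" by (rule \<Psi>_cont1) simp
  then show cont: "continuous_on (- {0}) \<phi>" by (simp add: \<Psi>_def adjv_id)
  show "Ind_smooth_vector (lam \<delta> t) (lift \<phi>)"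
    unfolding Ind_smooth_vector_def
  proof (intro conjI ballI lift_Ind_space[OF hom cont])
    fix x :: "'n sqmat" assume x: "x \<in> SL"
    have S: "Ind_smooth_on (lam \<delta> t) GLmat (\<lambda>y. lift (\<Psi> [] y))"
      unfolding Ind_smooth_on_def
    proof (intro exI[of _ "\<lambda>bs y. lift (\<Psi> bs y)"] conjI allI impI ballI refl)
      fix bs :: "'n sqmat list" and y :: "'n sqmat" assume y: "y \<in> GLmat"
      show "lift (\<Psi> bs y) \<in> Ind_space (lam \<delta> t)"
        using y by (intro lift_Ind_space \<Psi>_hom \<Psi>_cont1) auto
      show "((\<lambda>z. nrm2 (\<lambda>g. lift (\<Psi> bs z) g - lift (\<Psi> bs y) g)) \<longlongrightarrow> 0) (at y)"
        by (rule nrm2_lift_continuous[OF open_GLmat y \<Psi>_cont]) (auto intro: \<Psi>_hom)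
      fix b :: "'n sqmat"
      show "((\<lambda>h. nrm2 (\<lambda>g. (lift (\<Psi> bs (y + h *\<^sub>R b)) g - lift (\<Psi> bs y) g) / of_real h - lift (\<Psi> (b # bs) y) g)) \<longlongrightarrow> 0) (at 0)"
        by (rule nrm2_lift_differentiable[OF open_GLmat y \<Psi>_cont]) (auto intro: \<Psi>_hom \<Psi>_deriv)
    qed
    have eq: "nrm2 (\<lambda>g. lift (\<Psi> [] y) g - Ind_act y (lift \<phi>) g) = 0" if "y \<in> SL" for y
    proof -
      have "det y = 1" using that by (simp add: SL_def)
      then have "lift (\<Psi> [] y) g = Ind_act y (lift \<phi>) g" for g
        by (simp add: Ind_act_def lift_mult) (simp add: lift_def \<Psi>_def adjv_eq)
      then show ?thesis by (simp add: nrm2_def)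
    qed
    show "\<exists>U \<Phi>. open U \<and> x \<in> U \<and> Ind_smooth_on (lam \<delta> t) U \<Phi> \<and>
        (\<forall>y\<in>U \<inter> SL. nrm2 (\<lambda>g. \<Phi> y g - Ind_act y (lift \<phi>) g) = 0)"
      using open_GLmat S x eq
      by (intro exI[of _ GLmat] exI[of _ "\<lambda>y. lift (\<Psi> [] y)"]) (auto simp: SL_def)
  qed
qed

lemma smooth_fn_norm_powr: "smooth_fn (\<lambda>y v. of_real ((norm (adjv y v))\<^sup>2) powr z)"
proof (rule smooth_fn.powr)
  have "smooth_fn (\<lambda>y v :: (real, 'a) vec. \<Sum>k\<in>UNIV. (of_real (adjv y v $ k) :: complex)\<^sup>2)"
    by (intro smooth_fn_sum smooth_fn_power smooth_fn_adjv) auto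
  moreover have "complex_of_real ((norm v)\<^sup>2) = (\<Sum>k\<in>UNIV. (of_real (v $ k))\<^sup>2)" for v :: "(real, 'a) vec"
    by (simp add: norm_vec_def L2_set_def sum_nonneg flip: of_real_power of_real_sum)
  ultimately show "smooth_fn (\<lambda>y v :: (real, 'a) vec. complex_of_real ((norm (adjv y v))\<^sup>2))"
    by simp
qed (simp add: adjv_nonzero)

section \<open>Homogeneous monomials\<close>

text \<open>This is |v|^(2z); squaring the norm makes the base polynomial, as membership in
  \<open>smooth_fn\<close> demands.\<close>

definition npow :: "complex \<Rightarrow> (real, 'n::finite) vec \<Rightarrow> complex" where
  "npow z v = of_real ((norm v)\<^sup>2) powr z"

lemma cmod_npow: "v \<noteq> 0 \<Longrightarrow> cmod (npow z v) = norm v powr (2 * Re z)"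
  unfolding npow_def by (simp add: norm_powr_real_powr powr_powr[symmetric] powr_numeral)

definition parity :: "pol \<Rightarrow> nat \<Rightarrow> bool" where
  "parity \<delta> m \<longleftrightarrow> (even m \<longleftrightarrow> \<delta> = Pol_plus)"

text \<open>If m has the parity prescribed by \<delta>, the sign of a^m is
  \<open>eps \<delta> a\<close>; the powers of |a| combine to the exponent m + 2z, which is the
  degree of \<open>hfac\<close>.\<close>

lemma hfac_monomial:
  assumes "parity \<delta> m" "of_nat m + 2 * z = - of_nat N / 2 - of_real t * \<i>" "a \<noteq> 0"
  shows "of_real (a ^ m) * of_real (a\<^sup>2) powr z = hfac N \<delta> t a"
proof -
  let ?A = "complex_of_real \<bar>a\<bar>"
  have A0: "?A \<noteq> 0" using assms(3) by simp
  have e: "complex_of_real (sgn a ^ m) = inverse (of_real (eps \<delta> a))"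
    using assms(1,3) by (cases \<delta>) (auto simp: parity_def sgn_if)
  have "a ^ m = sgn a ^ m * \<bar>a\<bar> ^ m" by (metis power_mult_distrib sgn_mult_abs)
  then have 1: "complex_of_real (a ^ m) = of_real (sgn a ^ m) * ?A ^ m" by simp
  have 2: "?A ^ m = ?A powr of_nat m" using A0 by (simp add: powr_nat')
  have 3: "complex_of_real (a\<^sup>2) powr z = ?A powr (2 * z)"
  proof -
    have "ln (a\<^sup>2) = 2 * ln \<bar>a\<bar>" using assms(3) by (metis ln_realpow power2_abs zero_less_abs_iff of_nat_numeral)
    then show ?thesis
      using assms(3) by (simp add: powr_def Ln_of_real mult_ac flip: of_real_power)
  qed
  have "of_real (a ^ m) * of_real (a\<^sup>2) powr z = of_real (sgn a ^ m) * ?A powr (of_nat m + 2 * z)"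
    unfolding 1 2 3 using A0 by (simp add: powr_add)
  also have "?A powr (of_nat m + 2 * z) = ?A powr (of_real (- real N / 2)) * ?A powr (- (of_real t * \<i>))"
    unfolding assms(2) by (simp add: powr_add[symmetric])
  also have "?A powr (of_real (- real N / 2)) = of_real (\<bar>a\<bar> powr (- real N / 2))"
    by (rule powr_of_real) simp
  also have "\<bar>a\<bar> powr (- real N / 2) = (\<bar>a\<bar> ^ N) powr (- 1 / 2)"
    using assms(3) by (simp add: powr_powr flip: powr_realpow)
  finally show ?thesis
    unfolding hfac_def e by (simp add: powr_minus mult_ac)
qed

lemma npow_scale:
  assumes "a \<noteq> 0" "v \<noteq> 0"
  shows "npow z (a *\<^sub>R v) = of_real (a\<^sup>2) powr z * npow z v"
proof -
  have "complex_of_real ((norm (a *\<^sub>R v))\<^sup>2) = of_real (a\<^sup>2) * of_real ((norm v)\<^sup>2)"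
    by (simp add: power_mult_distrib flip: of_real_power of_real_mult)
  then show ?thesis unfolding npow_def by (simp add: powr_times_real flip: of_real_power)
qed

definition monom2 :: "'n::finite \<Rightarrow> nat \<Rightarrow> 'n \<Rightarrow> nat \<Rightarrow> complex \<Rightarrow> (real, 'n) vec \<Rightarrow> complex" where
  "monom2 p A q B z v = of_real (v $ p) ^ A * of_real (v $ q) ^ B * npow z v"

lemma Hom_monom2:
  fixes p q :: "'n::finite"
  assumes "parity \<delta> (A + B)" "of_nat (A + B) + 2 * z = - of_nat CARD('n) / 2 - of_real t * \<i>"
  shows "Hom \<delta> t (monom2 p A q B z)"
  unfolding Hom_def
proof (intro allI impI)
  fix a :: real and v :: "(real, 'n) vec" assume av: "a \<noteq> 0" "v \<noteq> 0"
  show "monom2 p A q B z (a *\<^sub>R v) = hfac CARD('n) \<delta> t a * monom2 p A q B z v"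
    unfolding monom2_def npow_scale[OF av] hfac_monomial[OF assms av(1), symmetric]
    by (simp add: power_mult_distrib power_add mult_ac)
qed

lemma smooth_fn_monom2: "smooth_fn (\<lambda>y v. monom2 p A q B z (adjv y v))"
  unfolding monom2_def npow_def
  by (intro smooth_fn.mult smooth_fn_power smooth_fn_adjv smooth_fn_norm_powr)

text \<open>The generator of a smooth vector is its directional derivative, so it is again homogeneous
  and continuous.\<close>

lemma dInd_smooth_lift:
  fixes f h :: "(real, 'n::{finite,linorder}) vec \<Rightarrow> complex"
  assumes ij: "i \<noteq> j" and f: "Hom \<delta> t f" "smooth_fn (\<lambda>y v. f (adjv y v))"
    and deriv: "\<And>v. v \<noteq> 0 \<Longrightarrow> ((\<lambda>s. f (shear i j (- s) *v v)) has_vector_derivative h v) (at 0)"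
  shows "dInd (lam \<delta> t) (elem_mat i j) (lift f) (lift h)"
proof (rule dInd_lift[OF ij f(1) smooth_lift(1)[OF f] _ _ deriv])
  let ?H = "\<lambda>y v. f (adjv y v)"
  define h' where "h' = dir_deriv (elem_mat i j) ?H (mat 1)"
  have det1: "det (shear i j s) = 1" for s using shear_in_SL[OF ij, of s] by (simp add: SL_def)
  have hom: "Hom \<delta> t (?H y)" if "det y \<noteq> 0" for y
    using f(1) that unfolding Hom_def by (simp add: adjv_scale adjv_eq_0_iff)
  have d': "((\<lambda>s. ?H (mat 1 + s *\<^sub>R elem_mat i j) v) has_vector_derivative h' v) (at 0)" if "v \<noteq> 0" for v
    unfolding h'_def by (rule dir_deriv(2)[OF f(2)]) (use that in auto)
  have eq: "?H (mat 1 + s *\<^sub>R elem_mat i j) v = f (shear i j (- s) *v v)" for s v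
    unfolding shear_def[symmetric] by (simp add: adjv_eq det1 matrix_inv_shear[OF ij])
  have hh': "h v = h' v" if "v \<noteq> 0" for v
    using deriv[OF that] d'[OF that] unfolding eq by (rule vector_derivative_unique_at)
  have "Hom \<delta> t h'"
    by (rule Hom_derivative[OF hom d']) auto
  then show "Hom \<delta> t h" using hh' unfolding Hom_def by simp
  have "continuous_on (- {0}) (\<lambda>v. case (mat 1, v) of (y, v) \<Rightarrow> dir_deriv (elem_mat i j) ?H y v)"
    by (rule continuous_on_compose2[OF smooth_fn_continuous[OF dir_deriv(1)[OF f(2)]]])
      (auto intro!: continuous_intros)
  then have "continuous_on (- {0}) h'" by (simp add: h'_def)
  then show "continuous_on (- {0}) h" using hh' by (simp cong: continuous_on_cong_simp)
qed

section \<open>Derivatives of homogeneous monomials along the one-parameter groups\<close>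

lemma shear_vec_nth: "(shear i j s *v v) $ p = v $ p + (if p = i then s * v $ j else 0)"
  by (simp add: shear_mult_vec axis_def)

lemma norm_shear_vec:
  assumes "i \<noteq> j"
  shows "(norm (shear i j (- s) *v v))\<^sup>2 = (norm v)\<^sup>2 - 2 * s * v $ i * v $ j + s\<^sup>2 * (v $ j)\<^sup>2"
proof -
  have n: "(norm (axis i 1 :: (real, 'a) vec))\<^sup>2 = 1" by (simp add: norm_axis_1)
  have "(norm (x + y))\<^sup>2 = (norm x)\<^sup>2 + 2 * (x \<bullet> y) + (norm y)\<^sup>2" for x y :: "(real, 'a) vec"
    by (simp add: power2_norm_eq_inner inner_add_left inner_add_right inner_commute)
  from this[of v "(- s * v $ j) *\<^sub>R axis i 1"] show ?thesis
    unfolding shear_mult_vec by (simp add: inner_axis power_mult_distrib n)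
qed

lemma npow_shear_deriv:
  assumes ij: "i \<noteq> j" and v: "v \<noteq> 0"
  shows "((\<lambda>s. npow z (shear i j (- s) *v v)) has_vector_derivative
    - 2 * z * of_real (v $ i) * of_real (v $ j) * npow (z - 1) v) (at 0)"
proof -
  let ?f = "\<lambda>s. (norm v)\<^sup>2 - 2 * s * v $ i * v $ j + s\<^sup>2 * (v $ j)\<^sup>2"
  have "((\<lambda>s. complex_of_real (?f s)) has_vector_derivative of_real (- 2 * v $ i * v $ j)) (at 0)"
    by (rule has_vector_derivative_of_real) (auto intro!: derivative_eq_intros)
  moreover have "complex_of_real (?f 0) \<notin> \<real>\<^sub>\<le>\<^sub>0" using v by (simp del: of_real_power)
  ultimately have "((\<lambda>w. w powr z) \<circ> (\<lambda>s. complex_of_real (?f s)) has_vector_derivative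
    of_real (- 2 * v $ i * v $ j) * (z * complex_of_real (?f 0) powr (z - 1))) (at 0)"
    by (intro field_vector_diff_chain_at has_field_derivative_powr)
  then show ?thesis
    unfolding npow_def norm_shear_vec[OF ij] by (simp add: o_def mult_ac)
qed

lemma coord_shear_deriv:
  "((\<lambda>s. complex_of_real ((shear i j (- s) *v v) $ p) ^ A) has_vector_derivative
    (if p = i then - of_nat A * of_real (v $ p) ^ (A - 1) * of_real (v $ j) else 0)) (at 0)"
proof -
  have "((\<lambda>s. ((shear i j (- s) *v v) $ p) ^ A) has_field_derivative
    (if p = i then - of_nat A * (v $ p) ^ (A - 1) * (v $ j) else 0)) (at 0)"
    unfolding shear_vec_nth by (auto intro!: derivative_eq_intros)
  from has_vector_derivative_of_real[OF this, where 'a = complex] show ?thesis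
    by (cases "p = i") simp_all
qed

text \<open>The product rule for -v_j \<partial>_i. Where an exponent is 0, the truncated A - 1 or B
  - 1 is harmless because its coefficient is 0.\<close>

lemma monom2_shear_deriv:
  assumes ij: "i \<noteq> j" and v: "v \<noteq> 0"
  shows "((\<lambda>s. monom2 p A q B z (shear i j (- s) *v v)) has_vector_derivative
    (- of_real (v $ j)) * (
      (if p = i then of_nat A * monom2 p (A - 1) q B z v else 0) +
      (if q = i then of_nat B * monom2 p A q (B - 1) z v else 0) +
      2 * z * of_real (v $ i) * monom2 p A q B (z - 1) v)) (at 0)"
proof -
  have s0: "shear i j (- 0) *v v = v" by (simp add: shear_0)
  from has_vector_derivative_mult[OF has_vector_derivative_mult[OF coord_shear_deriv[of i j v p A] coord_shear_deriv[of i j v q B]]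
      npow_shear_deriv[OF ij v, of z]]
  show ?thesis
    unfolding monom2_def s0 by (auto simp: algebra_simps)
qed

section \<open>Equations without solution\<close>

text \<open>Along the orbit v_l is constant because a \<noteq> l, so v_l F is the derivative of
  -\<psi> and the integral is read off at the endpoints.\<close>

lemma integral_orbit:
  fixes \<psi> F :: "(real, 'n::finite) vec \<Rightarrow> complex"
  assumes al: "a \<noteq> l" and v: "v \<noteq> 0" and T: "T \<ge> 0"
    and d: "\<And>v. v \<noteq> 0 \<Longrightarrow> ((\<lambda>s. \<psi> (shear a l (- s) *v v)) has_vector_derivative - of_real (v $ l) * F v) (at 0)"
  shows "of_real (v $ l) * integral {0..T} (\<lambda>r. F (shear a l (- r) *v v)) = \<psi> v - \<psi> (shear a l (- T) *v v)"
proof -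
  let ?u = "\<lambda>r. shear a l (- r) *v v"
  have "((\<lambda>r. - \<psi> (?u r)) has_vector_derivative of_real (v $ l) * F (?u r)) (at r)" for r
  proof -
    have "?u r $ l = v $ l" using al by (simp add: shear_vec_nth)
    moreover have "shear a l (- s) *v ?u r = ?u (r + s)" for s
      by (simp add: shear_vec_cancel[OF al] algebra_simps)
    ultimately have "((\<lambda>s. \<psi> (?u (r + s))) has_vector_derivative - of_real (v $ l) * F (?u r)) (at 0)"
      using d[OF shear_vec_nonzero[OF al v], of "-r"] by simp
    from has_vector_derivative_minus[OF has_vector_derivative_unshift[OF this]]
    show ?thesis by simp
  qed
  then have "((\<lambda>r. of_real (v $ l) * F (?u r)) has_integral (- \<psi> (?u T) - - \<psi> (?u 0))) {0..T}"
    by (rule fundamental_theorem_of_calculus[OF T has_vector_derivative_at_within])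
  from integral_unique[OF this] show ?thesis by (simp add: shear_0)
qed

text \<open>Near the hyperplane \<open>v\<^sub>l = 0\<close> the integral is of size \<open>\<psi>(v) / v\<^sub>l\<close> as soon as the second
  endpoint has left the box, which is not square integrable.\<close>

lemma no_primitive_hyperplane:
  fixes k l a :: "'n::{finite,linorder}"
  assumes kl: "k \<noteq> l" and al: "a \<noteq> l" and z: "Re z < 0" "real M + 2 * Re z \<le> - 1 / 2"
    and F: "Hom \<delta> t F" "continuous_on (- {0}) F"
    and d: "\<And>v. v \<noteq> 0 \<Longrightarrow> ((\<lambda>s. monom2 k M k 0 z (shear a l (- s) *v v)) has_vector_derivative
      - of_real (v $ l) * F v) (at 0)"
  shows "\<nexists>\<omega>. dInd (lam \<delta> t) (elem_mat a l) \<omega> (lift F)"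
proof (rule not_coboundaryI[OF al F, of a])
  fix C :: real
  let ?\<psi> = "monom2 k M k 0 z"
  let ?N = "real CARD('n)"
  \<comment> \<open>On the box |v| \<le> 2n and v_k \<ge> 1, so |\<psi>(v)| \<ge> 2
    \<open>c1\<close>. As \<psi> has degree at most -1/2 in modulus, |\<psi>| \<le>
    \<open>c1\<close> on vectors of norm at least D \<ge> \<open>c1\<close>^(-2).\<close>
  define c1 where "c1 = (2 * ?N) powr (2 * Re z) / 2"
  define D where "D = 1 + c1 powr (- 2)"
  \<comment> \<open>From v_l \<ge> c/T and v_a \<le> 2, the endpoint has a-th coordinate at most 2 -
    c = -D, hence norm at least D.\<close>
  define c where "c = D + 2"
  \<comment> \<open>The integral is at least \<open>c1\<close> T / (2c) on a box of volume c/T, so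
    \<open>c1\<close>^2 T / (4c) has to exceed C. The summand 2c keeps v_l \<le> 1.\<close>
  define T where "T = 2 * c + 4 * c * (\<bar>C\<bar> + 1) / c1\<^sup>2"
  define lo where "lo m = (if m = l then c / T else 1)" for m
  define hi where "hi m = (if m = l then 2 * c / T else 2)" for m
  have c1: "c1 > 0" by (simp add: c1_def)
  then have D: "D \<ge> 1" "c1 powr (-2) \<le> D" by (auto simp: D_def)
  have c: "c > 2" using D by (simp add: c_def)
  have T2: "T \<ge> 2 * c" using c c1 by (simp add: T_def)
  then have T: "T > 0" using c by linarith
  have Dc: "D powr (real M + 2 * Re z) \<le> c1"
  proof -
    have "D powr (real M + 2 * Re z) \<le> D powr (- 1 / 2)" using D z by (intro powr_mono) auto
    also have "\<dots> \<le> (c1 powr (-2)) powr (- 1 / 2)" using D c1 by (intro powr_mono2') auto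
    also have "\<dots> = c1" using c1 by (simp add: powr_powr)
    finally show ?thesis .
  qed
  have low: "c1 * T / (2 * c) \<le> cmod (integral {0..T} (\<lambda>r. F (shear a l (- r) *v v)))"
    if v: "\<forall>m. v $ m \<in> {lo m..hi m}" for v
  proof -
    let ?u = "shear a l (- T) *v v"
    have vm: "1 \<le> v $ m" "v $ m \<le> 2" if "m \<noteq> l" for m
      using v[rule_format, of m] that by (auto simp: lo_def hi_def)
    have vl: "c / T \<le> v $ l" "v $ l \<le> 2 * c / T" using v[rule_format, of l] by (auto simp: lo_def hi_def)
    have vl0: "v $ l > 0" using vl(1) c T by (meson divide_pos_pos less_le_trans less_trans zero_less_numeral)
    have v0: "v \<noteq> 0" using vl0 by auto
    have "2 * c / T \<le> 2" using T2 T c by (simp add: field_simps)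
    then have "\<bar>v $ m\<bar> \<le> 2" for m using vm[of m] vl vl0 by (cases "m = l") auto
    then have "(\<Sum>m\<in>UNIV. \<bar>v $ m\<bar>) \<le> (\<Sum>m\<in>(UNIV::'n set). 2)" by (intro sum_mono) auto
    then have nv: "norm v \<le> 2 * ?N" using norm_le_l1_cart[of v] by simp
    have "2 * c1 = (2 * ?N) powr (2 * Re z)" by (simp add: c1_def)
    also have "\<dots> \<le> norm v powr (2 * Re z)" using z nv v0 by (intro powr_mono2') auto
    also have "\<dots> \<le> (v $ k) ^ M * norm v powr (2 * Re z)"
      using vm[OF kl] by (simp add: mult_le_cancel_right1 one_le_power)
    also have "\<dots> = cmod (?\<psi> v)"
      using vm[OF kl] v0 by (simp add: monom2_def norm_mult norm_power cmod_npow)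
    finally have 1: "2 * c1 \<le> cmod (?\<psi> v)" .
    have u0: "?u \<noteq> 0" by (rule shear_vec_nonzero[OF al v0])
    have "D \<le> T * v $ l - v $ a"
      using vl(1) T vm[OF al] by (simp add: c_def field_simps)
    also have "\<dots> \<le> \<bar>?u $ a\<bar>" by (simp add: shear_vec_nth)
    also have "\<dots> \<le> norm ?u" by (rule component_le_norm_cart)
    finally have nu: "D \<le> norm ?u" .
    have "cmod (?\<psi> ?u) = \<bar>?u $ k\<bar> ^ M * norm ?u powr (2 * Re z)"
      using u0 by (simp add: monom2_def norm_mult norm_power cmod_npow)
    also have "\<dots> \<le> norm ?u ^ M * norm ?u powr (2 * Re z)"
      by (intro mult_right_mono power_mono component_le_norm_cart) auto
    also have "\<dots> = norm ?u powr (real M + 2 * Re z)" using u0 by (simp add: powr_add powr_realpow)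
    also have "\<dots> \<le> D powr (real M + 2 * Re z)" using nu D z by (intro powr_mono2') auto
    finally have 2: "cmod (?\<psi> ?u) \<le> c1" using Dc by linarith
    have "c1 \<le> cmod (?\<psi> v - ?\<psi> ?u)" using 1 2 norm_triangle_ineq2[of "?\<psi> v" "?\<psi> ?u"] by linarith
    also have "\<dots> = v $ l * cmod (integral {0..T} (\<lambda>r. F (shear a l (- r) *v v)))"
      using T vl0 by (subst integral_orbit[OF al v0 _ d, of T, symmetric]) (auto simp: norm_mult)
    also have "\<dots> \<le> 2 * c / T * cmod (integral {0..T} (\<lambda>r. F (shear a l (- r) *v v)))"
      using vl(2) by (intro mult_right_mono) auto
    finally show ?thesis using T c by (simp add: field_simps)
  qed
  have "(\<Prod>m\<in>UNIV. hi m - lo m) = (\<Prod>m\<in>UNIV. if m = l then c / T else 1)"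
    by (intro prod.cong) (auto simp: hi_def lo_def field_simps)
  then have pr: "(\<Prod>m\<in>UNIV. hi m - lo m) = c / T" by simp
  have "(c1 * T / (2 * c))\<^sup>2 * (c / T) = c1\<^sup>2 * T / (4 * c)"
    using T c by (simp add: power2_eq_square field_simps)
  also have "\<dots> = c1\<^sup>2 / 2 + \<bar>C\<bar> + 1" using c c1 by (simp add: T_def field_simps)
  also have "\<dots> > C" using zero_le_power2[of c1] by linarith
  finally have "C < (c1 * T / (2 * c))\<^sup>2 * (\<Prod>m\<in>UNIV. hi m - lo m)" by (simp add: pr)
  moreover have "\<forall>m. lo m \<le> hi m" using c T by (auto simp: lo_def hi_def field_simps)
  moreover have "{lo a..hi a} \<subseteq> {1..2}" using al by (simp add: lo_def hi_def)
  moreover have "0 \<le> c1 * T / (2 * c)" using c1 T c by simp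
  ultimately show "\<exists>T\<ge>0. \<exists>lo hi b. (\<forall>m. lo m \<le> hi m) \<and> {lo a..hi a} \<subseteq> {1..2} \<and>
      (\<forall>v. (\<forall>m. v $ m \<in> {lo m..hi m}) \<longrightarrow>
        b \<le> cmod (integral {0..T} (\<lambda>r. F (shear a l (- r) *v v)))) \<and>
      b \<ge> 0 \<and> b\<^sup>2 * (\<Prod>m\<in>UNIV. hi m - lo m) > C"
    using T low by (intro exI[of _ T] conjI exI[of _ lo] exI[of _ hi] exI[of _ "c1 * T / (2 * c)"]) auto
qed

text \<open>The primitive \<open>\<sigma> (1 + \<sigma>\<^sup>2)\<^bsup>1 - L/2\<^esup>\<close> minorises the oscillating integral: for large \<open>L\<close> its
  derivative lies below the integrand.\<close>

lemma Re_powr_lower: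
  fixes L t :: real
  assumes L: "L \<ge> 4 + \<bar>t\<bar> / 2" and z: "Re z = - L / 2" "Im z = - t / 2"
  shows "Re (of_real (1 + \<sigma>\<^sup>2) powr z) \<ge> (1 + \<sigma>\<^sup>2) powr (- L / 2) * (1 - (L - 3) * \<sigma>\<^sup>2) + \<sigma>\<^sup>2 * (1 + \<sigma>\<^sup>2) powr (- L / 2)"
proof -
  let ?x = "\<sigma>\<^sup>2"
  have x: "?x \<ge> 0" by simp
  have p: "1 + ?x > 0" using x by linarith
  have c: "cos y \<ge> 1 - \<bar>y\<bar>" for y :: real
  proof -
    have "(sin (y / 2))\<^sup>2 \<le> \<bar>sin (y / 2)\<bar>"
      by (metis abs_ge_zero abs_sin_le_one mult_left_le power2_abs power2_eq_square)
    also have "\<dots> \<le> \<bar>y / 2\<bar>" by (rule abs_sin_x_le_abs_x)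
    finally show ?thesis using cos_double_sin[of "y / 2"] by simp
  qed
  have "Re (of_real (1 + ?x) powr z) = (1 + ?x) powr (- L / 2) * cos (t / 2 * ln (1 + ?x))"
  proof -
    have "complex_of_real (1 + ?x) \<noteq> 0" using p by (simp only: of_real_eq_0_iff)
    then have "of_real (1 + ?x) powr z = exp (z * of_real (ln (1 + ?x)))"
      using p by (simp only: powr_def Ln_of_real if_False)
    moreover have "(1 + ?x) powr (- L / 2) = exp (- L / 2 * ln (1 + ?x))"
      using p by (simp add: powr_def)
    ultimately show ?thesis using z by (simp add: Re_exp)
  qed
  \<comment> \<open>Since ln(1 + x) \<le> x, the phase is at most x |t|/2; the hypothesis L - 4
    \<ge> |t|/2 absorbs it and leaves the extra term x as a gain.\<close>
  moreover have "(1 - (L - 3) * ?x) + ?x \<le> cos (t / 2 * ln (1 + ?x))"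
  proof -
    have "\<bar>t / 2 * ln (1 + ?x)\<bar> \<le> \<bar>t\<bar> / 2 * ?x"
      using ln_add_one_self_le_self[OF x] ln_ge_zero[of "1 + ?x"] by (simp add: abs_mult mult_left_mono)
    moreover have "(L - 4 - \<bar>t\<bar> / 2) * ?x \<ge> 0" using L by (intro mult_nonneg_nonneg) auto
    ultimately show ?thesis using c[of "t / 2 * ln (1 + ?x)"] by (simp add: algebra_simps)
  qed
  then have "(1 + ?x) powr (- L / 2) * ((1 - (L - 3) * ?x) + ?x) \<le> (1 + ?x) powr (- L / 2) * cos (t / 2 * ln (1 + ?x))"
    by (intro mult_left_mono) auto
  ultimately show ?thesis by (simp add: algebra_simps)
qed

lemma primitive_deriv:
  fixes L :: real
  shows "((\<lambda>\<sigma>. \<sigma> * (1 + \<sigma>\<^sup>2) powr (1 - L / 2)) has_real_derivative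
    (1 + \<sigma>\<^sup>2) powr (- L / 2) * (1 - (L - 3) * \<sigma>\<^sup>2)) (at \<sigma>)"
proof -
  have p: "1 + \<sigma>\<^sup>2 > 0" by (simp add: add_pos_nonneg)
  have e: "(1 + \<sigma>\<^sup>2) powr (1 - L / 2) = (1 + \<sigma>\<^sup>2) * (1 + \<sigma>\<^sup>2) powr (- L / 2)"
  proof -
    have "(1 + \<sigma>\<^sup>2) powr (1 + - L / 2) = (1 + \<sigma>\<^sup>2) powr 1 * (1 + \<sigma>\<^sup>2) powr (- L / 2)"
      by (rule powr_add)
    then show ?thesis using p by simp
  qed
  have "((\<lambda>\<sigma>. \<sigma> * (1 + \<sigma>\<^sup>2) powr (1 - L / 2)) has_real_derivative
    1 * (1 + \<sigma>\<^sup>2) powr (1 - L / 2) + (1 - L / 2) * (1 + \<sigma>\<^sup>2) powr (1 - L / 2 - 1) * (2 * \<sigma>) * \<sigma>) (at \<sigma>)"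
    using p by (auto intro!: derivative_eq_intros has_real_derivative_powr')
  moreover have "1 - L / 2 - 1 = - L / 2" by simp
  ultimately show ?thesis unfolding e by (simp add: algebra_simps power2_eq_square)
qed

text \<open>The variable \<sigma> = (x - r c)/w decreases from at least 2 to at most 0, so the
  boundary terms of the primitive have favourable signs. As they may be tiny, the actual bound comes
  from the surplus over its derivative, at least 5^(-L/2) while 1 \<le> \<sigma> \<le> 2, on an
  r-interval of length w/c.\<close>

lemma oscillating_integral_lower:
  fixes L t x w c T :: real
  assumes L: "L \<ge> 4 + \<bar>t\<bar> / 2" and z: "Re z = - L / 2" "Im z = - t / 2"
    and w: "w > 0" and c: "c \<ge> 1" and x: "2 * w \<le> x" "x \<le> T"
  shows "w * 5 powr (- L / 2) \<le> c * cmod (integral {0..T} (\<lambda>r. of_real (1 + ((x - r * c) / w)\<^sup>2) powr z))"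
proof -
  define \<sigma> where "\<sigma> r = (x - r * c) / w" for r
  define G where "G s = s * (1 + s\<^sup>2) powr (1 - L / 2)" for s :: real
  define G' where "G' s = (1 + s\<^sup>2) powr (- L / 2) * (1 - (L - 3) * s\<^sup>2)" for s :: real
  define K where "K r = Re (of_real (1 + (\<sigma> r)\<^sup>2) powr z)" for r
  let ?k = "\<lambda>r. of_real (1 + (\<sigma> r)\<^sup>2) powr z"
  have kc: "continuous_on A ?k" for A
  proof -
    have pos: "1 + (\<sigma> r)\<^sup>2 > 0" for r by (simp add: add_pos_nonneg)
    show ?thesis
    proof (rule continuous_on_powr_complex)
      show "A \<subseteq> {r. 0 \<le> Re (of_real (1 + (\<sigma> r)\<^sup>2)) \<or> Im (of_real (1 + (\<sigma> r)\<^sup>2)) \<noteq> 0}"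
        by auto
    next
      fix r assume "complex_of_real (1 + (\<sigma> r)\<^sup>2) = 0"
      then show "Re z > 0" using pos[of r] by (simp only: of_real_eq_0_iff)
    qed (use w in \<open>auto simp: \<sigma>_def intro!: continuous_intros\<close>)
  qed
  have Kc: "continuous_on A K" for A unfolding K_def by (intro continuous_intros kc)
  have G: "(G has_real_derivative G' s) (at s)" for s
    unfolding G_def[abs_def] G'_def by (rule primitive_deriv)
  have piece: "integral {a..b} K \<ge> w / c * (G (\<sigma> a) - G (\<sigma> b)) + d * (b - a)"
    if "a \<le> b" and le: "\<And>r. r \<in> {a..b} \<Longrightarrow> G' (\<sigma> r) + d \<le> K r" for a b d
  proof -
    have "((\<lambda>r. - w / c * G (\<sigma> r) + d * r) has_vector_derivative G' (\<sigma> r) + d) (at r within {a..b})" for r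
    proof -
      have "(\<sigma> has_real_derivative - c / w) (at r)"
        unfolding \<sigma>_def using w by (auto intro!: derivative_eq_intros)
      from DERIV_chain2[OF G this] have "((\<lambda>r. G (\<sigma> r)) has_real_derivative G' (\<sigma> r) * (- c / w)) (at r)" .
      then have "((\<lambda>r. - w / c * G (\<sigma> r) + d * r) has_real_derivative - w / c * (G' (\<sigma> r) * (- c / w)) + d) (at r)"
        by (auto intro!: derivative_eq_intros)
      then show ?thesis
        using w c by (auto simp: has_real_derivative_iff_has_vector_derivative intro: has_vector_derivative_at_within)
    qed
    then have "((\<lambda>r. G' (\<sigma> r) + d) has_integral (- w / c * G (\<sigma> b) + d * b - (- w / c * G (\<sigma> a) + d * a))) {a..b}"
      using that(1) by (intro fundamental_theorem_of_calculus) auto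
    then have "- w / c * G (\<sigma> b) + d * b - (- w / c * G (\<sigma> a) + d * a) \<le> integral {a..b} K"
      by (rule has_integral_le[OF _ integrable_integral])
        (use le Kc in \<open>auto intro: integrable_continuous_real\<close>)
    then show ?thesis by (simp add: algebra_simps)
  qed
  have K1: "G' (\<sigma> r) + (\<sigma> r)\<^sup>2 * (1 + (\<sigma> r)\<^sup>2) powr (- L / 2) \<le> K r" for r
    unfolding K_def G'_def by (rule Re_powr_lower[OF L z])
  then have K0: "G' (\<sigma> r) + 0 \<le> K r" for r
    by (rule order_trans[rotated]) simp
  \<comment> \<open>\<sigma> equals 2 at \<open>r1\<close> and 1 at \<open>r2\<close>.\<close>
  define r1 where "r1 = (x - 2 * w) / c"
  define r2 where "r2 = (x - w) / c"
  have r12: "0 \<le> r1" "r1 \<le> r2" "r2 \<le> T"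
  proof -
    show "0 \<le> r1" "r1 \<le> r2" using x w c by (auto simp: r1_def r2_def divide_right_mono)
    have "(x - w) * 1 \<le> (x - w) * c" using x w c by (intro mult_left_mono) auto
    then have "r2 \<le> x - w" using c by (simp add: r2_def divide_le_eq)
    then show "r2 \<le> T" using x w by linarith
  qed
  have "w / c * (G (\<sigma> r1) - G (\<sigma> r2)) + 5 powr (- L / 2) * (r2 - r1) \<le> integral {r1..r2} K"
  proof (rule piece[OF r12(2)])
    fix r assume r: "r \<in> {r1..r2}"
    have "r1 * c \<le> r * c" "r * c \<le> r2 * c" using r c by (auto intro: mult_right_mono)
    then have rc: "x - 2 * w \<le> r * c" "r * c \<le> x - w" using c by (auto simp: r1_def r2_def)
    have s: "1 \<le> \<sigma> r" "\<sigma> r \<le> 2" using rc w by (auto simp: \<sigma>_def field_simps)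
    have "(\<sigma> r)\<^sup>2 \<le> 2\<^sup>2" using s by (intro power_mono) auto
    then have "5 powr (- L / 2) \<le> (1 + (\<sigma> r)\<^sup>2) powr (- L / 2)"
      using L by (intro powr_mono2') (auto simp: add_pos_nonneg)
    also have "\<dots> \<le> (\<sigma> r)\<^sup>2 * (1 + (\<sigma> r)\<^sup>2) powr (- L / 2)"
      using s by (simp add: mult_le_cancel_right1 one_le_power)
    finally show "G' (\<sigma> r) + 5 powr (- L / 2) \<le> K r" using K1[of r] by linarith
  qed
  moreover have "w / c * (G (\<sigma> 0) - G (\<sigma> r1)) + 0 * (r1 - 0) \<le> integral {0..r1} K"
    by (rule piece[OF r12(1) K0])
  moreover have "w / c * (G (\<sigma> r2) - G (\<sigma> T)) + 0 * (T - r2) \<le> integral {r2..T} K"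
    by (rule piece[OF r12(3) K0])
  moreover have "integral {0..T} K = integral {0..r1} K + integral {r1..r2} K + integral {r2..T} K"
  proof -
    have "integral {0..r1} K + integral {r1..r2} K = integral {0..r2} K"
      using r12 Kc by (intro Henstock_Kurzweil_Integration.integral_combine integrable_continuous_real) auto
    moreover have "integral {0..r2} K + integral {r2..T} K = integral {0..T} K"
      using r12 Kc by (intro Henstock_Kurzweil_Integration.integral_combine integrable_continuous_real) auto
    ultimately show ?thesis by linarith
  qed
  moreover have "w / c * (G (\<sigma> 0) - G (\<sigma> T)) \<ge> 0"
  proof -
    have "\<sigma> 0 \<ge> 0" using x w by (simp add: \<sigma>_def)
    moreover have "T * 1 \<le> T * c" using c x w by (intro mult_left_mono) auto
    then have "x - T * c \<le> 0" using x by linarith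
    then have "\<sigma> T \<le> 0" unfolding \<sigma>_def using w by (rule divide_nonpos_pos)
    ultimately have "G (\<sigma> 0) \<ge> 0" "G (\<sigma> T) \<le> 0" by (auto simp: G_def mult_nonpos_nonneg)
    then show ?thesis using w c by simp
  qed
  moreover have "r2 - r1 = w / c" using c by (simp add: r1_def r2_def field_simps)
  ultimately have "5 powr (- L / 2) * (w / c) \<le> integral {0..T} K"
    by (simp add: algebra_simps)
  also have "\<dots> = Re (integral {0..T} ?k)"
    unfolding K_def by (rule integral_linear[OF integrable_continuous_real[OF kc] bounded_linear_Re, unfolded o_def])
  also have "\<dots> \<le> cmod (integral {0..T} ?k)" by (rule complex_Re_le_cmod)
  finally show ?thesis using c by (simp add: \<sigma>_def field_simps)
qed

text \<open>Along the lines in direction \<open>e\<^sub>k\<close> a solution would tend to limits whose difference is the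
  total integral, and one of them is not zero.\<close>

lemma no_primitive_line:
  fixes k l c :: "'n::{finite,linorder}"
  assumes kc: "k \<noteq> c" and kl: "k \<noteq> l" and L: "L \<ge> 4 + \<bar>t\<bar> / 2" and z: "Re z = - L / 2" "Im z = - t / 2"
    and F: "Hom \<delta> t (monom2 c 1 l m z)"
  shows "\<nexists>\<omega>. dInd (lam \<delta> t) (elem_mat k c) \<omega> (lift (monom2 c 1 l m z))"
proof (rule not_coboundaryI[OF kc F smooth_lift(1)[OF F smooth_fn_monom2], of c])
  fix C :: real
  let ?N = "real CARD('n)"
  \<comment> \<open>The worst cases over the box: (2n)^2 bounds the transverse part W of |v|^2, and
    5^(-L/2) comes from the one-dimensional estimate.\<close>
  define b where "b = (2 * ?N) powr (- L) * 5 powr (- L / 2)"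
  define T where "T = 4 * ?N + (\<bar>C\<bar> + 1) / b\<^sup>2"
  \<comment> \<open>The long edge is the one along e_k: the bound does not decay with v_k, because
    v_k \<le> T and v_c \<ge> 1 let the line reach v_k = 0 before time T. Starting at 4n ensures v_k
    \<ge> 2w.\<close>
  define lo where "lo m = (if m = k then 4 * ?N else 1)" for m
  define hi where "hi m = (if m = k then T else 2)" for m
  have b: "b > 0" by (simp add: b_def)
  have T: "T \<ge> 4 * ?N" using b by (simp add: T_def)
  then have T0: "T \<ge> 0" by (meson of_nat_0_le_iff mult_nonneg_nonneg order_trans zero_le_numeral)
  have low: "b \<le> cmod (integral {0..T} (\<lambda>r. monom2 c 1 l m z (shear k c (- r) *v v)))"
    if v: "\<forall>m. v $ m \<in> {lo m..hi m}" for v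
  proof -
    have vm: "1 \<le> v $ m" "v $ m \<le> 2" if "m \<noteq> k" for m
      using v[rule_format, of m] that by (auto simp: lo_def hi_def)
    have vk: "4 * ?N \<le> v $ k" "v $ k \<le> T" using v[rule_format, of k] by (auto simp: lo_def hi_def)
    \<comment> \<open>W is the squared distance from the origin to the line v + R e_k, constant
      along the orbit; factoring it out of |v|^2 leaves 1 + \<sigma>^2.\<close>
    define W where "W = (\<Sum>m\<in>- {k}. (v $ m)\<^sup>2)"
    define w where "w = sqrt W"
    have nv: "(norm v)\<^sup>2 = (v $ k)\<^sup>2 + W"
    proof -
      have "(norm v)\<^sup>2 = (\<Sum>m\<in>UNIV. (v $ m)\<^sup>2)" by (simp add: norm_vec_def L2_set_def sum_nonneg)
      also have "\<dots> = (v $ k)\<^sup>2 + W" unfolding W_def Compl_eq_Diff_UNIV by (intro sum.remove) auto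
      finally show ?thesis .
    qed
    have W1: "W \<ge> 1"
    proof -
      have "1 \<le> (v $ c)\<^sup>2" using vm[of c] kc by (simp add: one_le_power)
      also have "\<dots> \<le> W" unfolding W_def using kc by (intro member_le_sum) auto
      finally show ?thesis .
    qed
    have WN: "W \<le> (2 * ?N)\<^sup>2"
    proof -
      have "W \<le> (\<Sum>m\<in>- {k}. 2\<^sup>2)"
        unfolding W_def using vm by (intro sum_mono power_mono) (auto intro: order_trans[of 0 1])
      also have "\<dots> \<le> 4 * ?N" using card_mono[of UNIV "- {k}"] by simp
      also have "\<dots> \<le> (2 * ?N)\<^sup>2" by (simp add: power2_eq_square mult_le_cancel_left1)
      finally show ?thesis .
    qed
    have w: "w \<ge> 1" "w \<le> 2 * ?N" and w2: "w\<^sup>2 = W"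
      using W1 WN by (auto simp: w_def real_le_lsqrt)
    have eq: "monom2 c 1 l m z (shear k c (- r) *v v) =
      of_real (v $ c * (v $ l) ^ m) * of_real W powr z * of_real (1 + ((v $ k - r * v $ c) / w)\<^sup>2) powr z" for r
    proof -
      have "(norm (shear k c (- r) *v v))\<^sup>2 = W * (1 + ((v $ k - r * v $ c) / w)\<^sup>2)"
        using w W1 unfolding norm_shear_vec[OF kc] nv power_divide w2 by (simp add: power2_eq_square field_simps)
      then have "npow z (shear k c (- r) *v v) = of_real W powr z * of_real (1 + ((v $ k - r * v $ c) / w)\<^sup>2) powr z"
        unfolding npow_def using W1 by (simp only: of_real_mult) (intro powr_times_real; simp)
      moreover have "(shear k c (- r) *v v) $ c = v $ c" "(shear k c (- r) *v v) $ l = v $ l"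
        using kc kl by (auto simp: shear_vec_nth)
      ultimately show ?thesis by (simp add: monom2_def)
    qed
    let ?I = "integral {0..T} (\<lambda>r. of_real (1 + ((v $ k - r * v $ c) / w)\<^sup>2) powr z)"
    have "b \<le> W powr (- L / 2) * (w * 5 powr (- L / 2))"
    proof -
      have "(2 * ?N)\<^sup>2 = (2 * ?N) powr 2" by simp
      then have "((2 * ?N)\<^sup>2) powr (- L / 2) = (2 * ?N) powr (2 * (- L / 2))" by (simp only: powr_powr)
      then have "(2 * ?N) powr (- L) = ((2 * ?N)\<^sup>2) powr (- L / 2)" by simp
      also have "\<dots> \<le> W powr (- L / 2)" using W1 WN L by (intro powr_mono2') auto
      finally have "b \<le> W powr (- L / 2) * 5 powr (- L / 2)" unfolding b_def by (intro mult_right_mono) auto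
      also have "\<dots> \<le> W powr (- L / 2) * (w * 5 powr (- L / 2))" using w by (intro mult_left_mono) auto
      finally show ?thesis .
    qed
    also have "\<dots> \<le> W powr (- L / 2) * (v $ c * cmod ?I)"
      using vm[of c] kc w vk by (intro mult_left_mono oscillating_integral_lower[OF L z]) auto
    also have "\<dots> \<le> (v $ l) ^ m * (W powr (- L / 2) * (v $ c * cmod ?I))"
    proof -
      have "1 * (W powr (- L / 2) * (v $ c * cmod ?I)) \<le> (v $ l) ^ m * (W powr (- L / 2) * (v $ c * cmod ?I))"
        using vm[of l] vm[of c] kl kc by (intro mult_right_mono one_le_power mult_nonneg_nonneg) auto
      then show ?thesis by simp
    qed
    also have "\<dots> = cmod (of_real (v $ c * (v $ l) ^ m) * of_real W powr z * ?I)"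
      using vm[of l] vm[of c] kl kc W1 z by (simp add: norm_mult norm_power norm_powr_real_powr)
    also have "\<dots> = cmod (integral {0..T} (\<lambda>r. monom2 c 1 l m z (shear k c (- r) *v v)))"
      unfolding eq by simp
    finally show ?thesis .
  qed
  have "(\<Prod>m\<in>UNIV. hi m - lo m) = (\<Prod>m\<in>UNIV. if m = k then T - 4 * ?N else 1)"
    by (intro prod.cong) (auto simp: hi_def lo_def)
  then have pr: "(\<Prod>m\<in>UNIV. hi m - lo m) = T - 4 * ?N" by simp
  have "C < \<bar>C\<bar> + 1" by linarith
  also have "\<dots> = b\<^sup>2 * (\<Prod>m\<in>UNIV. hi m - lo m)" unfolding pr using b by (simp add: T_def)
  finally have "C < b\<^sup>2 * (\<Prod>m\<in>UNIV. hi m - lo m)" .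
  moreover have "\<forall>m. lo m \<le> hi m" using T by (auto simp: lo_def hi_def)
  moreover have "{lo c..hi c} \<subseteq> {1..2}" using kc by (simp add: lo_def hi_def)
  ultimately show "\<exists>T\<ge>0. \<exists>lo hi b. (\<forall>m. lo m \<le> hi m) \<and> {lo c..hi c} \<subseteq> {1..2} \<and>
      (\<forall>v. (\<forall>m. v $ m \<in> {lo m..hi m}) \<longrightarrow>
        b \<le> cmod (integral {0..T} (\<lambda>r. monom2 c 1 l m z (shear k c (- r) *v v)))) \<and>
      b \<ge> 0 \<and> b\<^sup>2 * (\<Prod>m\<in>UNIV. hi m - lo m) > C"
    using T0 low b by (intro exI[of _ T] conjI exI[of _ lo] exI[of _ hi] exI[of _ b]) auto
qed

section \<open>The two types of commuting pairs\<close>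

lemma elem_mat_eq_iff: "elem_mat i j = elem_mat k l \<longleftrightarrow> i = k \<and> j = l"
proof
  assume "elem_mat i j = elem_mat k l"
  then have "elem_mat i j $ i $ j = elem_mat k l $ i $ j" by simp
  then show "i = k \<and> j = l" by (simp add: elem_mat_def split: if_splits)
qed simp

lemma elem_mat_mult: "elem_mat i j ** elem_mat k l = (if j = k then elem_mat i l else 0)"
proof -
  have "(elem_mat i j ** elem_mat k l) $ a $ b = (if j = k then elem_mat i l else 0) $ a $ b" for a b
  proof -
    have "(elem_mat i j ** elem_mat k l) $ a $ b =
      (\<Sum>m\<in>UNIV. if m = j then (if a = i \<and> j = k \<and> b = l then 1 else 0) else 0)"
      unfolding matrix_matrix_mult_def elem_mat_def vec_lambda_beta by (rule sum.cong) auto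
    then show ?thesis by (simp add: elem_mat_def)
  qed
  then show ?thesis by (simp add: vec_eq_iff)
qed

text \<open>The bracket of u_ij and u_lk is u_ik if j = l, minus u_lj if i = k, so it is nonzero
  only in these cases; both at once would give u_ij = u_kl.\<close>

lemma E_set_cases:
  assumes "elem_mat i j \<in> E_set k l"
  obtains (row) "i = k" "j \<noteq> k" "j \<noteq> l" | (column) "j = l" "i \<noteq> k" "i \<noteq> l"
proof -
  have ij: "i \<noteq> j" "\<not> (i = k \<and> j = l)" "lie_bracket (elem_mat i j) (elem_mat l k) \<noteq> 0"
    using assms by (auto simp: E_set_def elem_mat_eq_iff)
  then have "i = k \<or> j = l" unfolding lie_bracket_def elem_mat_mult by (auto split: if_splits)
  then show ?thesis using ij that by blast
qed

lemma smooth_fn_cmult: "smooth_fn H \<Longrightarrow> smooth_fn (\<lambda>y v. c * H y v)"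
  by (intro smooth_fn.mult smooth_fn.const)

lemma row_case:
  fixes t :: real and k l j :: "'n::{finite,linorder}"
  assumes "j \<noteq> k" "j \<noteq> l" "k \<noteq> l"
  shows "\<exists>f g. Ind_smooth_vector (lam \<delta> t) f \<and> Ind_smooth_vector (lam \<delta> t) g \<and>
    (\<exists>h. dInd (lam \<delta> t) (elem_mat k j) f h \<and> dInd (lam \<delta> t) (elem_mat k l) g h) \<and>
    (\<nexists>\<omega>. dInd (lam \<delta> t) (elem_mat k l) \<omega> f) \<and>
    (\<nexists>\<omega>. dInd (lam \<delta> t) (elem_mat k j) \<omega> g)"
proof -
  \<comment> \<open>The size of q yields the bound on L needed against oscillation; m is then 2q or
    2q + 1, so that the total degree 1 + m of the coordinates has the parity of \<delta>, and z is
    forced by homogeneity.\<close>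
  obtain q :: nat where q: "real q \<ge> 3 + \<bar>t\<bar>" using real_arch_simple by blast
  define m where "m = (if \<delta> = Pol_plus then 2 * q + 1 else 2 * q)"
  define L where "L = real CARD('n) / 2 + 1 + real m"
  define z where "z = - (of_real L + of_real t * \<i>) / 2"
  have z: "Re z = - L / 2" "Im z = - t / 2" by (simp_all add: z_def)
  have L: "L \<ge> 4 + \<bar>t\<bar> / 2" using q by (auto simp: L_def m_def)
  have par: "parity \<delta> (1 + m)" by (cases \<delta>) (simp_all add: parity_def m_def)
  have deg: "of_nat (1 + m) + 2 * z = - of_nat CARD('n) / 2 - of_real t * \<i>"
    by (simp add: z_def L_def field_simps)
  let ?f = "monom2 l 1 l m z" and ?g = "monom2 j 1 l m z"
  note Hf = Hom_monom2[OF par deg, of l l] and Hg = Hom_monom2[OF par deg, of j l]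
  \<comment> \<open>The common value -v_j v_l \<partial>_k \<psi>: since j and l differ from k, the
    coordinate factors of f and g pass through \<partial>_k.\<close>
  define h where "h v = - of_real (v $ j) * (2 * z * of_real (v $ k) * monom2 l 1 l m (z - 1) v)" for v
  have fd: "((\<lambda>s. ?f (shear k j (- s) *v v)) has_vector_derivative h v) (at 0)" if "v \<noteq> 0" for v
    using monom2_shear_deriv[of k j v l 1 l m z] that assms by (simp add: h_def)
  have gd: "((\<lambda>s. ?g (shear k l (- s) *v v)) has_vector_derivative h v) (at 0)" if "v \<noteq> 0" for v
    using monom2_shear_deriv[of k l v j 1 l m z] that assms by (simp add: h_def monom2_def mult_ac)
  have "Ind_smooth_vector (lam \<delta> t) (lift ?f)" "Ind_smooth_vector (lam \<delta> t) (lift ?g)"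
    by (rule smooth_lift(2)[OF Hf smooth_fn_monom2] smooth_lift(2)[OF Hg smooth_fn_monom2])+
  moreover have "dInd (lam \<delta> t) (elem_mat k j) (lift ?f) (lift h)"
    by (rule dInd_smooth_lift[OF _ Hf smooth_fn_monom2 fd]) (use assms in auto)
  moreover have "dInd (lam \<delta> t) (elem_mat k l) (lift ?g) (lift h)"
    by (rule dInd_smooth_lift[OF _ Hg smooth_fn_monom2 gd]) (use assms in auto)
  moreover have "\<nexists>\<omega>. dInd (lam \<delta> t) (elem_mat k l) \<omega> (lift ?f)"
    by (rule no_primitive_line[OF _ _ L z Hf]) (use assms in auto)
  moreover have "\<nexists>\<omega>. dInd (lam \<delta> t) (elem_mat k j) \<omega> (lift ?g)"
    by (rule no_primitive_line[OF _ _ L z Hg]) (use assms in auto)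
  ultimately show ?thesis by blast
qed

lemma column_case:
  fixes t :: real and k l i :: "'n::{finite,linorder}"
  assumes n: "CARD('n) \<ge> 3" and "i \<noteq> k" "i \<noteq> l" "k \<noteq> l"
  shows "\<exists>f g. Ind_smooth_vector (lam \<delta> t) f \<and> Ind_smooth_vector (lam \<delta> t) g \<and>
    (\<exists>h. dInd (lam \<delta> t) (elem_mat i l) f h \<and> dInd (lam \<delta> t) (elem_mat k l) g h) \<and>
    (\<nexists>\<omega>. dInd (lam \<delta> t) (elem_mat k l) \<omega> f) \<and>
    (\<nexists>\<omega>. dInd (lam \<delta> t) (elem_mat i l) \<omega> g)"
proof -
  \<comment> \<open>\<psi> must have degree 1 - n/2 - it and the parity opposite to \<delta>, since
    one derivative lowers the degree by 1 and flips the parity; a factor v_k^M with M = 0 or 1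
    achieves this.\<close>
  define M :: nat where "M = (if \<delta> = Pol_plus then 1 else 0)"
  define z where "z = (1 - of_nat M - of_nat CARD('n) / 2 - of_real t * \<i>) / 2"
  have Rz: "real M + 2 * Re z = 1 - real CARD('n) / 2" by (simp add: z_def field_simps)
  \<comment> \<open>Here n \<ge> 3 enters: the real part 1 - n/2 of the degree of \<psi> is at most
    -1/2.\<close>
  then have z: "Re z < 0" "real M + 2 * Re z \<le> - 1 / 2" using n by auto
  have par: "parity \<delta> (M + 1 + 0)" by (cases \<delta>) (simp_all add: parity_def M_def)
  have deg: "of_nat (M + 1 + 0) + 2 * (z - 1) = - of_nat CARD('n) / 2 - of_real t * \<i>"
    by (simp add: z_def field_simps)
  let ?\<psi> = "monom2 k M k 0 z"
  define f where "f v = of_nat M * monom2 k (M - 1) k 0 z v + 2 * z * monom2 k (M + 1) k 0 (z - 1) v" for v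
  define g where "g v = 2 * z * monom2 k M i 1 (z - 1) v" for v
  have Hf: "Hom \<delta> t f"
  proof -
    have 2: "Hom \<delta> t (monom2 k (M + 1) k 0 (z - 1))" by (rule Hom_monom2[OF par deg])
    show ?thesis
    \<comment> \<open>For M = 0 the first monomial of f has coefficient 0 but, with M - 1 truncated
      to 0, the wrong degree; it must be discarded before homogeneity is invoked.\<close>
    proof (cases "M = 0")
      case True
      then show ?thesis using Hom_cmult[OF 2, of "2 * z"] by (simp add: f_def[abs_def])
    next
      case False
      then have M: "M = 1" "\<delta> = Pol_plus" by (auto simp: M_def split: if_splits)
      have "Hom \<delta> t (monom2 k (M - 1) k 0 z)"
        by (rule Hom_monom2) (use M in \<open>simp_all add: parity_def z_def\<close>)
      from Hom_lincomb[OF this 2] show ?thesis unfolding f_def[abs_def] .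
    qed
  qed
  have Hg: "Hom \<delta> t g"
    unfolding g_def[abs_def] by (intro Hom_cmult Hom_monom2) (use par deg in simp_all)
  have Sf: "smooth_fn (\<lambda>y v. f (adjv y v))" and Sg: "smooth_fn (\<lambda>y v. g (adjv y v))"
    unfolding f_def g_def by (intro smooth_fn.add smooth_fn_cmult smooth_fn_monom2)+
  have psi_k: "((\<lambda>s. ?\<psi> (shear k l (- s) *v v)) has_vector_derivative - of_real (v $ l) * f v) (at 0)"
    if "v \<noteq> 0" for v
    using monom2_shear_deriv[OF \<open>k \<noteq> l\<close> that, of k M k 0 z]
    by (simp add: f_def monom2_def algebra_simps)
  have psi_i: "((\<lambda>s. ?\<psi> (shear i l (- s) *v v)) has_vector_derivative - of_real (v $ l) * g v) (at 0)"
    if "v \<noteq> 0" for v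
    using monom2_shear_deriv[OF \<open>i \<noteq> l\<close> that, of k M k 0 z] \<open>i \<noteq> k\<close>
    by (simp add: g_def monom2_def algebra_simps)
  \<comment> \<open>This is -v_l \<partial>_i \<partial>_k \<psi>. Both generators multiply by the
    same v_l, so the cocycle equation is the symmetry of second derivatives.\<close>
  define h where "h v = - of_real (v $ l) * (2 * z * of_real (v $ i) * (of_nat M * monom2 k (M - 1) k 0 (z - 1) v +
    2 * (z - 1) * monom2 k (M + 1) k 0 (z - 2) v))" for v
  have fd: "((\<lambda>s. f (shear i l (- s) *v v)) has_vector_derivative h v) (at 0)" if "v \<noteq> 0" for v
  proof -
    have "((\<lambda>s. f (shear i l (- s) *v v)) has_vector_derivative
      of_nat M * (- of_real (v $ l) * (2 * z * of_real (v $ i) * monom2 k (M - 1) k 0 (z - 1) v)) +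
      2 * z * (- of_real (v $ l) * (2 * (z - 1) * of_real (v $ i) * monom2 k (M + 1) k 0 (z - 1 - 1) v))) (at 0)"
      unfolding f_def
      using monom2_shear_deriv[OF \<open>i \<noteq> l\<close> that, of k "M - 1" k 0 z]
        monom2_shear_deriv[OF \<open>i \<noteq> l\<close> that, of k "M + 1" k 0 "z - 1"] \<open>i \<noteq> k\<close>
      by (intro has_vector_derivative_add has_vector_derivative_mult_right) simp_all
    then show ?thesis by (simp add: h_def algebra_simps)
  qed
  have gd: "((\<lambda>s. g (shear k l (- s) *v v)) has_vector_derivative h v) (at 0)" if "v \<noteq> 0" for v
  proof -
    have "((\<lambda>s. g (shear k l (- s) *v v)) has_vector_derivative
      2 * z * (- of_real (v $ l) * (of_nat M * monom2 k (M - 1) i 1 (z - 1) v +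
        2 * (z - 1) * of_real (v $ k) * monom2 k M i 1 (z - 1 - 1) v))) (at 0)"
      unfolding g_def
      using monom2_shear_deriv[OF \<open>k \<noteq> l\<close> that, of k M i 1 "z - 1"] \<open>i \<noteq> k\<close>
      by (intro has_vector_derivative_mult_right) simp
    then show ?thesis by (simp add: h_def monom2_def algebra_simps)
  qed
  have "Ind_smooth_vector (lam \<delta> t) (lift f)" "Ind_smooth_vector (lam \<delta> t) (lift g)"
    by (rule smooth_lift(2)[OF Hf Sf] smooth_lift(2)[OF Hg Sg])+
  moreover have "dInd (lam \<delta> t) (elem_mat i l) (lift f) (lift h)"
    by (rule dInd_smooth_lift[OF \<open>i \<noteq> l\<close> Hf Sf fd])
  moreover have "dInd (lam \<delta> t) (elem_mat k l) (lift g) (lift h)"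
    by (rule dInd_smooth_lift[OF \<open>k \<noteq> l\<close> Hg Sg gd])
  \<comment> \<open>The same \<psi> is a primitive in both directions: a = k treats the equation for
    f, and a = i the one for g.\<close>
  moreover have "\<nexists>\<omega>. dInd (lam \<delta> t) (elem_mat k l) \<omega> (lift f)"
    by (rule no_primitive_hyperplane[OF \<open>k \<noteq> l\<close> \<open>k \<noteq> l\<close> z Hf smooth_lift(1)[OF Hf Sf] psi_k])
  moreover have "\<nexists>\<omega>. dInd (lam \<delta> t) (elem_mat i l) \<omega> (lift g)"
    by (rule no_primitive_hyperplane[OF \<open>k \<noteq> l\<close> \<open>i \<noteq> l\<close> z Hg smooth_lift(1)[OF Hg Sg] psi_i])
  ultimately show ?thesis by blast
qed

theorem theorem2p4:
  fixes t :: real and \<delta> :: pol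
    and k l i j :: "'n::{finite,linorder}"
  assumes "CARD('n) \<ge> 3"
    and "k \<noteq> l"
    and "elem_mat i j \<in> E_set k l"
  shows "\<exists>f g. Ind_smooth_vector (lam \<delta> t) f \<and> Ind_smooth_vector (lam \<delta> t) g \<and>
    (\<exists>h. dInd (lam \<delta> t) (elem_mat i j) f h \<and> dInd (lam \<delta> t) (elem_mat k l) g h) \<and>
    (\<nexists>\<omega>. dInd (lam \<delta> t) (elem_mat k l) \<omega> f) \<and>
    (\<nexists>\<omega>. dInd (lam \<delta> t) (elem_mat i j) \<omega> g)"
  using assms(3)
proof (cases rule: E_set_cases)
  case row
  then show ?thesis using row_case[OF _ _ assms(2)] by blast
next
  case column
  then show ?thesis using column_case[OF assms(1) _ _ assms(2)] by blast
qed

end
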